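(* Let $n\ge 2$, let $\lambda\vdash n-1$ and let $\sigma\in S_n$. For each $i\in\{1,\dots,n\}$ with $\sigma(i)\neq i$, the permutation $\sigma\cdot(i\;\sigma(i))$ has a fixed point; let $\chi^\lambda(\sigma\cdot(i\;\sigma(i)))$ denote the value of $\chi^\lambda$ at any permutation of $S_{n-1}$ whose cycle type is obtained from that of $\sigma\cdot(i\;\sigma(i))$ by deleting one part equal to $1$. Then \[ \sum_{i:\ \sigma(i)\neq i}\chi^{\lambda}\bigl(\sigma\cdot(i\;\sigma(i))\bigr)=\sum_{x}c(x)\,\chi^{\lambda+x}(\sigma), \] where the sum on the right runs over all cells $x$ not in the Ferrers diagram $F_\lambda$ such that $F_\lambda\cup\{x\}$ is the Ferrers diagram of a partition $\lambda+x\vdash n$.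
   Context: For a partition $\mu\vdash m$, $\chi^\mu$ denotes the irreducible character of $S_m$ indexed by $\mu$; it is a class function, so its value depends only on cycle type. $(a\;b)$ denotes a transposition. The Ferrers diagram $F_\lambda$ of $\lambda=(\lambda_1\ge\dots\ge\lambda_k>0)$ is the set of cells $(i,j)$ with $1\le i\le k$, $1\le j\le\lambda_i$ (row $i$, column $j$, rows numbered top to bottom). The content of a cell $x=(i,j)$ is $c(x)=j-i$. *)

theory Defs
  imports
    Complex_Main
    "HOL-Library.Multiset"
    "HOL-Library.Function_Algebras"
    "HOL-Combinatorics.Orbits"
begin

section \<open>Partitions and Ferrers diagrams\<close>

definition is_partition :: "nat \<Rightarrow> nat list \<Rightarrow> bool" where
  "is_partition m \<mu> \<longleftrightarrow> sorted_wrt (\<ge>) \<mu> \<and> (\<forall>k\<in>set \<mu>. k > 0) \<and> sum_list \<mu> = m"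

definition ferrers :: "nat list \<Rightarrow> (nat \<times> nat) set" where
  "ferrers \<mu> = {(i, j). 1 \<le> i \<and> i \<le> length \<mu> \<and> 1 \<le> j \<and> j \<le> \<mu> ! (i - 1)}"

definition cell_content :: "nat \<times> nat \<Rightarrow> int" where
  "cell_content x = int (snd x) - int (fst x)"

definition addable_cells :: "nat list \<Rightarrow> (nat \<times> nat) set" where
  "addable_cells \<mu> = {x. x \<notin> ferrers \<mu> \<and>
     (\<exists>\<nu>. is_partition (sum_list \<mu> + 1) \<nu> \<and> ferrers \<nu> = insert x (ferrers \<mu>))}"

definition add_cell :: "nat list \<Rightarrow> nat \<times> nat \<Rightarrow> nat list" where
  "add_cell \<mu> x = (THE \<nu>. is_partition (sum_list \<mu> + 1) \<nu> \<and> ferrers \<nu> = insert x (ferrers \<mu>))"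


section \<open>Trace of a linear map on a space of complex-valued functions\<close>

definition fun_scale :: "complex \<Rightarrow> ('a \<Rightarrow> complex) \<Rightarrow> 'a \<Rightarrow> complex" where
  "fun_scale c f = (\<lambda>x. c * f x)"

global_interpretation fun_space: vector_space "fun_scale :: complex \<Rightarrow> ('a \<Rightarrow> complex) \<Rightarrow> 'a \<Rightarrow> complex"
  by unfold_locales (auto simp: fun_scale_def fun_eq_iff algebra_simps)

text \<open>
  \<open>trace_on V T\<close> is the trace of \<open>T\<close> restricted to a finite-dimensional \<open>T\<close>-invariant subspace
  \<open>V\<close>: the sum of the diagonal entries of its matrix in some basis of \<open>V\<close>.
\<close>
definition trace_on :: "('a \<Rightarrow> complex) set \<Rightarrow> (('a \<Rightarrow> complex) \<Rightarrow> 'a \<Rightarrow> complex) \<Rightarrow> complex" where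
  "trace_on V T =
     (let B = (SOME B. fun_space.independent B \<and> fun_space.span B = V)
      in \<Sum>b\<in>B. fun_space.representation B (T b) b)"


section \<open>The group algebra of the symmetric group\<close>

text \<open>
  The group algebra of \<open>S\<^sub>m\<close> over the complex numbers consists of the functions supported on
  \<open>sym_grp m\<close>; the function \<open>f\<close> stands for the formal sum of the \<open>f g \<cdot> g\<close>.
  Products of permutations are compositions (the right factor acts first).
\<close>
definition sym_grp :: "nat \<Rightarrow> (nat \<Rightarrow> nat) set" where
  "sym_grp m = {p. p permutes {1..m}}"

definition grp_alg :: "nat \<Rightarrow> ((nat \<Rightarrow> nat) \<Rightarrow> complex) set" where
  "grp_alg m = {f. \<forall>g. g \<notin> sym_grp m \<longrightarrow> f g = 0}"

definition grp_elt :: "(nat \<Rightarrow> nat) \<Rightarrow> (nat \<Rightarrow> nat) \<Rightarrow> complex" where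
  "grp_elt \<sigma> = (\<lambda>g. if g = \<sigma> then 1 else 0)"

definition grp_mult ::
  "nat \<Rightarrow> ((nat \<Rightarrow> nat) \<Rightarrow> complex) \<Rightarrow> ((nat \<Rightarrow> nat) \<Rightarrow> complex) \<Rightarrow> (nat \<Rightarrow> nat) \<Rightarrow> complex" where
  "grp_mult m f h = (\<lambda>g. \<Sum>x\<in>sym_grp m. f x * h (inv x \<circ> g))"


section \<open>Young symmetrizers and the irreducible characters\<close>

text \<open>
  The canonical tableau of shape \<open>\<mu>\<close>, with the numbers \<open>1, \<dots>, m\<close> filled in row by row.
\<close>
definition tableau :: "nat list \<Rightarrow> nat \<times> nat \<Rightarrow> nat" where
  "tableau \<mu> x = sum_list (take (fst x - 1) \<mu>) + snd x"

definition row_group :: "nat list \<Rightarrow> (nat \<Rightarrow> nat) set" where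
  "row_group \<mu> = {p \<in> sym_grp (sum_list \<mu>).
     \<forall>(i, j)\<in>ferrers \<mu>. \<exists>j'. (i, j') \<in> ferrers \<mu> \<and> p (tableau \<mu> (i, j)) = tableau \<mu> (i, j')}"

definition column_group :: "nat list \<Rightarrow> (nat \<Rightarrow> nat) set" where
  "column_group \<mu> = {q \<in> sym_grp (sum_list \<mu>).
     \<forall>(i, j)\<in>ferrers \<mu>. \<exists>i'. (i', j) \<in> ferrers \<mu> \<and> q (tableau \<mu> (i, j)) = tableau \<mu> (i', j)}"

definition row_symmetrizer :: "nat list \<Rightarrow> (nat \<Rightarrow> nat) \<Rightarrow> complex" where
  "row_symmetrizer \<mu> = (\<Sum>p\<in>row_group \<mu>. grp_elt p)"

definition column_antisymmetrizer :: "nat list \<Rightarrow> (nat \<Rightarrow> nat) \<Rightarrow> complex" where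
  "column_antisymmetrizer \<mu> = (\<Sum>q\<in>column_group \<mu>. fun_scale (of_int (sign q)) (grp_elt q))"

definition young_symmetrizer :: "nat list \<Rightarrow> (nat \<Rightarrow> nat) \<Rightarrow> complex" where
  "young_symmetrizer \<mu> =
     grp_mult (sum_list \<mu>) (row_symmetrizer \<mu>) (column_antisymmetrizer \<mu>)"

text \<open>
  The Specht module as the left ideal generated by the Young symmetrizer. With row symmetrization
  and column antisymmetrization, the partition \<open>(m)\<close> gives the trivial and \<open>(1, \<dots>, 1)\<close> the sign
  representation.
\<close>
definition specht_module :: "nat list \<Rightarrow> ((nat \<Rightarrow> nat) \<Rightarrow> complex) set" where
  "specht_module \<mu> = (\<lambda>f. grp_mult (sum_list \<mu>) f (young_symmetrizer \<mu>)) ` grp_alg (sum_list \<mu>)"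

definition irr_char :: "nat list \<Rightarrow> (nat \<Rightarrow> nat) \<Rightarrow> complex" where
  "irr_char \<mu> \<sigma> = trace_on (specht_module \<mu>) (grp_mult (sum_list \<mu>) (grp_elt \<sigma>))"


section \<open>Cycle types\<close>

text \<open>Fixed points count as cycles of length 1.\<close>
definition cycle_type :: "nat \<Rightarrow> (nat \<Rightarrow> nat) \<Rightarrow> nat multiset" where
  "cycle_type m \<sigma> = image_mset card (mset_set (orbit \<sigma> ` {1..m}))"

text \<open>
  The value of the character at any permutation of cycle type \<open>M\<close>; it is meaningful because
  \<open>irr_char \<mu>\<close> is a class function, and \<open>M\<close> has to be the cycle type of some permutation.
\<close>
definition irr_char_at_type :: "nat list \<Rightarrow> nat multiset \<Rightarrow> complex" where
  "irr_char_at_type \<mu> M =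
     (THE v. \<exists>\<tau>\<in>sym_grp (sum_list \<mu>). cycle_type (sum_list \<mu>) \<tau> = M \<and> v = irr_char \<mu> \<tau>)"

end

theory Submission
  imports Defs "HOL-Library.Poly_Mapping"
begin

text \<open>
  Let \<open>m = n - 1\<close>, let \<open>e\<close> be the primitive idempotent of the group algebra of \<open>S\<^sub>m\<close> given by a Young
  symmetrizer of shape \<open>\<mu>\<close>, and let \<open>X\<close> be the sum of the transpositions \<open>(a n)\<close> with \<open>a < n\<close>. Both sides
  of the identity are the trace of \<open>g \<mapsto> \<sigma> g X e\<close> on the group algebra of \<open>S\<^sub>n\<close>. Evaluated on the basis
  of permutations the trace gives the left-hand side, since \<open>e\<close> is supported on permutations fixing \<open>n\<close>.
  On the other hand \<open>e\<close> is an orthogonal sum of idempotents equivalent to the primitive idempotents of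
  shape \<open>\<mu> + x\<close> (the branching rule), and \<open>X\<close>, a difference of two central class sums, acts on the
  summand of \<open>x\<close> by the content of \<open>x\<close>.

  For the branching rule, the Young symmetrizer of \<open>\<mu> + x\<close> is a multiple of \<open>a c b\<close>, where \<open>c\<close> is the one
  of \<open>\<mu>\<close> and \<open>a\<close>, \<open>b\<close> are the row and column sums of \<open>\<mu> + x\<close>. Hence every expected summand occurs in
  the induced and in the restricted module, which bounds the dimensions \<open>f\<close> from both sides:
  \<open>(m + 1) f(\<mu>) \<ge> (\<Sum>x. f(\<mu> + x))\<close> and \<open>f(\<nu>) \<ge> (\<Sum>y. f(\<nu> - y))\<close>. The commutation relation of adding and
  removing cells forces equality by induction, so nothing else occurs.
\<close>

section \<open>Traces of projections\<close>

text \<open>Modules are handled as left ideals \<open>A e\<close> of idempotents \<open>e\<close> of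
  the group algebra \<open>A\<close>, and \<open>e A e'\<close> plays the role of the homomorphisms
  between two of them. A dimension is then the trace of a projection, hence a natural number. The
  counting rests on this: the part of an induced module that is not yet accounted for is cut out by
  an idempotent, and the idempotent vanishes as soon as its trace does.

  Semisimplicity enters through the adjoint \<open>star\<close>. The identity coefficient of
  \<open>star u * u\<close> is a sum of squared moduli, so \<open>u * star u * u = 0\<close> forces
  \<open>u = 0\<close>. This makes the square of a Young symmetrizer nonzero, and it makes
  orthogonality of two shapes symmetric in them. It is therefore enough to compare shapes by a
  single number, the sum of the column indices of the cells, which takes over the part of the
  dominance order.\<close>

lemma fun_space_finite_sum_apply:
  fixes f :: "'b \<Rightarrow> 'a \<Rightarrow> complex"
  shows "(\<Sum>x\<in>A. f x) y = (\<Sum>x\<in>A. f x y)"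
  by (induction A rule: infinite_finite_induct) auto

lemma indicator_expansion:
  fixes v :: "'a \<Rightarrow> complex"
  assumes "finite S" "\<And>x. x \<notin> S \<Longrightarrow> v x = 0"
  shows "v = (\<Sum>g\<in>S. fun_scale (v g) (\<lambda>h. if h = g then 1 else 0))"
  using assms
  by (auto simp: fun_eq_iff fun_space_finite_sum_apply fun_scale_def if_distrib[of "(*) _"] sum.delta'
      cong: if_cong)

text \<open>One basis serves every \<open>T\<close>, because the choice in \<open>trace_on\<close>
  depends on \<open>V\<close> alone. It is finite since it is independent and lies in the span of
  the point indicators of \<open>S\<close>.\<close>

lemma trace_on_basis:
  assumes "finite S" "fun_space.subspace V" "V \<subseteq> {f. \<forall>x. x \<notin> S \<longrightarrow> f x = 0}"
  obtains B where "fun_space.independent B" "fun_space.span B = V" "finite B"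
    "\<And>T. trace_on V T = (\<Sum>b\<in>B. fun_space.representation B (T b) b)"
proof -
  define B where "B = (SOME B. fun_space.independent B \<and> fun_space.span B = V)"
  obtain B' where B': "B' \<subseteq> V" "fun_space.independent B'" "V \<subseteq> fun_space.span B'"
    using fun_space.maximal_independent_subset by blast
  then have "fun_space.span B' = V"
    using assms(2) by (meson fun_space.span_minimal subset_antisym)
  with B' have B: "fun_space.independent B \<and> fun_space.span B = V"
    unfolding B_def by (intro someI[of "\<lambda>B. fun_space.independent B \<and> fun_space.span B = V"]) auto
  let ?D = "(\<lambda>g. (\<lambda>h. if h = g then 1 else 0 :: complex)) ` S"
  have "B \<subseteq> fun_space.span ?D"
  proof
    fix b assume "b \<in> B"
    then have "b \<in> V" using B fun_space.span_superset by blast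
    then have "b = (\<Sum>g\<in>S. fun_scale (b g) (\<lambda>h. if h = g then 1 else 0))"
      using assms by (intro indicator_expansion) auto
    also have "\<dots> \<in> fun_space.span ?D"
      by (intro fun_space.span_sum fun_space.span_scale fun_space.span_base) auto
    finally show "b \<in> fun_space.span ?D" .
  qed
  then have "finite B"
    using fun_space.independent_span_bound[of ?D B] B assms(1) by simp
  moreover have "trace_on V T = (\<Sum>b\<in>B. fun_space.representation B (T b) b)" for T
    unfolding trace_on_def B_def[symmetric] Let_def ..
  ultimately show thesis using B that by blast
qed

text \<open>The trace of \<open>T\<close> on \<open>V\<close> is the trace of \<open>T\<close> after
  the projection \<open>P\<close> on all functions supported on \<open>S\<close>. This trades the
  unknown basis of \<open>V\<close> for the point indicators: each basis vector \<open>b\<close>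
  equals \<open>P b\<close> and is expanded in them.\<close>

lemma trace_on_eq_sum:
  fixes P T :: "('a \<Rightarrow> complex) \<Rightarrow> 'a \<Rightarrow> complex"
  assumes "finite S" and V: "fun_space.subspace V" "V \<subseteq> {f. \<forall>x. x \<notin> S \<longrightarrow> f x = 0}"
    and linP: "Vector_Spaces.linear fun_scale fun_scale P"
    and linT: "Vector_Spaces.linear fun_scale fun_scale T"
    and PV: "\<And>f. (\<And>x. x \<notin> S \<Longrightarrow> f x = 0) \<Longrightarrow> P f \<in> V" and P_id: "\<And>f. f \<in> V \<Longrightarrow> P f = f"
    and TV: "\<And>f. f \<in> V \<Longrightarrow> T f \<in> V"
  shows "trace_on V T = (\<Sum>g\<in>S. T (P (\<lambda>h. if h = g then 1 else 0)) g)"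
proof -
  interpret P: Vector_Spaces.linear fun_scale fun_scale P by fact
  interpret T: Vector_Spaces.linear fun_scale fun_scale T by fact
  obtain B where B: "fun_space.independent B" "fun_space.span B = V" "finite B"
    and tr: "trace_on V T = (\<Sum>b\<in>B. fun_space.representation B (T b) b)"
    using trace_on_basis[OF assms(1-3)] by blast
  let ?R = "fun_space.representation B"
  define D where "D g = (\<lambda>h. if h = g then 1 else 0 :: complex)" for g :: 'a
  have D: "T (P (D g)) \<in> V" if "g \<in> S" for g
    using that by (intro TV PV) (auto simp: D_def)
  have "?R (T b) b = (\<Sum>g\<in>S. b g * ?R (T (P (D g))) b)" if "b \<in> B" for b
  proof -
    have bV: "b \<in> V" using that B fun_space.span_superset by blast
    have "T b = T (P b)" using P_id bV by simp
    also have "P b = P (\<Sum>g\<in>S. fun_scale (b g) (D g))"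
      unfolding D_def using indicator_expansion[of S b] V(2) bV assms(1) by auto
    also have "T \<dots> = (\<Sum>g\<in>S. fun_scale (b g) (T (P (D g))))"
      by (simp add: P.sum T.sum P.scale T.scale)
    finally have "?R (T b) b = ?R (\<Sum>g\<in>S. fun_scale (b g) (T (P (D g)))) b" by simp
    also have "\<dots> = (\<Sum>g\<in>S. ?R (fun_scale (b g) (T (P (D g)))) b)"
      using B D by (subst fun_space.representation_sum) (auto intro: fun_space.span_scale)
    also have "\<dots> = (\<Sum>g\<in>S. b g * ?R (T (P (D g))) b)"
      using B D by (intro sum.cong refl) (simp add: fun_space.representation_scale)
    finally show ?thesis .
  qed
  then have "trace_on V T = (\<Sum>b\<in>B. \<Sum>g\<in>S. b g * ?R (T (P (D g))) b)"
    by (simp add: tr)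
  also have "\<dots> = (\<Sum>g\<in>S. (\<Sum>b\<in>B. fun_scale (?R (T (P (D g))) b) b) g)"
    by (subst sum.swap) (simp add: fun_space_finite_sum_apply fun_scale_def mult.commute)
  also have "\<dots> = (\<Sum>g\<in>S. T (P (D g)) g)"
    using D B by (intro sum.cong refl) (simp add: fun_space.sum_representation_eq)
  finally show ?thesis unfolding D_def .
qed

text \<open>The trace of an idempotent matrix is its rank: on the range of the projection the
  identity map has trace the number of basis vectors. Rank zero leaves only the zero matrix.\<close>

lemma idempotent_matrix_trace:
  fixes M :: "'a \<Rightarrow> 'a \<Rightarrow> complex"
  assumes fin: "finite S"
    and idem: "\<And>g h. g \<in> S \<Longrightarrow> h \<in> S \<Longrightarrow> (\<Sum>k\<in>S. M g k * M k h) = M g h"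
  obtains d :: nat where "(\<Sum>g\<in>S. M g g) = of_nat d"
    "d = 0 \<Longrightarrow> \<forall>g\<in>S. \<forall>h\<in>S. M g h = 0"
proof -
  define P :: "('a \<Rightarrow> complex) \<Rightarrow> 'a \<Rightarrow> complex"
    where "P f = (\<lambda>h. if h \<in> S then \<Sum>g\<in>S. f g * M g h else 0)" for f
  have linP: "Vector_Spaces.linear fun_scale fun_scale P"
    by unfold_locales
      (auto simp: P_def fun_eq_iff fun_scale_def algebra_simps sum.distrib sum_distrib_left)
  interpret P: Vector_Spaces.linear fun_scale fun_scale P by fact
  have PP: "P (P f) = P f" for f
  proof
    fix h
    show "P (P f) h = P f h"
    proof (cases "h \<in> S")
      case True
      then have "P (P f) h = (\<Sum>k\<in>S. \<Sum>g\<in>S. f g * M g k * M k h)"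
        by (simp add: P_def sum_distrib_right)
      also have "\<dots> = (\<Sum>g\<in>S. f g * (\<Sum>k\<in>S. M g k * M k h))"
        by (subst sum.swap) (simp add: sum_distrib_left mult.assoc)
      also have "\<dots> = P f h" using True idem by (simp add: P_def)
      finally show ?thesis .
    qed (simp add: P_def)
  qed
  let ?V = "range P"
  have V: "fun_space.subspace ?V"
    using P.subspace_image[OF fun_space.subspace_UNIV] .
  have supp: "?V \<subseteq> {f. \<forall>x. x \<notin> S \<longrightarrow> f x = 0}"
    by (auto simp: P_def)
  have lin_id: "Vector_Spaces.linear fun_scale fun_scale (\<lambda>f :: 'a \<Rightarrow> complex. f)"
    using fun_space.linear_ident .
  obtain B where B: "fun_space.independent B" "fun_space.span B = ?V" "finite B"
    and tr: "\<And>T. trace_on ?V T = (\<Sum>b\<in>B. fun_space.representation B (T b) b)"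
    using trace_on_basis[OF fin V supp] by blast
  have P_D: "P (\<lambda>h. if h = g then 1 else 0) h = M g h" if "g \<in> S" "h \<in> S" for g h
    using that fin by (simp add: P_def if_distrib[of "\<lambda>x. x * _"] cong: if_cong)
  have "(\<Sum>g\<in>S. M g g) = (\<Sum>g\<in>S. P (\<lambda>h. if h = g then 1 else 0) g)"
    using P_D by simp
  also have "\<dots> = trace_on ?V (\<lambda>f. f)"
    by (rule trace_on_eq_sum[OF fin V supp linP lin_id, symmetric]) (use PP in auto)
  also have "\<dots> = of_nat (card B)"
    unfolding tr using B by (simp add: fun_space.representation_basis)
  finally have "(\<Sum>g\<in>S. M g g) = of_nat (card B)" .
  then show thesis
  proof (rule that)
    assume "card B = 0"
    then have "B = {}" using B by simp
    then have "P f = 0" for f using B(2) by auto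
    then show "\<forall>g\<in>S. \<forall>h\<in>S. M g h = 0" using P_D by (metis zero_fun_apply)
  qed
qed

section \<open>Group algebras\<close>

type_synonym 'g group_ring = "'g \<Rightarrow>\<^sub>0 complex"

abbreviation coef :: "'g group_ring \<Rightarrow> 'g \<Rightarrow> complex" where
  "coef \<equiv> Poly_Mapping.lookup"

abbreviation gel :: "'g \<Rightarrow> 'g group_ring" where
  "gel g \<equiv> Poly_Mapping.single g 1"

abbreviation scal :: "complex \<Rightarrow> ('g::group_add) group_ring" where
  "scal \<equiv> Poly_Mapping.single 0"

definition galg :: "'g set \<Rightarrow> 'g group_ring set" where
  "galg S = {f. Poly_Mapping.keys f \<subseteq> S}"

lemma galg_iff: "f \<in> galg S \<longleftrightarrow> (\<forall>g. g \<notin> S \<longrightarrow> coef f g = 0)"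
  unfolding galg_def by (auto simp: in_keys_iff)

lemma coef_mult:
  fixes f h :: "('g::group_add) group_ring"
  assumes "f \<in> galg S" "finite S"
  shows "coef (f * h) k = (\<Sum>l\<in>S. coef f l * coef h (- l + k))"
proof -
  have *: "(k = l + q) = (q = - l + k)" for l q :: 'g
    by (metis add.assoc add_0 left_minus right_minus)
  have "coef (f * h) k = (\<Sum>l. coef f l * coef h (- l + k))"
    by (simp add: Poly_Mapping.lookup_mult *)
  also have "\<dots> = (\<Sum>l\<in>S. coef f l * coef h (- l + k))"
    using assms by (intro Sum_any.expand_superset) (auto simp: galg_iff)
  finally show ?thesis .
qed

lemma coef_mult_right:
  fixes f h :: "('g::group_add) group_ring"
  assumes "h \<in> galg S" "finite S"
  shows "coef (f * h) k = (\<Sum>l\<in>S. coef f (k - l) * coef h l)"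
proof -
  let ?A = "Poly_Mapping.keys f \<union> (\<lambda>l. k - l) ` S"
  have "coef (f * h) k = (\<Sum>l\<in>?A. coef f l * coef h (- l + k))"
    using assms by (intro coef_mult) (auto simp: galg_def)
  also have "\<dots> = (\<Sum>l\<in>(\<lambda>l. k - l) ` S. coef f l * coef h (- l + k))"
  proof (rule sum.mono_neutral_right)
    show "\<forall>i\<in>?A - (\<lambda>l. k - l) ` S. coef f i * coef h (- i + k) = 0"
    proof
      fix i assume "i \<in> ?A - (\<lambda>l. k - l) ` S"
      then have "i \<notin> (\<lambda>l. k - l) ` S" by simp
      moreover have "i = k - (- i + k)" by (simp add: diff_conv_add_uminus minus_add del: add_uminus_conv_diff)
      ultimately have "- i + k \<notin> S" by blast
      then show "coef f i * coef h (- i + k) = 0" using assms by (auto simp: galg_iff)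
    qed
  qed (use assms in auto)
  also have "\<dots> = (\<Sum>l\<in>S. coef f (k - l) * coef h l)"
    by (subst sum.reindex) (auto simp: inj_on_def diff_conv_add_uminus minus_add add.assoc simp del: add_uminus_conv_diff)
  finally show ?thesis .
qed

lemma gel_in_galg [simp]: "gel g \<in> galg S \<longleftrightarrow> g \<in> S"
  by (auto simp: galg_def)

lemma coef_gel: "coef (gel g) h = (if h = g then 1 else 0)"
  by (auto simp: lookup_single)

lemma gel_mult: "gel g * gel h = gel (g + h)"
  by (simp add: mult_single)

lemma gel_zero [simp]: "gel 0 = 1"
  by simp

lemma coef_gel_mult [simp]:
  fixes f :: "('g::group_add) group_ring"
  shows "coef (gel g * f) k = coef f (- g + k)"
  by (subst coef_mult[of _ "{g}"]) auto

lemma coef_mult_gel [simp]: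
  fixes f :: "('g::group_add) group_ring"
  shows "coef (f * gel g) k = coef f (k - g)"
  by (subst coef_mult_right[of _ "{g}"]) auto

lemma coef_scal_mult [simp]:
  fixes f :: "('g::group_add) group_ring"
  shows "coef (scal a * f) k = a * coef f k"
  by (subst coef_mult[of _ "{0}"]) (auto simp: galg_def split: if_splits)

lemma scal_commute:
  fixes f :: "('g::group_add) group_ring"
  shows "f * scal a = scal a * f"
proof (rule poly_mapping_eqI)
  fix k
  have "coef (f * scal a) k = coef f k * a"
    by (subst coef_mult_right[of _ "{0}"]) (auto simp: galg_def split: if_splits)
  then show "coef (f * scal a) k = coef (scal a * f) k" by simp
qed

lemma scal_left_commute:
  fixes f :: "('g::group_add) group_ring"
  shows "f * (scal a * h) = scal a * (f * h)"
proof -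
  have "f * (scal a * h) = (f * scal a) * h" by (simp only: mult.assoc)
  then show ?thesis by (simp only: scal_commute mult.assoc)
qed

lemma scal_mult_gel: "scal a * gel g = Poly_Mapping.single g a"
  by (simp add: mult_single)

lemma scal_mult_assoc:
  fixes f :: "('g::group_add) group_ring"
  shows "scal a * (scal b * f) = scal (a * b) * f"
  by (simp add: mult_single flip: mult.assoc)

lemma scal_mult_mult_scal:
  fixes f h :: "('g::group_add) group_ring"
  shows "(scal a * f) * (scal b * h) = scal (a * b) * (f * h)"
proof -
  have "(scal a * f) * (scal b * h) = scal a * (f * (scal b * h))" by (rule mult.assoc)
  also have "f * (scal b * h) = scal b * (f * h)" by (rule scal_left_commute)
  finally show ?thesis by (simp only: scal_mult_assoc)
qed

lemma scal_one [simp]: "scal 1 = 1"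
  by simp

lemma group_ring_expansion:
  fixes f :: "('g::group_add) group_ring"
  assumes "f \<in> galg S" "finite S"
  shows "f = (\<Sum>g\<in>S. scal (coef f g) * gel g)"
proof (rule poly_mapping_eqI)
  fix k show "coef f k = coef (\<Sum>g\<in>S. scal (coef f g) * gel g) k"
    using assms by (auto simp: lookup_sum scal_mult_gel lookup_single when_def galg_iff)
qed

section \<open>The adjoint involution and its positivity\<close>

lift_definition star :: "('g::group_add) group_ring \<Rightarrow> 'g group_ring" is
  "\<lambda>f g. cnj (f (- g))"
proof -
  fix f :: "'g \<Rightarrow> complex" assume "finite {x. f x \<noteq> 0}"
  then have "finite (uminus ` {x. f x \<noteq> 0})" by simp
  moreover have "{x. cnj (f (- x)) \<noteq> 0} \<subseteq> uminus ` {x. f x \<noteq> 0}"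
    by (auto intro!: image_eqI[of _ uminus "- x" for x])
  ultimately show "finite {x. cnj (f (- x)) \<noteq> 0}" by (rule finite_subset[rotated])
qed

lemma coef_star [simp]: "coef (star f) g = cnj (coef f (- g))"
  by transfer simp

lemma star_star [simp]: "star (star f) = f"
  by (rule poly_mapping_eqI) simp

lemma star_mult:
  fixes f h :: "('g::group_add) group_ring"
  shows "star (f * h) = star h * star f"
proof (rule poly_mapping_eqI)
  fix k
  let ?S = "Poly_Mapping.keys f"
  have f: "f \<in> galg ?S" by (simp add: galg_def)
  have f': "star f \<in> galg (uminus ` ?S)"
    by (auto simp: galg_def in_keys_iff intro!: image_eqI[of _ uminus "- x" for x])
  have "coef (star (f * h)) k = (\<Sum>l\<in>?S. cnj (coef f l) * cnj (coef h (- l - k)))"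
    by (simp add: coef_mult[OF f])
  also have "\<dots> = (\<Sum>l\<in>uminus ` ?S. cnj (coef f (- l)) * cnj (coef h (l - k)))"
    by (subst sum.reindex) (auto simp: inj_on_def)
  also have "\<dots> = coef (star h * star f) k"
    by (subst coef_mult_right[OF f']) (auto simp: mult.commute)
  finally show "coef (star (f * h)) k = coef (star h * star f) k" .
qed

text \<open>The coefficient of \<open>star u * u\<close> at the identity is the sum of the squared
  moduli of the coefficients of \<open>u\<close>.\<close>

lemma star_mult_self_eq_0:
  fixes u :: "('g::group_add) group_ring"
  assumes "star u * u = 0"
  shows "u = 0"
proof (rule poly_mapping_eqI)
  fix k
  let ?S = "Poly_Mapping.keys u"
  have u: "u \<in> galg ?S" by (simp add: galg_def)
  have "0 = coef (star u * u) 0" using assms by simp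
  also have "\<dots> = (\<Sum>l\<in>?S. coef u l * cnj (coef u l))"
    by (subst coef_mult_right[OF u]) (auto simp: mult.commute)
  also have "\<dots> = of_real (\<Sum>l\<in>?S. (cmod (coef u l))\<^sup>2)"
    unfolding of_real_sum by (intro sum.cong refl) (rule complex_norm_square[symmetric])
  finally have "(\<Sum>l\<in>?S. (cmod (coef u l))\<^sup>2) = 0"
    by (metis of_real_eq_0_iff)
  then show "coef u k = coef 0 k"
    by (auto simp: sum_nonneg_eq_0_iff in_keys_iff)
qed

text \<open>The element \<open>w = star u * u\<close> is self-adjoint with \<open>w * w = 0\<close>,
  so positivity applies first to \<open>w\<close> and then to \<open>u\<close>.\<close>

lemma star_nilpotent_eq_0:
  fixes u :: "('g::group_add) group_ring"
  assumes "u * star u * u = 0"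
  shows "u = 0"
proof -
  have "star (star u * u) * (star u * u) = star u * (u * star u * u)"
    by (simp add: star_mult mult.assoc)
  then have "star u * u = 0" using assms star_mult_self_eq_0 by simp
  then show ?thesis by (rule star_mult_self_eq_0)
qed

lemma coef_mult_commute_0:
  fixes f h :: "('g::group_add) group_ring"
  shows "coef (f * h) 0 = coef (h * f) 0"
proof -
  let ?S = "Poly_Mapping.keys f"
  have f: "f \<in> galg ?S" by (simp add: galg_def)
  show ?thesis by (simp add: coef_mult[OF f] coef_mult_right[OF f] mult.commute)
qed

lemma galg_0 [simp]: "0 \<in> galg S" by (simp add: galg_iff)
lemma galg_add: "f \<in> galg S \<Longrightarrow> h \<in> galg S \<Longrightarrow> f + h \<in> galg S"
  by (simp add: galg_iff lookup_add)
lemma galg_diff: "f \<in> galg S \<Longrightarrow> h \<in> galg S \<Longrightarrow> f - h \<in> galg S"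
  by (simp add: galg_iff lookup_minus)
lemma galg_sum: "(\<And>x. x \<in> A \<Longrightarrow> f x \<in> galg S) \<Longrightarrow> (\<Sum>x\<in>A. f x) \<in> galg S"
  by (simp add: galg_iff lookup_sum)
lemma galg_scal_mult: "f \<in> galg S \<Longrightarrow> scal a * f \<in> galg S"
  by (simp add: galg_iff)
lemma galg_mono: "S \<subseteq> S' \<Longrightarrow> f \<in> galg S \<Longrightarrow> f \<in> galg S'"
  by (auto simp: galg_def)

locale fin_subgroup =
  fixes S :: "'g::group_add set"
  assumes fin: "finite S" and zero_mem [simp]: "0 \<in> S"
    and add_mem: "x \<in> S \<Longrightarrow> y \<in> S \<Longrightarrow> x + y \<in> S"
    and uminus_mem: "x \<in> S \<Longrightarrow> - x \<in> S"
begin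

lemma uminus_mem_iff: "- x \<in> S \<longleftrightarrow> x \<in> S"
  using uminus_mem by force

lemma add_mem_iff1: "x \<in> S \<Longrightarrow> x + y \<in> S \<longleftrightarrow> y \<in> S"
  by (metis add_mem uminus_mem add.assoc left_minus add_0)

lemma add_mem_iff2: "y \<in> S \<Longrightarrow> x + y \<in> S \<longleftrightarrow> x \<in> S"
  by (metis add_mem uminus_mem add.assoc right_minus add_0_right)

lemma galg_1 [simp]: "1 \<in> galg S"
  by (metis gel_in_galg gel_zero zero_mem)

lemma galg_mult:
  assumes "f \<in> galg S" "h \<in> galg S"
  shows "f * h \<in> galg S"
  unfolding galg_iff
proof (intro allI impI)
  fix k assume k: "k \<notin> S"
  have "coef (f * h) k = (\<Sum>l\<in>S. coef f l * coef h (- l + k))"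
    using assms(1) fin by (rule coef_mult)
  also have "\<dots> = 0"
    using k assms(2) by (intro sum.neutral) (auto simp: galg_iff add_mem_iff1 uminus_mem_iff)
  finally show "coef (f * h) k = 0" .
qed

lemma galg_star: "f \<in> galg S \<Longrightarrow> star f \<in> galg S"
  by (auto simp: galg_iff uminus_mem_iff)

lemma bij_add_left: "a \<in> S \<Longrightarrow> bij_betw (\<lambda>x. a + x) S S"
  by (rule bij_betw_byWitness[of _ "\<lambda>x. - a + x"]) (auto simp: add_mem uminus_mem simp flip: add.assoc)

end

section \<open>Traces of two-sided multiplications\<close>

text \<open>The trace of the map \<open>x \<mapsto> z * x * e\<close> on the group algebra of
  \<open>S\<close>, for \<open>z\<close> and \<open>e\<close> in that algebra. If \<open>e\<close>
  is idempotent, this is the trace of left multiplication by \<open>z\<close> on the left ideal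
  generated by \<open>e\<close>.\<close>

definition tr :: "'g::group_add set \<Rightarrow> 'g group_ring \<Rightarrow> 'g group_ring \<Rightarrow> complex" where
  "tr S z e = (\<Sum>g\<in>S. coef (z * gel g * e) g)"

lemma tr_add_left: "tr S (y + z) e = tr S y e + tr S z e"
  by (simp add: tr_def algebra_simps lookup_add sum.distrib)
lemma tr_add_right: "tr S z (d + e) = tr S z d + tr S z e"
  by (simp add: tr_def algebra_simps lookup_add sum.distrib)
lemma tr_diff_left: "tr S (y - z) e = tr S y e - tr S z e"
  by (simp add: tr_def algebra_simps lookup_minus sum_subtractf)
lemma tr_0_left [simp]: "tr S 0 e = 0" by (simp add: tr_def)
lemma tr_0_right [simp]: "tr S z 0 = 0" by (simp add: tr_def)
lemma tr_sum_left: "tr S (\<Sum>x\<in>A. f x) e = (\<Sum>x\<in>A. tr S (f x) e)"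
  by (induction A rule: infinite_finite_induct) (auto simp: tr_add_left)
lemma tr_sum_right: "tr S z (\<Sum>x\<in>A. f x) = (\<Sum>x\<in>A. tr S z (f x))"
  by (induction A rule: infinite_finite_induct) (auto simp: tr_add_right)
lemma tr_scal_left: "tr S (scal a * z) e = a * tr S z e"
  by (simp add: tr_def mult.assoc sum_distrib_left)
lemma tr_scal_right: "tr S z (scal a * e) = a * tr S z e"
  by (simp add: tr_def mult.assoc sum_distrib_left scal_left_commute)

context fin_subgroup
begin

lemma tr_gel: "tr S (gel s) e = (\<Sum>g\<in>S. coef e (- g - s + g))"
  by (simp add: tr_def gel_mult minus_add)

lemma tr_one: "tr S 1 e = of_nat (card S) * coef e 0"
  using tr_gel[of 0 e] by simp

text \<open>Both sides expand into the same double sum, taken in the two orders. It is used for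
  equivalent idempotents: if \<open>u * v\<close> is idempotent and absorbs \<open>u\<close> and
  \<open>v\<close>, then \<open>v * u\<close> is an idempotent with the same traces.\<close>

lemma tr_commute_right:
  assumes "z \<in> galg S" "d \<in> galg S" "e \<in> galg S"
  shows "tr S z (d * e) = tr S z (e * d)"
proof -
  have "tr S z (d * e) = (\<Sum>g\<in>S. \<Sum>k\<in>S. coef d (- g + k) * coef (z * gel k * e) g)"
    if "z \<in> galg S" "d \<in> galg S" "e \<in> galg S" for d e
    unfolding tr_def
  proof (intro sum.cong refl)
    fix g assume g: "g \<in> S"
    have "gel g * d = (\<Sum>k\<in>S. scal (coef (gel g * d) k) * gel k)"
      using g that fin by (intro group_ring_expansion galg_mult) auto
    then have "z * gel g * (d * e) = z * (\<Sum>k\<in>S. scal (coef (gel g * d) k) * gel k) * e"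
      by (metis mult.assoc)
    then show "coef (z * gel g * (d * e)) g = (\<Sum>k\<in>S. coef d (- g + k) * coef (z * gel k * e) g)"
      by (simp add: sum_distrib_left sum_distrib_right lookup_sum mult.assoc scal_left_commute)
  qed
  note 1 = this[OF assms]
  have "tr S z (e * d) = (\<Sum>g\<in>S. \<Sum>k\<in>S. coef (z * gel g * e) k * coef d (- k + g))"
    unfolding tr_def
  proof (intro sum.cong refl)
    fix g assume g: "g \<in> S"
    have "z * gel g * e \<in> galg S" using g assms by (intro galg_mult) auto
    then show "coef (z * gel g * (e * d)) g = (\<Sum>k\<in>S. coef (z * gel g * e) k * coef d (- k + g))"
      using coef_mult[of "z * gel g * e" S d g] fin by (simp add: mult.assoc)
  qed
  also have "\<dots> = tr S z (d * e)"
    unfolding 1 by (subst sum.swap) (simp add: mult.commute)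
  finally show ?thesis ..
qed

lemma tr_conj_left:
  assumes "h \<in> S"
  shows "tr S (gel h * z * gel (- h)) e = tr S z e"
proof -
  have "tr S (gel h * z * gel (- h)) e = (\<Sum>g\<in>S. coef (z * gel (- h + g) * e) (- h + g))"
    unfolding tr_def
  proof (intro sum.cong refl)
    fix g
    have "gel h * z * gel (- h) * gel g * e = gel h * (z * gel (- h + g) * e)"
      by (metis gel_mult mult.assoc)
    then show "coef (gel h * z * gel (- h) * gel g * e) g = coef (z * gel (- h + g) * e) (- h + g)"
      by simp
  qed
  also have "\<dots> = tr S z e"
    unfolding tr_def using bij_add_left[of "- h"] assms
    by (intro sum.reindex_bij_betw[where g = "\<lambda>g. coef (z * gel g * e) g"]) (simp add: uminus_mem)
  finally show ?thesis .
qed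

text \<open>With \<open>z\<close> and \<open>e\<close> idempotent,
  \<open>x \<mapsto> z * x * e\<close> is a projection, so its trace is the dimension of
  \<open>z A e\<close>, where \<open>A\<close> is the algebra of \<open>S\<close>. For a primitive
  \<open>z\<close> of a subgroup algebra this is a multiplicity in the restriction of
  \<open>A e\<close>.\<close>

lemma tr_idempotent:
  assumes "z \<in> galg S" "e \<in> galg S" "z * z = z" "e * e = e"
  obtains d :: nat where "tr S z e = of_nat d" "d = 0 \<Longrightarrow> \<forall>x\<in>galg S. z * x * e = 0"
proof -
  define M where "M g h = coef (z * gel g * e) h" for g h
  have exp: "z * x * e = (\<Sum>k\<in>S. scal (coef x k) * (z * gel k * e))" if "x \<in> galg S" for x
  proof -
    have "z * x * e = z * (\<Sum>k\<in>S. scal (coef x k) * gel k) * e"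
      by (rule arg_cong[OF group_ring_expansion[OF that fin], where f = "\<lambda>x. z * x * e"])
    then show ?thesis
      by (simp add: sum_distrib_left sum_distrib_right mult.assoc scal_left_commute)
  qed
  have "(\<Sum>k\<in>S. M g k * M k h) = M g h" if "g \<in> S" "h \<in> S" for g h
  proof -
    have "z * (z * gel g * e) * e = (z * z) * gel g * (e * e)"
      by (simp only: mult.assoc)
    then have "z * gel g * e = z * (z * gel g * e) * e"
      unfolding assms(3,4) ..
    also have "\<dots> = (\<Sum>k\<in>S. scal (M g k) * (z * gel k * e))"
      unfolding M_def using that assms by (intro exp galg_mult) auto
    finally have "M g h = coef (\<Sum>k\<in>S. scal (M g k) * (z * gel k * e)) h"
      unfolding M_def by simp
    then show ?thesis by (simp add: lookup_sum M_def)
  qed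
  then obtain d :: nat where d: "(\<Sum>g\<in>S. M g g) = of_nat d"
    "d = 0 \<Longrightarrow> \<forall>g\<in>S. \<forall>h\<in>S. M g h = 0"
    by (rule idempotent_matrix_trace[OF fin, of M]) blast+
  show thesis
  proof
    show "tr S z e = of_nat d" using d(1) by (simp add: tr_def M_def)
    assume "d = 0"
    then have *: "M g h = 0" if "g \<in> S" "h \<in> S" for g h using d(2) that by blast
    have "z * gel g * e = 0" if "g \<in> S" for g
    proof (rule poly_mapping_eqI)
      fix h
      have "z * gel g * e \<in> galg S" using that assms by (intro galg_mult) auto
      then show "coef (z * gel g * e) h = coef 0 h"
        using *[OF that, of h] by (cases "h \<in> S") (auto simp: M_def galg_iff)
    qed
    then have "(\<Sum>k\<in>S. scal (coef x k) * (z * gel k * e)) = 0" for x by simp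
    then show "\<forall>x\<in>galg S. z * x * e = 0" using exp by metis
  qed
qed

text \<open>The case \<open>z = 1\<close>: the natural number is the dimension of the left ideal
  generated by \<open>e\<close>.\<close>

lemma idempotent_coef_0:
  assumes "e \<in> galg S" "e * e = e"
  obtains d :: nat where "of_nat (card S) * coef e 0 = of_nat d" "d = 0 \<Longrightarrow> e = 0"
proof (rule tr_idempotent[of 1 e])
  fix d :: nat assume d: "tr S 1 e = of_nat d" "d = 0 \<Longrightarrow> \<forall>x\<in>galg S. 1 * x * e = 0"
  show thesis
  proof (rule that[of d])
    show "of_nat (card S) * coef e 0 = of_nat d" using d(1) by (simp only: tr_one)
    show "e = 0" if "d = 0" using d(2)[OF that] galg_1 by fastforce
  qed
qed (use assms in simp_all)

end

section \<open>Young diagrams\<close>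

definition young_diagram :: "(nat \<times> nat) set \<Rightarrow> bool" where
  "young_diagram F \<longleftrightarrow> finite F \<and> (\<forall>(i, j)\<in>F. 1 \<le> i \<and> 1 \<le> j) \<and>
     (\<forall>(i, j)\<in>F. \<forall>i' j'. 1 \<le> i' \<and> i' \<le> i \<and> 1 \<le> j' \<and> j' \<le> j \<longrightarrow> (i', j') \<in> F)"

lemma young_diagramI:
  assumes "finite F" "\<And>i j. (i, j) \<in> F \<Longrightarrow> 1 \<le> i \<and> 1 \<le> j"
    "\<And>i j i' j'. (i, j) \<in> F \<Longrightarrow> 1 \<le> i' \<Longrightarrow> i' \<le> i \<Longrightarrow> 1 \<le> j' \<Longrightarrow> j' \<le> j \<Longrightarrow> (i', j') \<in> F"
  shows "young_diagram F"
  unfolding young_diagram_def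
proof (intro conjI)
  show "\<forall>(i, j)\<in>F. 1 \<le> i \<and> 1 \<le> j" by (clarify, rule assms(2))
  show "\<forall>(i, j)\<in>F. \<forall>i' j'. 1 \<le> i' \<and> i' \<le> i \<and> 1 \<le> j' \<and> j' \<le> j \<longrightarrow> (i', j') \<in> F"
    by (clarify, rule assms(3))
qed fact

lemma young_diagram_finite: "young_diagram F \<Longrightarrow> finite F"
  by (simp add: young_diagram_def)

lemma young_diagram_pos: "young_diagram F \<Longrightarrow> (i, j) \<in> F \<Longrightarrow> 1 \<le> i \<and> 1 \<le> j"
  unfolding young_diagram_def by blast

lemma young_diagram_down:
  "young_diagram F \<Longrightarrow> (i, j) \<in> F \<Longrightarrow> 1 \<le> i' \<Longrightarrow> i' \<le> i \<Longrightarrow> 1 \<le> j' \<Longrightarrow> j' \<le> j \<Longrightarrow> (i', j') \<in> F"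
  unfolding young_diagram_def by blast

lemma young_diagram_Int:
  assumes "young_diagram F" "young_diagram G" shows "young_diagram (F \<inter> G)"
proof (rule young_diagramI)
  fix i j i' j' assume "(i, j) \<in> F \<inter> G" "1 \<le> i'" "i' \<le> i" "1 \<le> j'" "j' \<le> j"
  then show "(i', j') \<in> F \<inter> G"
    using young_diagram_down[OF assms(1), of i j] young_diagram_down[OF assms(2), of i j] by blast
qed (use assms in \<open>auto dest: young_diagram_finite young_diagram_pos\<close>)

lemma young_diagram_Un:
  assumes "young_diagram F" "young_diagram G" shows "young_diagram (F \<union> G)"
proof (rule young_diagramI)
  fix i j i' j' assume "(i, j) \<in> F \<union> G" "1 \<le> i'" "i' \<le> i" "1 \<le> j'" "j' \<le> j"
  then show "(i', j') \<in> F \<union> G"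
    using young_diagram_down[OF assms(1), of i j] young_diagram_down[OF assms(2), of i j] by blast
qed (use assms in \<open>auto dest: young_diagram_finite young_diagram_pos\<close>)

lemma initial_segment:
  fixes J :: "nat set"
  assumes "finite J" "\<And>j. j \<in> J \<Longrightarrow> 1 \<le> j" "\<And>j j'. j \<in> J \<Longrightarrow> 1 \<le> j' \<Longrightarrow> j' \<le> j \<Longrightarrow> j' \<in> J"
  shows "J = {1..card J}"
proof (cases "J = {}")
  case False
  define m where "m = Max J"
  have "J = {1..m}"
  proof (intro equalityI subsetI)
    fix j assume "j \<in> {1..m}"
    then show "j \<in> J" using assms(3)[OF Max_in[OF assms(1) False], of j] by (simp add: m_def)
  next
    fix j assume "j \<in> J"
    then show "j \<in> {1..m}" using assms(1,2) by (simp add: m_def)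
  qed
  then show ?thesis by simp
qed simp

text \<open>By removing the maximum, which is at least the number of elements. The equality case is
  what later identifies two shapes.\<close>

lemma sum_initial_segment_le:
  fixes J :: "nat set"
  assumes "finite J" "\<And>j. j \<in> J \<Longrightarrow> 1 \<le> j"
  shows "\<Sum>{1..card J} \<le> \<Sum>J \<and> (\<Sum>J = \<Sum>{1..card J} \<longrightarrow> J = {1..card J})"
  using assms
proof (induction "card J" arbitrary: J)
  case (Suc n)
  let ?m = "Max J" and ?K = "J - {Max J}"
  have ne: "J \<noteq> {}" using Suc.hyps(2) by auto
  have m: "?m \<in> J" using ne Suc.prems by simp
  have K: "card ?K = n" using m Suc by simp
  have "J \<subseteq> {1..?m}" using Suc.prems by auto
  then have le: "Suc n \<le> ?m"
    by (metis Suc.hyps(2) card_atLeastAtMost card_mono diff_Suc_1 finite_atLeastAtMost)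
  have IH: "\<Sum>{1..n} \<le> \<Sum>?K" "\<Sum>?K = \<Sum>{1..n} \<Longrightarrow> ?K = {1..n}"
    using Suc.hyps(1)[of ?K] K Suc.prems by auto
  have S: "\<Sum>J = ?m + \<Sum>?K" using m Suc.prems by (simp add: sum.remove)
  have S': "\<Sum>{1..card J} = Suc n + \<Sum>{1..n}" using Suc.hyps(2)[symmetric] by simp
  show ?case
  proof (intro conjI impI)
    show "\<Sum>{1..card J} \<le> \<Sum>J" using S S' IH(1) le by linarith
    assume "\<Sum>J = \<Sum>{1..card J}"
    then have "?m = Suc n" "\<Sum>?K = \<Sum>{1..n}" using S S' IH(1) le by linarith+
    then have "?m = Suc n" "?K = {1..n}" using IH(2) by auto
    then have "insert ?m ?K = insert (Suc n) {1..n}" by (rule arg_cong2)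
    also have "\<dots> = {1..Suc n}" by auto
    finally have "J = {1..Suc n}" unfolding insert_Diff[OF m] .
    then show "J = {1..card J}" unfolding Suc.hyps(2)[symmetric] .
  qed
qed simp

section \<open>Row lengths and column weights\<close>

definition row_len :: "(nat \<times> nat) set \<Rightarrow> nat \<Rightarrow> nat" where
  "row_len F i = card {j. (i, j) \<in> F}"

lemma finite_rows: "finite F \<Longrightarrow> finite {j. (i, j) \<in> F}"
  by (rule finite_subset[of _ "snd ` F"]) force+

lemma finite_cols: "finite F \<Longrightarrow> finite {i. (i, j) \<in> F}"
  by (rule finite_subset[of _ "fst ` F"]) force+

lemma young_diagram_row:
  assumes "young_diagram F"
  shows "{j. (i, j) \<in> F} = {1..row_len F i}"
  unfolding row_len_def
proof (rule initial_segment)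
  fix j j' assume "j \<in> {j. (i, j) \<in> F}" "1 \<le> j'" "j' \<le> j"
  then show "j' \<in> {j. (i, j) \<in> F}"
    using young_diagram_down[OF assms, of i j i j'] young_diagram_pos[OF assms, of i j] by simp
qed (use young_diagram_pos[OF assms] young_diagram_finite[OF assms] in \<open>auto simp: finite_rows\<close>)

lemma young_diagram_col:
  assumes "young_diagram F"
  shows "{i. (i, j) \<in> F} = {1..card {i. (i, j) \<in> F}}"
proof (rule initial_segment)
  fix i i' assume "i \<in> {i. (i, j) \<in> F}" "1 \<le> i'" "i' \<le> i"
  then show "i' \<in> {i. (i, j) \<in> F}"
    using young_diagram_down[OF assms, of i j i' j] young_diagram_pos[OF assms, of i j] by simp
qed (use young_diagram_pos[OF assms] young_diagram_finite[OF assms] in \<open>auto simp: finite_cols\<close>)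

lemma mem_young_diagram_iff:
  assumes "young_diagram F"
  shows "(i, j) \<in> F \<longleftrightarrow> 1 \<le> j \<and> j \<le> row_len F i"
  using young_diagram_row[OF assms, of i] by auto

lemma row_len_antimono:
  assumes "young_diagram F" "1 \<le> i" "i \<le> i'"
  shows "row_len F i' \<le> row_len F i"
proof (cases "row_len F i' = 0")
  case False
  then have "(i', row_len F i') \<in> F" using mem_young_diagram_iff[OF assms(1)] by simp
  then have "(i, row_len F i') \<in> F"
    using assms False by (auto intro: young_diagram_down[OF assms(1), of i' "row_len F i'"])
  then show ?thesis using mem_young_diagram_iff[OF assms(1)] by simp
qed simp

lemma young_diagram_eqI_cols:
  assumes "young_diagram F" "young_diagram G"
    "\<And>j. card {i. (i, j) \<in> F} = card {i. (i, j) \<in> G}"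
  shows "F = G"
proof -
  have "{i. (i, j) \<in> F} = {i. (i, j) \<in> G}" for j
    using young_diagram_col[OF assms(1), of j] young_diagram_col[OF assms(2), of j] assms(3)
    by simp
  then show ?thesis by auto
qed

text \<open>A numerical stand-in for the dominance order: pushing cells to the left within their
  rows lowers it.\<close>

definition col_weight :: "(nat \<times> nat) set \<Rightarrow> nat" where
  "col_weight F = (\<Sum>x\<in>F. snd x)"

lemma col_weight_rows:
  assumes "finite F" "finite I" "fst ` F \<subseteq> I"
  shows "col_weight F = (\<Sum>i\<in>I. \<Sum>{j. (i, j) \<in> F})"
proof -
  have "(\<Sum>i\<in>I. \<Sum>{j. (i, j) \<in> F}) = (\<Sum>(i, j)\<in>Sigma I (\<lambda>i. {j. (i, j) \<in> F}). j)"
    using assms by (intro sum.Sigma) (auto intro: finite_rows)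
  also have "Sigma I (\<lambda>i. {j. (i, j) \<in> F}) = F" using assms by force
  finally show ?thesis by (simp add: col_weight_def case_prod_unfold)
qed

text \<open>Each row of \<open>S\<close> costs at least as much as the left-justified row of the
  same length, which is the row of \<open>F\<close>. Equality of the totals forces equality in every
  row.\<close>

lemma col_weight_le:
  assumes F: "young_diagram F" and S: "finite S" "\<And>i j. (i, j) \<in> S \<Longrightarrow> 1 \<le> j"
    and rows: "\<And>i. card {j. (i, j) \<in> S} = row_len F i"
  shows "col_weight F \<le> col_weight S" "col_weight S = col_weight F \<Longrightarrow> S = F"
proof -
  let ?I = "fst ` F \<union> fst ` S"
  have I: "finite ?I" using S young_diagram_finite[OF F] by simp
  have wF: "col_weight F = (\<Sum>i\<in>?I. \<Sum>{1..row_len F i})"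
    using col_weight_rows[OF young_diagram_finite[OF F] I] young_diagram_row[OF F] by simp
  have wS: "col_weight S = (\<Sum>i\<in>?I. \<Sum>{j. (i, j) \<in> S})"
    using col_weight_rows[OF S(1) I] by simp
  have row: "\<Sum>{1..row_len F i} \<le> \<Sum>{j. (i, j) \<in> S}"
    "\<Sum>{j. (i, j) \<in> S} = \<Sum>{1..row_len F i} \<Longrightarrow> {j. (i, j) \<in> S} = {1..row_len F i}" for i
    using sum_initial_segment_le[of "{j. (i, j) \<in> S}"] finite_rows[OF S(1)] S(2) rows by auto
  show "col_weight F \<le> col_weight S"
    unfolding wF wS using row(1) by (intro sum_mono)
  assume eq: "col_weight S = col_weight F"
  have "\<Sum>{j. (i, j) \<in> S} = \<Sum>{1..row_len F i}" if "i \<in> ?I" for i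
    using sum_mono_inv[of "\<lambda>i. \<Sum>{1..row_len F i}" ?I "\<lambda>i. \<Sum>{j. (i, j) \<in> S}"] row(1) I that
      eq[unfolded wF wS] by auto
  then have "{j. (i, j) \<in> S} = {j. (i, j) \<in> F}" if "i \<in> ?I" for i
    using row(2) young_diagram_row[OF F] that by metis
  then show "S = F" by force
qed

section \<open>Addable and removable cells\<close>

definition addable :: "(nat \<times> nat) set \<Rightarrow> (nat \<times> nat) set" where
  "addable F = {x. x \<notin> F \<and> young_diagram (insert x F)}"

definition removable :: "(nat \<times> nat) set \<Rightarrow> (nat \<times> nat) set" where
  "removable F = {y \<in> F. young_diagram (F - {y})}"

lemma addable_eq:
  assumes F: "young_diagram F"
  shows "addable F = (\<lambda>i. (i, Suc (row_len F i))) ` {i. 1 \<le> i \<and> (i = 1 \<or> row_len F i < row_len F (i - 1))}"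
proof (intro equalityI subsetI)
  fix x assume "x \<in> addable F"
  moreover obtain i j where ij: "x = (i, j)" by force
  ultimately have x: "x = (i, j)" "(i, j) \<notin> F" and G: "young_diagram (insert (i, j) F)"
    by (simp_all add: addable_def)
  note m = mem_young_diagram_iff[OF F]
  have pos: "1 \<le> i" "1 \<le> j" using young_diagram_pos[OF G] by auto
  have "j - 1 \<le> row_len F i"
  proof (cases "j = 1")
    case False
    then have "1 \<le> j - 1" "j - 1 \<noteq> j" using pos by auto
    then have "(i, j - 1) \<in> F" using young_diagram_down[OF G, of i j i "j - 1"] pos by auto
    then show ?thesis using m by simp
  qed simp
  then have j: "j = Suc (row_len F i)" using x(2) pos m by auto
  have "row_len F i < row_len F (i - 1)" if "i \<noteq> 1"
  proof -
    have "1 \<le> i - 1" "i - 1 \<noteq> i" using that pos by auto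
    then have "(i - 1, j) \<in> F" using young_diagram_down[OF G, of i j "i - 1" j] pos by auto
    then show ?thesis using m j by simp
  qed
  then show "x \<in> (\<lambda>i. (i, Suc (row_len F i))) ` {i. 1 \<le> i \<and> (i = 1 \<or> row_len F i < row_len F (i - 1))}"
    using x j pos by auto
next
  fix x assume "x \<in> (\<lambda>i. (i, Suc (row_len F i))) ` {i. 1 \<le> i \<and> (i = 1 \<or> row_len F i < row_len F (i - 1))}"
  then obtain i where x: "x = (i, Suc (row_len F i))" and i: "1 \<le> i" "i = 1 \<or> row_len F i < row_len F (i - 1)"
    by blast
  note m = mem_young_diagram_iff[OF F]
  have "young_diagram (insert x F)"
  proof (rule young_diagramI)
    fix a b a' b' assume "(a, b) \<in> insert x F" and le: "1 \<le> a'" "a' \<le> a" "1 \<le> b'" "b' \<le> b"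
    then consider "(a, b) = x" | "(a, b) \<in> F" by blast
    then show "(a', b') \<in> insert x F"
    proof cases
      case 1
      show ?thesis
      proof (cases "a' = a")
        case True
        then show ?thesis using 1 le x m[of a b'] by auto
      next
        case False
        then have "row_len F (i - 1) \<le> row_len F a'" "i \<noteq> 1"
          using row_len_antimono[OF F, of a' "i - 1"] 1 le x by auto
        then show ?thesis using m[of a' b'] 1 le x i by auto
      qed
    qed (use young_diagram_down[OF F, of a b] le in auto)
  qed (use F x i in \<open>auto dest: young_diagram_finite young_diagram_pos\<close>)
  then show "x \<in> addable F" using x m unfolding addable_def by auto
qed

lemma removable_eq:
  assumes F: "young_diagram F"
  shows "removable F = (\<lambda>i. (i, row_len F i)) ` {i. 1 \<le> i \<and> row_len F (Suc i) < row_len F i}"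
proof (intro equalityI subsetI)
  fix x assume "x \<in> removable F"
  moreover obtain i j where ij: "x = (i, j)" by force
  ultimately have x: "x = (i, j)" "(i, j) \<in> F" and G: "young_diagram (F - {(i, j)})"
    by (simp_all add: removable_def)
  note m = mem_young_diagram_iff[OF F]
  have pos: "1 \<le> i" "1 \<le> j" using young_diagram_pos[OF F x(2)] by auto
  have "(i, Suc j) \<notin> F" "(Suc i, j) \<notin> F"
    using young_diagram_down[OF G, of i "Suc j" i j] young_diagram_down[OF G, of "Suc i" j i j] pos
    by auto
  then have "j = row_len F i" "row_len F (Suc i) < row_len F i" using x(2) pos m by auto
  then show "x \<in> (\<lambda>i. (i, row_len F i)) ` {i. 1 \<le> i \<and> row_len F (Suc i) < row_len F i}"
    using x pos by auto
next
  fix x assume "x \<in> (\<lambda>i. (i, row_len F i)) ` {i. 1 \<le> i \<and> row_len F (Suc i) < row_len F i}"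
  then obtain i where x: "x = (i, row_len F i)" and i: "1 \<le> i" "row_len F (Suc i) < row_len F i" by blast
  note m = mem_young_diagram_iff[OF F]
  have "young_diagram (F - {x})"
  proof (rule young_diagramI)
    fix a b a' b' assume ab: "(a, b) \<in> F - {x}" and le: "1 \<le> a'" "a' \<le> a" "1 \<le> b'" "b' \<le> b"
    have "(a', b') \<noteq> x"
    proof
      assume e: "(a', b') = x"
      then have "i \<le> a" using le x by simp
      then consider "a = i" | "Suc i \<le> a" by linarith
      then show False
      proof cases
        case 1
        then have "b \<le> row_len F i" "b \<noteq> row_len F i" using ab x m by auto
        then show False using e le x by auto
      next
        case 2
        then have "row_len F a \<le> row_len F (Suc i)" using row_len_antimono[OF F, of "Suc i" a] by simp
        then show False using ab m e x le i by auto
      qed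
    qed
    then show "(a', b') \<in> F - {x}" using young_diagram_down[OF F, of a b] ab le by auto
  qed (use F in \<open>auto dest: young_diagram_finite young_diagram_pos\<close>)
  then show "x \<in> removable F" using x i m unfolding removable_def by auto
qed

lemma finite_removable: "young_diagram F \<Longrightarrow> finite (removable F)"
  by (auto simp: removable_def dest: young_diagram_finite)

text \<open>The first row always accepts a cell, and row \<open>i + 1\<close> accepts one exactly
  when the last cell of row \<open>i\<close> can be removed. The surplus of one addable cell
  produces the term \<open>f F\<close> in the commutation relation.\<close>

lemma addable_removable_rows:
  assumes F: "young_diagram F"
  shows "{i. 1 \<le> i \<and> (i = 1 \<or> row_len F i < row_len F (i - 1))} =
    insert 1 (Suc ` {i. 1 \<le> i \<and> row_len F (Suc i) < row_len F i})" (is "?A = insert 1 (Suc ` ?R)")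
proof (intro equalityI subsetI)
  fix i assume i: "i \<in> ?A"
  show "i \<in> insert 1 (Suc ` ?R)"
  proof (cases "i = 1")
    case False
    then have "i = Suc (i - 1)" "i - 1 \<in> ?R" using i by auto
    then show ?thesis by blast
  qed simp
qed auto

lemma finite_removable_rows:
  assumes F: "young_diagram F"
  shows "finite {i. 1 \<le> i \<and> row_len F (Suc i) < row_len F i}"
  using finite_removable[OF F] unfolding removable_eq[OF F]
  by (rule finite_imageD) (rule inj_onI, simp)

lemma finite_addable:
  assumes F: "young_diagram F"
  shows "finite (addable F)"
  using finite_removable_rows[OF F] unfolding addable_eq[OF F] addable_removable_rows[OF F] by simp

lemma card_addable:
  assumes F: "young_diagram F"
  shows "card (addable F) = Suc (card (removable F))"
proof -
  let ?R = "{i. 1 \<le> i \<and> row_len F (Suc i) < row_len F i}"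
  have "card (addable F) = card (insert 1 (Suc ` ?R))"
    unfolding addable_eq[OF F] addable_removable_rows[OF F] by (rule card_image) (simp add: inj_on_def)
  also have "\<dots> = Suc (card (Suc ` ?R))"
    using finite_removable_rows[OF F] by (subst card_insert_disjoint) auto
  also have "card (Suc ` ?R) = card (removable F)"
    unfolding removable_eq[OF F] by (simp add: card_image inj_on_def)
  finally show ?thesis .
qed

text \<open>Moves at distinct cells commute. The intermediate diagram of the other order is the
  intersection or the union of \<open>F\<close> with the final diagram, hence again a
  diagram.\<close>

lemma addable_removable_swap:
  assumes F: "young_diagram F" and "x \<noteq> y"
  shows "x \<in> addable F \<and> y \<in> removable (insert x F) \<longleftrightarrow> y \<in> removable F \<and> x \<in> addable (F - {y})"
proof -
  have 1: "young_diagram (F - {y})" if "young_diagram (insert x F - {y})" "x \<notin> F"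
  proof -
    have "F - {y} = F \<inter> (insert x F - {y})" by auto
    then show ?thesis using young_diagram_Int[OF F that(1)] by simp
  qed
  have 2: "young_diagram (insert x F)" if "young_diagram (insert x (F - {y}))" "y \<in> F"
  proof -
    have "insert x F = F \<union> insert x (F - {y})" using that by auto
    then show ?thesis using young_diagram_Un[OF F that(1)] by simp
  qed
  have 3: "insert x F - {y} = insert x (F - {y})" using \<open>x \<noteq> y\<close> by auto
  show ?thesis using 1 2 3 \<open>x \<noteq> y\<close> unfolding addable_def removable_def by auto
qed

text \<open>Young's lattice is differential: \<open>U D - D U = 1\<close> for its up and down operators.\<close>
lemma up_down_commutation:
  fixes f :: "(nat \<times> nat) set \<Rightarrow> real"
  assumes F: "young_diagram F"
  shows "(\<Sum>x\<in>addable F. \<Sum>y\<in>removable (insert x F). f (insert x F - {y})) =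
    f F + (\<Sum>y\<in>removable F. \<Sum>x\<in>addable (F - {y}). f (insert x (F - {y})))"
proof -
  \<comment> \<open>The terms with \<open>x = y\<close> are split off on both sides; each equals
    \<open>f F\<close>, and there are \<open>card (addable F)\<close> of them on the left and
    \<open>card (removable F)\<close> on the right. The remaining pairs \<open>?A\<close> and
    \<open>?B\<close> correspond under the swap of moves.\<close>
  let ?A = "SIGMA x:addable F. removable (insert x F) - {x}"
  let ?B = "SIGMA y:removable F. addable (F - {y}) - {y}"
  have yA: "young_diagram (insert x F)" "x \<notin> F" if "x \<in> addable F" for x
    using that by (auto simp: addable_def)
  have yB: "young_diagram (F - {y})" "y \<in> F" if "y \<in> removable F" for y
    using that by (auto simp: removable_def)
  have A: "x \<in> removable (insert x F)" "insert x F - {x} = F" if "x \<in> addable F" for x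
    using yA[OF that] F by (auto simp: removable_def)
  have B: "y \<in> addable (F - {y})" "insert y (F - {y}) = F" if "y \<in> removable F" for y
    using yB[OF that] F by (auto simp: addable_def insert_absorb)
  have "(\<Sum>x\<in>addable F. \<Sum>y\<in>removable (insert x F). f (insert x F - {y})) =
      (\<Sum>x\<in>addable F. f F + (\<Sum>y\<in>removable (insert x F) - {x}. f (insert x F - {y})))"
  proof (intro sum.cong refl)
    fix x assume x: "x \<in> addable F"
    show "(\<Sum>y\<in>removable (insert x F). f (insert x F - {y})) =
        f F + (\<Sum>y\<in>removable (insert x F) - {x}. f (insert x F - {y}))"
      using sum.remove[OF finite_removable[OF yA(1)[OF x]] A(1)[OF x], of "\<lambda>y. f (insert x F - {y})"]
      unfolding A(2)[OF x] .
  qed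
  also have "\<dots> = card (addable F) * f F + (\<Sum>(x, y)\<in>?A. f (insert x F - {y}))"
  proof -
    have fin: "\<forall>x\<in>addable F. finite (removable (insert x F) - {x})"
      using finite_removable[OF yA(1)] by simp
    show ?thesis by (simp add: sum.distrib sum.Sigma[OF finite_addable[OF F] fin])
  qed
  also have "(\<Sum>(x, y)\<in>?A. f (insert x F - {y})) = (\<Sum>(y, x)\<in>?B. f (insert x (F - {y})))"
  proof (rule sum.reindex_bij_witness[of _ prod.swap prod.swap])
    fix p assume "p \<in> ?A"
    then obtain x y where p: "p = (x, y)" "x \<in> addable F" "y \<in> removable (insert x F)" "x \<noteq> y"
      by blast
    then show "prod.swap p \<in> ?B" using addable_removable_swap[OF F p(4)] by simp
    have "insert x F - {y} = insert x (F - {y})" using p(4) by blast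
    then show "(case prod.swap p of (y, x) \<Rightarrow> f (insert x (F - {y}))) = (case p of (x, y) \<Rightarrow> f (insert x F - {y}))"
      using p(1) by simp
  next
    fix p assume "p \<in> ?B"
    then obtain x y where p: "p = (y, x)" "y \<in> removable F" "x \<in> addable (F - {y})" "x \<noteq> y"
      by blast
    then show "prod.swap p \<in> ?A" using addable_removable_swap[OF F p(4)] by simp
  qed auto
  also have "\<dots> = (\<Sum>y\<in>removable F. \<Sum>x\<in>addable (F - {y}) - {y}. f (insert x (F - {y})))"
  proof -
    have fin: "\<forall>y\<in>removable F. finite (addable (F - {y}) - {y})"
      using finite_addable[OF yB(1)] by simp
    show ?thesis by (simp add: sum.Sigma[OF finite_removable[OF F] fin])
  qed
  also have "real (card (addable F)) * f F = f F + card (removable F) * f F"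
    by (simp add: card_addable[OF F] algebra_simps)
  also have "f F + card (removable F) * f F + (\<Sum>y\<in>removable F. \<Sum>x\<in>addable (F - {y}) - {y}. f (insert x (F - {y})))
      = f F + (\<Sum>y\<in>removable F. f F + (\<Sum>x\<in>addable (F - {y}) - {y}. f (insert x (F - {y}))))"
    by (simp add: sum.distrib)
  also have "(\<Sum>y\<in>removable F. f F + (\<Sum>x\<in>addable (F - {y}) - {y}. f (insert x (F - {y})))) =
      (\<Sum>y\<in>removable F. \<Sum>x\<in>addable (F - {y}). f (insert x (F - {y})))"
  proof (intro sum.cong refl)
    fix y assume y: "y \<in> removable F"
    show "f F + (\<Sum>x\<in>addable (F - {y}) - {y}. f (insert x (F - {y}))) =
        (\<Sum>x\<in>addable (F - {y}). f (insert x (F - {y})))"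
      using sum.remove[OF finite_addable[OF yB(1)[OF y]] B(1)[OF y], of "\<lambda>x. f (insert x (F - {y}))"]
      unfolding B(2)[OF y] by simp
  qed
  finally show ?thesis .
qed

lemma removable_nonempty:
  assumes F: "young_diagram F" and "F \<noteq> {}"
  shows "removable F \<noteq> {}"
proof -
  have "finite (fst ` F)" "fst ` F \<noteq> {}" using assms young_diagram_finite by auto
  define i where "i = Max (fst ` F)"
  then obtain j where ij: "(i, j) \<in> F"
    using Max_in[OF \<open>finite (fst ` F)\<close> \<open>fst ` F \<noteq> {}\<close>] by auto
  have "(Suc i, k) \<notin> F" for k
  proof
    assume "(Suc i, k) \<in> F"
    then have "Suc i \<in> fst ` F" by force
    then show False using Max_ge[OF \<open>finite (fst ` F)\<close>] unfolding i_def by (metis not_less_eq_eq order_refl)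
  qed
  then have "row_len F (Suc i) = 0" by (simp add: row_len_def)
  moreover have "1 \<le> i" "0 < row_len F i"
    using ij young_diagram_pos[OF F] mem_young_diagram_iff[OF F] by fastforce+
  ultimately show ?thesis unfolding removable_eq[OF F] by auto
qed

section \<open>Ferrers diagrams of partitions given as lists\<close>

lemma ferrers_eq_Sigma: "ferrers \<mu> = (SIGMA i:{1..length \<mu>}. {1..\<mu> ! (i - 1)})"
  by (auto simp: ferrers_def)

lemma young_diagram_ferrers:
  assumes "is_partition m \<mu>"
  shows "young_diagram (ferrers \<mu>)"
proof (rule young_diagramI)
  show "finite (ferrers \<mu>)" by (auto simp: ferrers_eq_Sigma)
  fix i j i' j' assume *: "(i, j) \<in> ferrers \<mu>" "1 \<le> i'" "i' \<le> i" "1 \<le> j'" "j' \<le> j"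
  have "\<mu> ! (i - 1) \<le> \<mu> ! (i' - 1)"
    using assms * sorted_wrt_nth_less[of "(\<ge>)" \<mu> "i' - 1" "i - 1"]
    by (cases "i' = i") (auto simp: is_partition_def ferrers_def)
  then show "(i', j') \<in> ferrers \<mu>" using * by (auto simp: ferrers_def)
qed (auto simp: ferrers_def)

lemma card_ferrers: "card (ferrers \<mu>) = sum_list \<mu>"
proof -
  have "card (ferrers \<mu>) = (\<Sum>i\<in>{1..length \<mu>}. \<mu> ! (i - 1))"
    by (simp add: ferrers_eq_Sigma)
  also have "\<dots> = (\<Sum>i\<in>{0..<length \<mu>}. \<mu> ! i)"
    by (rule sum.reindex_bij_witness[of _ Suc "\<lambda>i. i - 1"]) auto
  finally show ?thesis by (simp add: sum_list_sum_nth)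
qed

lemma row_len_ferrers:
  "row_len (ferrers \<mu>) i = (if 1 \<le> i \<and> i \<le> length \<mu> then \<mu> ! (i - 1) else 0)"
proof -
  have "{j. (i, j) \<in> ferrers \<mu>} = (if 1 \<le> i \<and> i \<le> length \<mu> then {1..\<mu> ! (i - 1)} else {})"
    by (auto simp: ferrers_def)
  then show ?thesis by (simp add: row_len_def)
qed

lemma ferrers_inj:
  assumes "is_partition m \<mu>" "is_partition k \<nu>" "ferrers \<mu> = ferrers \<nu>"
  shows "\<mu> = \<nu>"
proof -
  have len: "length \<rho> = card {i. 0 < row_len (ferrers \<rho>) i}" if "is_partition l \<rho>" for l \<rho>
  proof -
    have "{i. 0 < row_len (ferrers \<rho>) i} = {1..length \<rho>}"
      using that by (auto simp: row_len_ferrers is_partition_def split: if_splits)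
    then show ?thesis by simp
  qed
  show ?thesis
  proof (rule nth_equalityI)
    show "length \<mu> = length \<nu>" using len assms by metis
    fix i assume "i < length \<mu>"
    then show "\<mu> ! i = \<nu> ! i"
      using row_len_ferrers[of \<mu> "Suc i"] row_len_ferrers[of \<nu> "Suc i"] assms(3) \<open>length \<mu> = length \<nu>\<close>
      by simp
  qed
qed

lemma ferrers_surj:
  assumes F: "young_diagram F"
  obtains \<nu> where "is_partition (card F) \<nu>" "ferrers \<nu> = F"
proof -
  define k where "k = card {i. (i, 1) \<in> F}"
  have k: "(i, 1) \<in> F \<longleftrightarrow> 1 \<le> i \<and> i \<le> k" for i
    using young_diagram_col[OF F, of 1] unfolding k_def by auto
  define \<nu> where "\<nu> = map (\<lambda>i. row_len F (Suc i)) [0..<k]"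
  have "ferrers \<nu> = F"
  proof (intro equalityI subsetI)
    fix x assume "x \<in> ferrers \<nu>"
    then show "x \<in> F" using mem_young_diagram_iff[OF F] by (auto simp: ferrers_def \<nu>_def)
  next
    fix x assume x: "x \<in> F"
    obtain i j where ij: "x = (i, j)" by force
    have "1 \<le> i" "1 \<le> j" using young_diagram_pos[OF F] x ij by auto
    then have "(i, 1) \<in> F" using young_diagram_down[OF F, of i j i 1] x ij by simp
    then show "x \<in> ferrers \<nu>"
      using k[of i] mem_young_diagram_iff[OF F, of i j] x ij by (auto simp: ferrers_def \<nu>_def)
  qed
  moreover from this have "is_partition (card F) \<nu>"
  proof -
    have "sorted_wrt (\<ge>) \<nu>"
      unfolding sorted_wrt_iff_nth_less \<nu>_def using row_len_antimono[OF F] by auto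
    moreover have "0 < row_len F (Suc i)" if "i < k" for i
      using k[of "Suc i"] mem_young_diagram_iff[OF F, of "Suc i" 1] that by simp
    moreover have "sum_list \<nu> = card F" using card_ferrers[of \<nu>] \<open>ferrers \<nu> = F\<close> by simp
    ultimately show ?thesis unfolding is_partition_def by (auto simp: \<nu>_def)
  qed
  ultimately show thesis using that by blast
qed

lemma addable_cells_eq:
  assumes "is_partition m \<mu>"
  shows "addable_cells \<mu> = addable (ferrers \<mu>)"
proof (intro equalityI subsetI)
  fix x assume "x \<in> addable_cells \<mu>"
  then show "x \<in> addable (ferrers \<mu>)"
    unfolding addable_cells_def addable_def using young_diagram_ferrers by force
next
  fix x assume x: "x \<in> addable (ferrers \<mu>)"
  then obtain \<nu> where "is_partition (card (insert x (ferrers \<mu>))) \<nu>" "ferrers \<nu> = insert x (ferrers \<mu>)"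
    using ferrers_surj unfolding addable_def by blast
  moreover have "card (insert x (ferrers \<mu>)) = sum_list \<mu> + 1"
    using x young_diagram_finite[OF young_diagram_ferrers[OF assms]] card_ferrers[of \<mu>]
    by (simp add: addable_def)
  ultimately show "x \<in> addable_cells \<mu>"
    using x unfolding addable_cells_def addable_def by auto
qed

lemma add_cell:
  assumes "is_partition m \<mu>" "x \<in> addable_cells \<mu>"
  shows "is_partition (m + 1) (add_cell \<mu> x)" "ferrers (add_cell \<mu> x) = insert x (ferrers \<mu>)"
proof -
  obtain \<nu> where \<nu>: "is_partition (sum_list \<mu> + 1) \<nu> \<and> ferrers \<nu> = insert x (ferrers \<mu>)"
    using assms(2) unfolding addable_cells_def by auto
  then have "is_partition (sum_list \<mu> + 1) (add_cell \<mu> x) \<and> ferrers (add_cell \<mu> x) = insert x (ferrers \<mu>)"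
    unfolding add_cell_def
  proof (rule theI)
    fix \<rho> assume "is_partition (sum_list \<mu> + 1) \<rho> \<and> ferrers \<rho> = insert x (ferrers \<mu>)"
    then show "\<rho> = \<nu>" using \<nu> ferrers_inj by metis
  qed
  then show "is_partition (m + 1) (add_cell \<mu> x)" "ferrers (add_cell \<mu> x) = insert x (ferrers \<mu>)"
    using assms(1) by (auto simp: is_partition_def)
qed

section \<open>The group algebra of the symmetric group\<close>

text \<open>The bijections of the natural numbers, written additively: this makes their group algebra a
  ring by the instances for finitely supported functions.\<close>
typedef nat_perm = "{p :: nat \<Rightarrow> nat. bij p}"
  morphisms act Abs_nat_perm
  by (rule exI[of _ id]) simp

lemma bij_act [simp]: "bij (act p)"
  using act[of p] by simp

lemma act_Abs [simp]: "bij p \<Longrightarrow> act (Abs_nat_perm p) = p"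
  by (simp add: Abs_nat_perm_inverse)

lemma nat_perm_eqI: "(\<And>x. act p x = act q x) \<Longrightarrow> p = q"
  using act_inject[of p q] by (simp add: fun_eq_iff)

instantiation nat_perm :: group_add
begin

definition "0 = Abs_nat_perm id"
definition "p + q = Abs_nat_perm (act p \<circ> act q)"
definition "- p = Abs_nat_perm (inv (act p))"
definition "p - q = p + - (q :: nat_perm)"

lemma act_zero [simp]: "act 0 = id"
  by (simp add: zero_nat_perm_def)

lemma act_add: "act (p + q) = act p \<circ> act q"
  by (simp add: plus_nat_perm_def bij_comp)

lemma act_uminus: "act (- p) = inv (act p)"
  by (simp add: uminus_nat_perm_def bij_imp_bij_inv)

instance
proof
  fix p q r :: nat_perm
  show "p + q + r = p + (q + r)" by (rule nat_perm_eqI) (simp add: act_add)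
  show "0 + p = p" "p + 0 = p" by (rule nat_perm_eqI, simp add: act_add)+
  show "- p + p = 0"
    by (rule nat_perm_eqI) (simp add: act_add act_uminus bij_is_inj)
  show "p + - q = p - q" by (simp add: minus_nat_perm_def)
qed

end

lemma act_add_apply [simp]: "act (p + q) x = act p (act q x)"
  by (simp add: act_add)

lemma act_uminus_act [simp]: "act (- p) (act p x) = x"
  by (simp add: act_uminus bij_is_inj)

lemma act_act_uminus [simp]: "act p (act (- p) x) = x"
  by (metis act_uminus_act minus_minus)

text \<open>All permutations live in one type and are the identity outside \<open>{1..n}\<close>. So
  \<open>SG m \<subseteq> SG (Suc m)\<close> holds literally, and elements of the smaller group
  algebra multiply with those of the larger one without an embedding.\<close>

definition SG :: "nat \<Rightarrow> nat_perm set" where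
  "SG n = {p. act p permutes {1..n}}"

lemma SG_act: "p \<in> SG n \<Longrightarrow> a \<in> {1..n} \<Longrightarrow> act p a \<in> {1..n}"
  unfolding SG_def by (simp only: mem_Collect_eq permutes_in_image)

lemma SG_act_outside: "p \<in> SG n \<Longrightarrow> a \<notin> {1..n} \<Longrightarrow> act p a = a"
  unfolding SG_def by (auto dest: permutes_not_in)

lemma SG_mono: "m \<le> n \<Longrightarrow> SG m \<subseteq> SG n"
  unfolding SG_def by (auto intro: permutes_subset)

lemma SG_permutation: "p \<in> SG n \<Longrightarrow> permutation (act p)"
  unfolding SG_def permutation_permutes by blast

lemma Abs_in_SG: "p permutes {1..n} \<Longrightarrow> Abs_nat_perm p \<in> SG n"
  by (simp add: SG_def permutes_bij)

lemma card_SG: "card (SG n) = fact n"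
proof -
  have "act ` SG n = {p. p permutes {1..n}}"
  proof (intro equalityI subsetI)
    fix p assume "p \<in> {p. p permutes {1..n}}"
    then show "p \<in> act ` SG n"
      by (intro image_eqI[of _ _ "Abs_nat_perm p"]) (auto simp: Abs_in_SG permutes_bij)
  qed (auto simp: SG_def)
  moreover have "inj_on act (SG n)" by (simp add: inj_on_def act_inject)
  ultimately have "card (SG n) = card {p. p permutes {1..n}}" by (metis card_image)
  then show ?thesis using card_permutations[of "{1..n}" n] by simp
qed

interpretation SG: fin_subgroup "SG n" for n
proof
  show "finite (SG n)" using card_SG[of n] card_ge_0_finite[of "SG n"] by simp
  show "0 \<in> SG n" by (simp add: SG_def permutes_id)
  show "x + y \<in> SG n" if "x \<in> SG n" "y \<in> SG n" for x y
    using that unfolding SG_def by (auto simp: act_add intro: permutes_compose)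
  show "- x \<in> SG n" if "x \<in> SG n" for x
    using that unfolding SG_def by (auto simp: act_uminus intro: permutes_inv)
qed

definition psgn :: "nat_perm \<Rightarrow> complex" where
  "psgn p = of_int (sign (act p))"

lemma psgn_add: "p \<in> SG n \<Longrightarrow> q \<in> SG n \<Longrightarrow> psgn (p + q) = psgn p * psgn q"
  unfolding psgn_def act_add by (simp add: sign_compose SG_permutation)

lemma psgn_zero [simp]: "psgn 0 = 1"
  by (simp add: psgn_def)

lemma psgn_uminus: "p \<in> SG n \<Longrightarrow> psgn (- p) = psgn p"
  unfolding psgn_def act_uminus by (simp add: sign_inverse SG_permutation)

lemma psgn_square [simp]: "psgn p * psgn p = 1"
  unfolding psgn_def by (metis of_int_1 of_int_mult sign_idempotent)

lemma cnj_psgn [simp]: "cnj (psgn p) = psgn p"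
  by (simp add: psgn_def)

definition tperm :: "nat \<Rightarrow> nat \<Rightarrow> nat_perm" where
  "tperm a b = Abs_nat_perm (Transposition.transpose a b)"

lemma act_tperm [simp]: "act (tperm a b) = Transposition.transpose a b"
  by (simp add: tperm_def)

lemma tperm_in_SG: "a \<in> {1..n} \<Longrightarrow> b \<in> {1..n} \<Longrightarrow> tperm a b \<in> SG n"
  unfolding SG_def by (simp add: permutes_swap_id)

lemma psgn_tperm: "a \<noteq> b \<Longrightarrow> psgn (tperm a b) = - 1"
  by (simp add: psgn_def sign_swap_id)

lemma uminus_tperm [simp]: "- tperm a b = tperm a b"
  by (rule nat_perm_eqI) (simp add: act_uminus)

lemma tperm_conj: "g + tperm a b - g = tperm (act g a) (act g b)"
proof (rule nat_perm_eqI)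
  fix x
  have "act (- g) x = y \<longleftrightarrow> x = act g y" for y by auto
  then show "act (g + tperm a b - g) x = act (tperm (act g a) (act g b)) x"
    by (auto simp: diff_conv_add_uminus Transposition.transpose_def simp del: add_uminus_conv_diff)
qed

section \<open>Symmetrizers of subgroups\<close>

definition sym_sum :: "nat_perm set \<Rightarrow> nat_perm group_ring" where
  "sym_sum H = (\<Sum>p\<in>H. gel p)"

definition alt_sum :: "nat_perm set \<Rightarrow> nat_perm group_ring" where
  "alt_sum H = (\<Sum>q\<in>H. scal (psgn q) * gel q)"

lemma coef_sym_sum: "finite H \<Longrightarrow> coef (sym_sum H) g = (if g \<in> H then 1 else 0)"
  by (simp add: sym_sum_def lookup_sum coef_gel)

lemma coef_alt_sum: "finite H \<Longrightarrow> coef (alt_sum H) g = (if g \<in> H then psgn g else 0)"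
  by (simp add: alt_sum_def lookup_sum scal_mult_gel lookup_single when_def)

locale perm_subgroup = fin_subgroup H for H :: "nat_perm set" +
  fixes n assumes sub: "H \<subseteq> SG n"
begin

lemma sym_sum_in: "sym_sum H \<in> galg (SG n)"
  unfolding galg_iff using sub fin by (auto simp: coef_sym_sum)

lemma alt_sum_in: "alt_sum H \<in> galg (SG n)"
  unfolding galg_iff using sub fin by (auto simp: coef_alt_sum)

lemma gel_sym_sum: "p \<in> H \<Longrightarrow> gel p * sym_sum H = sym_sum H"
  by (rule poly_mapping_eqI) (simp add: coef_sym_sum fin add_mem_iff1 uminus_mem_iff)

lemma sym_sum_gel: "p \<in> H \<Longrightarrow> sym_sum H * gel p = sym_sum H"
  by (rule poly_mapping_eqI)
    (simp add: coef_sym_sum fin add_mem_iff2 uminus_mem_iff diff_conv_add_uminus del: add_uminus_conv_diff)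

lemma gel_alt_sum: "q \<in> H \<Longrightarrow> gel q * alt_sum H = scal (psgn q) * alt_sum H"
proof (rule poly_mapping_eqI)
  fix k assume q: "q \<in> H"
  have "psgn (- q + k) = psgn q * psgn k" if "k \<in> H"
  proof -
    have "q \<in> SG n" "k \<in> SG n" using sub that q by blast+
    then show ?thesis using psgn_add[of "- q" n k] psgn_uminus[of q n] SG.uminus_mem[of q n] by simp
  qed
  then show "coef (gel q * alt_sum H) k = coef (scal (psgn q) * alt_sum H) k"
    using q by (simp add: coef_alt_sum fin add_mem_iff1 uminus_mem_iff)
qed

lemma alt_sum_gel: "q \<in> H \<Longrightarrow> alt_sum H * gel q = scal (psgn q) * alt_sum H"
proof (rule poly_mapping_eqI)
  fix k assume q: "q \<in> H"
  have "psgn (k - q) = psgn q * psgn k" if "k \<in> H"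
  proof -
    have "q \<in> SG n" "k \<in> SG n" using sub that q by blast+
    then show ?thesis
      using psgn_add[of k n "- q"] psgn_uminus[of q n] SG.uminus_mem[of q n] by (simp add: mult.commute)
  qed
  then show "coef (alt_sum H * gel q) k = coef (scal (psgn q) * alt_sum H) k"
    using q add_mem_iff2[of "- q" k] by (simp add: coef_alt_sum fin uminus_mem_iff)
qed

lemma sym_sum_mult:
  assumes "K \<subseteq> H"
  shows "sym_sum H * sym_sum K = scal (of_nat (card K)) * sym_sum H"
    "sym_sum K * sym_sum H = scal (of_nat (card K)) * sym_sum H"
proof -
  have *: "(\<Sum>p\<in>K. x) = scal (of_nat (card K)) * x" for x :: "nat_perm group_ring"
    by (rule poly_mapping_eqI) (simp add: lookup_sum)
  have "sym_sum H * sym_sum K = (\<Sum>p\<in>K. sym_sum H)"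
    unfolding sym_sum_def[of K] sum_distrib_left
    by (intro sum.cong refl sym_sum_gel) (use assms in blast)
  then show "sym_sum H * sym_sum K = scal (of_nat (card K)) * sym_sum H" using * by simp
  have "sym_sum K * sym_sum H = (\<Sum>p\<in>K. sym_sum H)"
    unfolding sym_sum_def[of K] sum_distrib_right
    by (intro sum.cong refl gel_sym_sum) (use assms in blast)
  then show "sym_sum K * sym_sum H = scal (of_nat (card K)) * sym_sum H" using * by simp
qed

lemma alt_sum_mult:
  assumes "K \<subseteq> H"
  shows "alt_sum H * alt_sum K = scal (of_nat (card K)) * alt_sum H"
    "alt_sum K * alt_sum H = scal (of_nat (card K)) * alt_sum H"
proof -
  have *: "(\<Sum>p\<in>K. x) = scal (of_nat (card K)) * x" for x :: "nat_perm group_ring"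
    by (rule poly_mapping_eqI) (simp add: lookup_sum)
  have "alt_sum H * alt_sum K = (\<Sum>p\<in>K. alt_sum H)"
    unfolding alt_sum_def[of K] sum_distrib_left
  proof (intro sum.cong refl)
    fix q assume "q \<in> K"
    then have "alt_sum H * gel q = scal (psgn q) * alt_sum H" using assms by (intro alt_sum_gel) blast
    then show "alt_sum H * (scal (psgn q) * gel q) = alt_sum H"
      unfolding scal_left_commute[of "alt_sum H" "psgn q" "gel q"] by (simp add: scal_mult_assoc)
  qed
  then show "alt_sum H * alt_sum K = scal (of_nat (card K)) * alt_sum H" using * by simp
  have "alt_sum K * alt_sum H = (\<Sum>p\<in>K. alt_sum H)"
    unfolding alt_sum_def[of K] sum_distrib_right
  proof (intro sum.cong refl)
    fix q assume "q \<in> K"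
    then have "gel q * alt_sum H = scal (psgn q) * alt_sum H" using assms by (intro gel_alt_sum) blast
    then show "scal (psgn q) * gel q * alt_sum H = alt_sum H"
      unfolding mult.assoc by (simp add: scal_mult_assoc)
  qed
  then show "alt_sum K * alt_sum H = scal (of_nat (card K)) * alt_sum H" using * by simp
qed

lemma star_sym_sum: "star (sym_sum H) = sym_sum H"
  by (rule poly_mapping_eqI) (simp add: coef_sym_sum fin uminus_mem_iff)

lemma star_alt_sum: "star (alt_sum H) = alt_sum H"
  by (rule poly_mapping_eqI) (use subsetD[OF sub] in \<open>simp add: coef_alt_sum fin uminus_mem_iff psgn_uminus[of _ n]\<close>)

lemma card_pos: "0 < card H"
  using fin zero_mem card_gt_0_iff by blast

end

text \<open>A Young subgroup as the stabilizer of the fibres of a labelling. Row and column groups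
  are the labellings by row and column index, so that their conjugation behaviour is a single
  statement about relabelling.\<close>

definition level_group :: "nat \<Rightarrow> (nat \<Rightarrow> 'b) \<Rightarrow> nat_perm set" where
  "level_group n f = {p \<in> SG n. \<forall>a\<in>{1..n}. f (act p a) = f a}"

lemma perm_subgroup_level_group: "perm_subgroup (level_group n f) n"
proof
  show "finite (level_group n f)" unfolding level_group_def using SG.fin by simp
  show "0 \<in> level_group n f" by (simp add: level_group_def)
  show "x + y \<in> level_group n f" if "x \<in> level_group n f" "y \<in> level_group n f" for x y
    using that SG_act[of y n] unfolding level_group_def by (simp add: SG.add_mem)
  show "- x \<in> level_group n f" if "x \<in> level_group n f" for x
  proof -
    have x: "x \<in> SG n" using that by (simp add: level_group_def)
    have "f (act (- x) a) = f a" if "a \<in> {1..n}" for a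
    proof -
      have "f (act x (act (- x) a)) = f (act (- x) a)"
        using SG_act[OF SG.uminus_mem[OF x] that] \<open>x \<in> level_group n f\<close> by (simp only: level_group_def mem_Collect_eq)
      then show ?thesis by simp
    qed
    then show ?thesis using x by (simp add: level_group_def SG.uminus_mem)
  qed
  show "level_group n f \<subseteq> SG n" by (auto simp: level_group_def)
qed

lemma level_group_conj:
  assumes g: "g \<in> SG n"
  shows "p \<in> level_group n (f \<circ> act (- g)) \<longleftrightarrow> - g + p + g \<in> level_group n f"
proof -
  have g': "- g \<in> SG n" using g by (rule SG.uminus_mem)
  have 1: "- g + p + g \<in> SG n \<longleftrightarrow> p \<in> SG n"
    using g g' by (simp add: SG.add_mem_iff1 SG.add_mem_iff2)
  have 2: "(\<forall>a\<in>{1..n}. P (act g a)) \<longleftrightarrow> (\<forall>a\<in>{1..n}. P a)" for P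
    using SG_act[OF g] SG_act[OF g'] by (metis act_act_uminus)
  show ?thesis unfolding level_group_def mem_Collect_eq 1
    using 2[of "\<lambda>a. f (act (- g) (act p a)) = f (act (- g) a)"] by simp
qed

lemma sym_sum_conj:
  assumes g: "g \<in> SG n"
  shows "gel g * sym_sum (level_group n f) * gel (- g) = sym_sum (level_group n (f \<circ> act (- g)))"
proof (rule poly_mapping_eqI)
  fix k
  interpret a: perm_subgroup "level_group n f" n by (rule perm_subgroup_level_group)
  interpret b: perm_subgroup "level_group n (f \<circ> act (- g))" n by (rule perm_subgroup_level_group)
  show "coef (gel g * sym_sum (level_group n f) * gel (- g)) k = coef (sym_sum (level_group n (f \<circ> act (- g)))) k"
    by (simp add: coef_sym_sum a.fin b.fin level_group_conj[OF g] add.assoc)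
qed

lemma alt_sum_conj:
  assumes g: "g \<in> SG n"
  shows "gel g * alt_sum (level_group n f) * gel (- g) = alt_sum (level_group n (f \<circ> act (- g)))"
proof (rule poly_mapping_eqI)
  fix k
  interpret a: perm_subgroup "level_group n f" n by (rule perm_subgroup_level_group)
  interpret b: perm_subgroup "level_group n (f \<circ> act (- g))" n by (rule perm_subgroup_level_group)
  have "psgn (- g + k + g) = psgn k" if "- g + k + g \<in> level_group n f"
  proof -
    have "k \<in> SG n" using that g unfolding level_group_def
      by (simp add: SG.add_mem_iff1 SG.add_mem_iff2 SG.uminus_mem)
    then show ?thesis using g
      by (simp add: psgn_add[of _ n] SG.add_mem SG.uminus_mem psgn_uminus[of _ n])
  qed
  then show "coef (gel g * alt_sum (level_group n f) * gel (- g)) k = coef (alt_sum (level_group n (f \<circ> act (- g)))) k"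
    by (simp add: coef_alt_sum a.fin b.fin level_group_conj[OF g] add.assoc)
qed

section \<open>Young symmetrizers of tableaux\<close>

text \<open>A tableau with \<open>n\<close> cells is given by the position of each of the numbers \<open>1, \<dots>, n\<close>.\<close>
definition is_tableau :: "nat \<Rightarrow> (nat \<times> nat) set \<Rightarrow> (nat \<Rightarrow> nat \<times> nat) \<Rightarrow> bool" where
  "is_tableau n F T \<longleftrightarrow> young_diagram F \<and> bij_betw T {1..n} F"

abbreviation rowG :: "nat \<Rightarrow> (nat \<Rightarrow> nat \<times> nat) \<Rightarrow> nat_perm set" where
  "rowG n T \<equiv> level_group n (fst \<circ> T)"

abbreviation colG :: "nat \<Rightarrow> (nat \<Rightarrow> nat \<times> nat) \<Rightarrow> nat_perm set" where
  "colG n T \<equiv> level_group n (snd \<circ> T)"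

definition ysym :: "nat \<Rightarrow> (nat \<Rightarrow> nat \<times> nat) \<Rightarrow> nat_perm group_ring" where
  "ysym n T = sym_sum (rowG n T) * alt_sum (colG n T)"

interpretation row: perm_subgroup "rowG n T" n for n T
  by (rule perm_subgroup_level_group)

interpretation col: perm_subgroup "colG n T" n for n T
  by (rule perm_subgroup_level_group)

lemma ysym_in: "ysym n T \<in> galg (SG n)"
  unfolding ysym_def by (intro SG.galg_mult row.sym_sum_in col.alt_sum_in)

lemma tableau_relabel:
  assumes "is_tableau n F T" "g \<in> SG n"
  shows "is_tableau n F (T \<circ> act g)"
proof -
  have "bij_betw (act g) {1..n} {1..n}" using assms(2) unfolding SG_def by (simp add: permutes_imp_bij)
  then show ?thesis using assms(1) unfolding is_tableau_def by (auto intro: bij_betw_trans)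
qed

lemma ysym_conj:
  assumes g: "g \<in> SG n"
  shows "gel g * ysym n T * gel (- g) = ysym n (T \<circ> act (- g))"
proof -
  have "gel g * ysym n T * gel (- g) =
      gel g * sym_sum (rowG n T) * (gel (- g) * gel g) * alt_sum (colG n T) * gel (- g)"
    by (simp add: ysym_def mult.assoc gel_mult)
  also have "\<dots> = (gel g * sym_sum (rowG n T) * gel (- g)) * (gel g * alt_sum (colG n T) * gel (- g))"
    by (simp only: mult.assoc)
  also have "\<dots> = ysym n (T \<circ> act (- g))"
    unfolding sym_sum_conj[OF g] alt_sum_conj[OF g] ysym_def by (simp only: comp_assoc)
  finally show ?thesis .
qed

lemma tableaux_conj:
  assumes "is_tableau n F T" "is_tableau n F T'"
  obtains g where "g \<in> SG n" "\<And>a. a \<in> {1..n} \<Longrightarrow> T' a = (T \<circ> act (- g)) a"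
proof -
  define f where "f a = (if a \<in> {1..n} then inv_into {1..n} T (T' a) else a)" for a
  have "bij_betw (inv_into {1..n} T \<circ> T') {1..n} {1..n}"
    using assms unfolding is_tableau_def by (auto intro: bij_betw_trans bij_betw_inv_into)
  then have "bij_betw f {1..n} {1..n}"
    by (rule bij_betw_cong[THEN iffD1, rotated]) (simp add: f_def)
  then have "f permutes {1..n}" by (intro bij_imp_permutes) (auto simp: f_def)
  then have h: "Abs_nat_perm f \<in> SG n" "act (Abs_nat_perm f) = f"
    by (auto simp: Abs_in_SG permutes_bij)
  show thesis
  proof
    show "- Abs_nat_perm f \<in> SG n" using h(1) by (rule SG.uminus_mem)
    fix a assume a: "a \<in> {1..n}"
    have "T' a \<in> F" using assms(2) a by (auto simp: is_tableau_def bij_betw_def)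
    then have "T (f a) = T' a"
      using a assms(1) bij_betw_inv_into_right[of T "{1..n}" F "T' a"] by (simp add: f_def is_tableau_def)
    then show "T' a = (T \<circ> act (- (- Abs_nat_perm f))) a" by (simp add: h(2))
  qed
qed

lemma level_group_cong:
  assumes "\<And>a. a \<in> {1..n} \<Longrightarrow> f a = f' a"
  shows "level_group n f = level_group n f'"
proof -
  have "f (act p a) = f' (act p a)" if "p \<in> SG n" "a \<in> {1..n}" for p a
    using assms SG_act that by blast
  then show ?thesis using assms unfolding level_group_def by auto
qed

lemma ysym_cong:
  assumes "\<And>a. a \<in> {1..n} \<Longrightarrow> T a = T' a"
  shows "ysym n T = ysym n T'"
proof -
  have "rowG n T = rowG n T'" "colG n T = colG n T'"
    by (rule level_group_cong, simp only: comp_apply assms)+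
  then show ?thesis by (simp only: ysym_def)
qed

lemma ysym_conj_same_shape:
  assumes "is_tableau n F T" "is_tableau n F T'"
  obtains g where "g \<in> SG n" "ysym n T' = gel g * ysym n T * gel (- g)"
proof -
  obtain g where g: "g \<in> SG n" "\<And>a. a \<in> {1..n} \<Longrightarrow> T' a = (T \<circ> act (- g)) a"
    using tableaux_conj[OF assms] by blast
  have "ysym n T' = ysym n (T \<circ> act (- g))" by (rule ysym_cong) (rule g(2))
  then show thesis using that[OF g(1)] ysym_conj[OF g(1)] by simp
qed

lemma row_col_Int:
  assumes "is_tableau n F T" "p \<in> rowG n T" "p \<in> colG n T"
  shows "p = 0"
proof (rule nat_perm_eqI)
  fix a
  show "act p a = act 0 a"
  proof (cases "a \<in> {1..n}")
    case True
    have "T (act p a) = T a"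
      using assms(2,3) True by (auto simp: level_group_def prod_eq_iff)
    moreover have "act p a \<in> {1..n}" using assms(2) True by (intro SG_act) (auto simp: level_group_def)
    moreover have "inj_on T {1..n}" using assms(1) by (simp add: is_tableau_def bij_betw_def)
    ultimately have "act p a = a" using True by (meson inj_onD)
    then show ?thesis by simp
  next
    case False
    then show ?thesis using assms(2) SG_act_outside[of p n a] by (simp add: level_group_def)
  qed
qed

text \<open>Only the identity preserves both rows and columns, so a permutation factors as
  \<open>p + q\<close> in at most one way and nothing cancels in the product.\<close>

lemma coef_ysym:
  assumes T: "is_tableau n F T"
  shows "p \<in> rowG n T \<Longrightarrow> q \<in> colG n T \<Longrightarrow> coef (ysym n T) (p + q) = psgn q"
    "(\<And>p q. p \<in> rowG n T \<Longrightarrow> q \<in> colG n T \<Longrightarrow> g \<noteq> p + q) \<Longrightarrow> coef (ysym n T) g = 0"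
proof -
  have in_gal: "sym_sum (rowG n T) \<in> galg (rowG n T)"
    by (simp add: galg_iff coef_sym_sum row.fin)
  have c: "coef (ysym n T) g = (\<Sum>l\<in>rowG n T. if - l + g \<in> colG n T then psgn (- l + g) else 0)" for g
    unfolding ysym_def coef_mult[OF in_gal row.fin]
    by (intro sum.cong refl) (simp add: coef_sym_sum coef_alt_sum row.fin col.fin)
  show "coef (ysym n T) (p + q) = psgn q" if p: "p \<in> rowG n T" and q: "q \<in> colG n T"
  proof -
    have "- l + (p + q) \<in> colG n T \<longleftrightarrow> l = p" if l: "l \<in> rowG n T" for l
    proof
      assume "- l + (p + q) \<in> colG n T"
      then have "(- l + p) + q \<in> colG n T" by (simp add: add.assoc)
      then have "- l + p \<in> colG n T" using q by (simp add: col.add_mem_iff2)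
      moreover have "- l + p \<in> rowG n T" using l p by (simp add: row.add_mem row.uminus_mem)
      ultimately have "- l + p = 0" using row_col_Int[OF T] by blast
      then show "l = p" by (metis add.inverse_inverse add_eq_0_iff)
    qed (use q in \<open>simp flip: add.assoc\<close>)
    then have "coef (ysym n T) (p + q) = (\<Sum>l\<in>rowG n T. if l = p then psgn q else 0)"
      unfolding c by (intro sum.cong refl) (auto simp flip: add.assoc)
    then show ?thesis using p by (simp add: row.fin)
  qed
  show "coef (ysym n T) g = 0" if *: "\<And>p q. p \<in> rowG n T \<Longrightarrow> q \<in> colG n T \<Longrightarrow> g \<noteq> p + q"
    unfolding c
  proof (intro sum.neutral ballI)
    fix l assume "l \<in> rowG n T"
    then have "- l + g \<notin> colG n T" using *[of l "- l + g"] by (auto simp flip: add.assoc)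
    then show "(if - l + g \<in> colG n T then psgn (- l + g) else 0) = 0" by simp
  qed
qed

lemma coef_ysym_0: "is_tableau n F T \<Longrightarrow> coef (ysym n T) 0 = 1"
  using coef_ysym(1)[of n F T 0 0] by simp

lemma tperm_in_level_group:
  assumes "a \<in> {1..n}" "b \<in> {1..n}" "f a = f b"
  shows "tperm a b \<in> level_group n f"
  using assms by (auto simp: level_group_def tperm_in_SG Transposition.transpose_def)

lemma card_fst_fibre:
  assumes "inj_on (\<lambda>a. (f a, g a)) A"
  shows "card {j. (i, j) \<in> (\<lambda>a. (f a, g a)) ` A} = card {a \<in> A. f a = i}"
proof -
  have "{j. (i, j) \<in> (\<lambda>a. (f a, g a)) ` A} = g ` {a \<in> A. f a = i}" by blast
  moreover have "inj_on g {a \<in> A. f a = i}"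
    using assms by (auto simp: inj_on_def)
  ultimately show ?thesis by (simp only: card_image)
qed

lemma card_snd_fibre:
  assumes "inj_on (\<lambda>a. (f a, g a)) A"
  shows "card {i. (i, j) \<in> (\<lambda>a. (f a, g a)) ` A} = card {a \<in> A. g a = j}"
proof -
  have "{i. (i, j) \<in> (\<lambda>a. (f a, g a)) ` A} = f ` {a \<in> A. g a = j}" by blast
  moreover have "inj_on f {a \<in> A. g a = j}"
    using assms by (auto simp: inj_on_def)
  ultimately show ?thesis by (simp only: card_image)
qed

section \<open>Orthogonality of symmetrizers of different shapes\<close>

text \<open>Put each \<open>a\<close> into its row of \<open>T\<close> and its column of
  \<open>T'\<close>. By \<open>sep\<close> this is injective, and the resulting set of cells has the
  row lengths of \<open>F\<close> and the column lengths of \<open>F'\<close>. Comparing it with the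
  left-justified \<open>F\<close> gives the inequality; if the weights agree, the set is
  \<open>F\<close> itself and then has the columns of \<open>F'\<close>.\<close>

lemma row_col_positions:
  assumes T: "is_tableau n F T" and T': "is_tableau n F' T'"
    and sep: "\<And>a b. a \<in> {1..n} \<Longrightarrow> b \<in> {1..n} \<Longrightarrow> fst (T a) = fst (T b) \<Longrightarrow> snd (T' a) = snd (T' b) \<Longrightarrow> a = b"
  shows "col_weight F \<le> col_weight F'"
    "col_weight F = col_weight F' \<Longrightarrow> F = F' \<and> bij_betw (\<lambda>a. (fst (T a), snd (T' a))) {1..n} F"
proof -
  let ?\<phi> = "\<lambda>a. (fst (T a), snd (T' a))"
  let ?S = "?\<phi> ` {1..n}"
  have inj: "inj_on ?\<phi> {1..n}" using sep by (auto simp: inj_on_def)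
  have F: "young_diagram F" "bij_betw T {1..n} F" and F': "young_diagram F'" "bij_betw T' {1..n} F'"
    using T T' by (auto simp: is_tableau_def)
  have rows: "card {j. (i, j) \<in> ?S} = row_len F i" for i
  proof -
    have "card {j. (i, j) \<in> ?S} = card {a \<in> {1..n}. fst (T a) = i}"
      using inj by (rule card_fst_fibre)
    also have "\<dots> = card {j. (i, j) \<in> (\<lambda>a. (fst (T a), snd (T a))) ` {1..n}}"
      by (rule card_fst_fibre[symmetric]) (use F(2) in \<open>simp add: bij_betw_def\<close>)
    also have "\<dots> = row_len F i"
      using F(2) by (simp add: bij_betw_def row_len_def)
    finally show ?thesis .
  qed
  have S1: "1 \<le> j" if "(i, j) \<in> ?S" for i j
  proof -
    have "\<exists>a\<in>{1..n}. j = snd (T' a)" using that by auto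
    then obtain a where a: "a \<in> {1..n}" "j = snd (T' a)" by blast
    have "T' a \<in> F'" using F'(2) a(1) by (rule bij_betw_apply)
    then show ?thesis using young_diagram_pos[OF F'(1), of "fst (T' a)" "snd (T' a)"] a(2) by simp
  qed
  have wS: "col_weight ?S = col_weight F'"
  proof -
    have "col_weight ?S = (\<Sum>a\<in>{1..n}. snd (T' a))"
      unfolding col_weight_def using inj by (simp add: sum.reindex)
    also have "\<dots> = col_weight F'"
      unfolding col_weight_def using F'(2) by (rule sum.reindex_bij_betw)
    finally show ?thesis .
  qed
  have finS: "finite ?S" by simp
  show "col_weight F \<le> col_weight F'"
    using col_weight_le(1)[OF F(1) finS S1 rows] wS by simp
  assume "col_weight F = col_weight F'"
  then have S: "?S = F" using col_weight_le(2)[OF F(1) finS S1 rows] wS by simp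
  have "card {i. (i, j) \<in> F} = card {i. (i, j) \<in> F'}" for j
  proof -
    have "card {i. (i, j) \<in> ?S} = card {a \<in> {1..n}. snd (T' a) = j}"
      using inj by (rule card_snd_fibre)
    also have "\<dots> = card {i. (i, j) \<in> (\<lambda>a. (fst (T' a), snd (T' a))) ` {1..n}}"
      by (rule card_snd_fibre[symmetric]) (use F'(2) in \<open>simp add: bij_betw_def\<close>)
    also have "\<dots> = card {i. (i, j) \<in> F'}"
      using F'(2) by (simp add: bij_betw_def)
    finally show ?thesis unfolding S .
  qed
  then have "F = F'" by (rule young_diagram_eqI_cols[OF F(1) F'(1)])
  then show "F = F' \<and> bij_betw ?\<phi> {1..n} F" using inj S by (simp add: bij_betw_def)
qed

text \<open>The transposition of \<open>a\<close> and \<open>b\<close> is absorbed by the row sum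
  with sign \<open>+1\<close> and by the column sum with sign \<open>-1\<close>, so the product
  equals its own negative.\<close>

lemma sym_sum_alt_sum_eq_0:
  assumes ab: "a \<in> {1..n}" "b \<in> {1..n}" "a \<noteq> b" and "fst (T a) = fst (T b)" "snd (T' a) = snd (T' b)"
  shows "sym_sum (rowG n T) * alt_sum (colG n T') = 0"
proof -
  let ?t = "tperm a b"
  have t: "?t \<in> rowG n T" "?t \<in> colG n T'"
    using assms by (auto intro!: tperm_in_level_group)
  have "sym_sum (rowG n T) * alt_sum (colG n T') = sym_sum (rowG n T) * gel ?t * alt_sum (colG n T')"
    using row.sym_sum_gel[OF t(1)] by simp
  also have "\<dots> = scal (- 1) * (sym_sum (rowG n T) * alt_sum (colG n T'))"
    unfolding mult.assoc col.gel_alt_sum[OF t(2)] psgn_tperm[OF ab(3)] by (rule scal_left_commute)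
  finally have eq: "sym_sum (rowG n T) * alt_sum (colG n T') = scal (- 1) * (sym_sum (rowG n T) * alt_sum (colG n T'))" .
  show ?thesis
  proof (rule poly_mapping_eqI)
    fix k show "coef (sym_sum (rowG n T) * alt_sum (colG n T')) k = coef 0 k"
      using arg_cong[OF eq, of "\<lambda>x. coef x k"] by (simp only: coef_scal_mult) simp
  qed
qed

text \<open>A nonzero product separates all pairs and so, under the weight assumption, forces equal
  shapes. The middle factor is reduced to a single permutation, which passes the column sum at the
  price of relabelling \<open>T'\<close>.\<close>

lemma sym_sum_mult_alt_sum_eq_0:
  assumes T: "is_tableau n F T" and T': "is_tableau n F' T'"
    and F: "F \<noteq> F'" "col_weight F' \<le> col_weight F" and x: "x \<in> galg (SG n)"
  shows "sym_sum (rowG n T) * x * alt_sum (colG n T') = 0"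
proof -
  have 0: "sym_sum (rowG n T) * alt_sum (colG n T'') = 0" if T'': "is_tableau n F' T''" for T''
  proof (rule ccontr)
    assume "\<not> ?thesis"
    then have "a = b" if "a \<in> {1..n}" "b \<in> {1..n}" "fst (T a) = fst (T b)" "snd (T'' a) = snd (T'' b)" for a b
      using sym_sum_alt_sum_eq_0[of a n b T T''] that by blast
    note sep = this
    have "col_weight F = col_weight F'"
      using row_col_positions(1)[OF T T'' sep] F(2) by (rule antisym)
    then show False using row_col_positions(2)[OF T T'' sep] F(1) by blast
  qed
  have "sym_sum (rowG n T) * gel g * alt_sum (colG n T') = 0" if g: "g \<in> SG n" for g
  proof -
    have "gel g * alt_sum (colG n T') = gel g * alt_sum (colG n T') * gel (- g) * gel g"
      by (simp add: mult.assoc gel_mult)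
    also have "\<dots> = alt_sum (colG n (T' \<circ> act (- g))) * gel g"
      unfolding alt_sum_conj[OF g] by (simp only: comp_assoc)
    finally have "sym_sum (rowG n T) * gel g * alt_sum (colG n T') =
        (sym_sum (rowG n T) * alt_sum (colG n (T' \<circ> act (- g)))) * gel g"
      by (simp only: mult.assoc)
    then show ?thesis using 0[OF tableau_relabel[OF T' SG.uminus_mem[OF g]]] by simp
  qed
  note g0 = this
  have "sym_sum (rowG n T) * x * alt_sum (colG n T') =
      sym_sum (rowG n T) * (\<Sum>g\<in>SG n. scal (coef x g) * gel g) * alt_sum (colG n T')"
    by (rule arg_cong[OF group_ring_expansion[OF x SG.fin], where f = "\<lambda>x. _ * x * _"])
  also have "\<dots> = (\<Sum>g\<in>SG n. scal (coef x g) * (sym_sum (rowG n T) * gel g * alt_sum (colG n T')))"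
    by (simp only: sum_distrib_left sum_distrib_right mult.assoc scal_left_commute)
  finally show ?thesis using g0 by simp
qed

text \<open>The combinatorial argument covers only \<open>col_weight F' \<le> col_weight F\<close>.
  Otherwise let \<open>u\<close> be the product in question: \<open>u * star u * u\<close> contains
  the factor \<open>ysym n T' * star u * ysym n T\<close>, which vanishes by the case already
  settled, so \<open>u = 0\<close> by positivity.\<close>

lemma ysym_orthogonal:
  assumes T: "is_tableau n F T" and T': "is_tableau n F' T'" and F: "F \<noteq> F'" and x: "x \<in> galg (SG n)"
  shows "ysym n T * x * ysym n T' = 0"
proof -
  have *: "ysym n T1 * y * ysym n T2 = 0"
    if "is_tableau n F1 T1" "is_tableau n F2 T2" "F1 \<noteq> F2" "col_weight F2 \<le> col_weight F1" "y \<in> galg (SG n)"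
    for T1 T2 F1 F2 y
  proof -
    have "ysym n T1 * y * ysym n T2 = sym_sum (rowG n T1) *
        (alt_sum (colG n T1) * y * sym_sum (rowG n T2)) * alt_sum (colG n T2)"
      by (simp only: ysym_def mult.assoc)
    also have "\<dots> = 0"
      using that by (intro sym_sum_mult_alt_sum_eq_0[of n F1 T1 F2 T2] SG.galg_mult col.alt_sum_in row.sym_sum_in)
    finally show ?thesis .
  qed
  show ?thesis
  proof (cases "col_weight F' \<le> col_weight F")
    case False
    let ?u = "ysym n T * x * ysym n T'"
    have "?u * star ?u * ?u =
        ysym n T * x * (ysym n T' * (star ?u) * ysym n T) * x * ysym n T'"
      by (simp only: mult.assoc)
    also have "ysym n T' * (star ?u) * ysym n T = 0"
      using F False x by (intro *[OF T' T] SG.galg_star SG.galg_mult ysym_in) auto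
    finally have "?u * star ?u * ?u = 0" by simp
    then show ?thesis by (rule star_nilpotent_eq_0)
  qed (use * assms in blast)
qed

lemma ysym_absorb_left: "p \<in> rowG n T \<Longrightarrow> gel p * ysym n T = ysym n T"
  unfolding ysym_def using row.gel_sym_sum by (simp flip: mult.assoc)

lemma ysym_absorb_right: "q \<in> colG n T \<Longrightarrow> ysym n T * gel q = scal (psgn q) * ysym n T"
  unfolding ysym_def using col.alt_sum_gel by (simp only: mult.assoc scal_left_commute)

text \<open>Von Neumann's lemma. A permutation \<open>g\<close> that is not a product of a row and a column permutation
  admits a transposition \<open>t\<close> of the row group with \<open>g\<inverse> t g\<close> in the column group, so \<open>h\<close> vanishes at \<open>g\<close>.\<close>
lemma ysym_unique:
  assumes T: "is_tableau n F T" and h: "h \<in> galg (SG n)"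
    and left: "\<And>p. p \<in> rowG n T \<Longrightarrow> gel p * h = h"
    and right: "\<And>q. q \<in> colG n T \<Longrightarrow> h * gel q = scal (psgn q) * h"
  shows "h = scal (coef h 0) * ysym n T"
proof -
  have L: "coef h (- p + k) = coef h k" if "p \<in> rowG n T" for p k
    using arg_cong[OF left[OF that], of "\<lambda>x. coef x k"] by simp
  have R: "coef h k = psgn q * coef h (k + q)" if "q \<in> colG n T" for q k
    using arg_cong[OF right[OF that], of "\<lambda>x. coef x (k + q)"] by simp
  show ?thesis
  proof (rule poly_mapping_eqI)
    fix g
    show "coef h g = coef (scal (coef h 0) * ysym n T) g"
    proof (cases "\<exists>p\<in>rowG n T. \<exists>q\<in>colG n T. g = p + q")
      case True
      then obtain p q where pq: "p \<in> rowG n T" "q \<in> colG n T" "g = p + q" by blast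
      have "coef h g = coef h q" using L[OF row.uminus_mem[OF pq(1)], of q] pq(3) by simp
      also have "\<dots> = psgn q * coef h 0" using R[OF pq(2), of 0] by simp
      finally show ?thesis using coef_ysym(1)[OF T pq(1,2)] pq(3) by simp
    next
      case False
      have "coef h g = 0"
      proof (cases "g \<in> SG n")
        case g: True
        have T': "is_tableau n F (T \<circ> act (- g))"
          using tableau_relabel[OF T SG.uminus_mem[OF g]] .
        have "\<exists>a b. a \<in> {1..n} \<and> b \<in> {1..n} \<and> fst (T a) = fst (T b) \<and>
            snd ((T \<circ> act (- g)) a) = snd ((T \<circ> act (- g)) b) \<and> a \<noteq> b"
        proof (rule ccontr)
          assume *: "\<not> ?thesis"
          let ?\<phi> = "\<lambda>a. (fst (T a), snd ((T \<circ> act (- g)) a))"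
          have "bij_betw ?\<phi> {1..n} F"
            using row_col_positions(2)[OF T T'] * by blast
          then have bij: "bij_betw (inv_into {1..n} T \<circ> ?\<phi>) {1..n} {1..n}"
            using T unfolding is_tableau_def by (auto intro: bij_betw_trans bij_betw_inv_into)
          \<comment> \<open>\<open>f\<close> sends \<open>a\<close> to the number in the row of
            \<open>a\<close> in \<open>T\<close> and in its column in
            \<open>T \<circ> act (- g)\<close>. It preserves rows, and \<open>f\<close> after
            \<open>g\<close> preserves columns, so \<open>g = - p + (p + g)\<close> would be a
            product of a row and a column permutation.\<close>
          define f where "f a = (if a \<in> {1..n} then inv_into {1..n} T (?\<phi> a) else a)" for a
          have "bij_betw f {1..n} {1..n}"
            using bij by (rule bij_betw_cong[THEN iffD1, rotated]) (simp add: f_def)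
          then have f: "f permutes {1..n}" by (intro bij_imp_permutes) (auto simp: f_def)
          define p where "p = Abs_nat_perm f"
          have p: "p \<in> SG n" "act p = f"
            unfolding p_def using f by (auto simp: Abs_in_SG permutes_bij)
          have Tf: "T (f a) = ?\<phi> a" if a: "a \<in> {1..n}" for a
          proof -
            have "?\<phi> a \<in> F" using \<open>bij_betw ?\<phi> {1..n} F\<close> a by (auto simp: bij_betw_def)
            then show ?thesis
              using a T bij_betw_inv_into_right[of T "{1..n}" F "?\<phi> a"]
              unfolding f_def is_tableau_def by simp
          qed
          have "p \<in> rowG n T" using p Tf by (simp add: level_group_def)
          moreover have "p + g \<in> colG n T"
            using p Tf SG_act[OF g] g by (simp add: level_group_def SG.add_mem)
          moreover have "g = - p + (p + g)" by (simp flip: add.assoc)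
          ultimately show False using False row.uminus_mem by blast
        qed
        then obtain a b where ab: "a \<in> {1..n}" "b \<in> {1..n}" "fst (T a) = fst (T b)"
          "snd (T (act (- g) a)) = snd (T (act (- g) b))" "a \<noteq> b" by auto
        let ?t = "tperm a b" and ?s = "tperm (act (- g) a) (act (- g) b)"
        have t: "?t \<in> rowG n T" using ab by (intro tperm_in_level_group) auto
        have "act (- g) a \<noteq> act (- g) b" using ab(5) by (metis act_act_uminus)
        moreover have s: "?s \<in> colG n T"
          using ab SG_act[OF SG.uminus_mem[OF g]] by (intro tperm_in_level_group) auto
        moreover have "?s = - g + ?t + g" using tperm_conj[of "- g" a b] by simp
        then have "?t + g = g + ?s" by (simp flip: add.assoc)
        ultimately have "coef h g = - coef h g"
          using L[OF t, of g] R[OF s, of g] psgn_tperm[of "act (- g) a" "act (- g) b"] by simp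
        then show ?thesis by simp
      qed (use h in \<open>simp add: galg_iff\<close>)
      then show ?thesis using coef_ysym(2)[OF T, of g] False by simp
    qed
  qed
qed

text \<open>The product inherits the row absorption of its left factor and the signed column
  absorption of its right factor, so uniqueness applies. This is the primitivity of the normalized
  symmetrizer.\<close>

lemma ysym_sandwich:
  assumes T: "is_tableau n F T" and x: "x \<in> galg (SG n)"
  shows "ysym n T * x * ysym n T = scal (coef (ysym n T * x * ysym n T) 0) * ysym n T"
proof (rule ysym_unique[OF T])
  show "ysym n T * x * ysym n T \<in> galg (SG n)" using x by (intro SG.galg_mult ysym_in)
  show "gel p * (ysym n T * x * ysym n T) = ysym n T * x * ysym n T" if "p \<in> rowG n T" for p
    using ysym_absorb_left[OF that] by (metis mult.assoc)
  show "ysym n T * x * ysym n T * gel q = scal (psgn q) * (ysym n T * x * ysym n T)" if "q \<in> colG n T" for q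
    unfolding mult.assoc ysym_absorb_right[OF that] by (simp only: scal_left_commute)
qed

text \<open>A central \<open>z\<close> can be moved past the row permutations, so both absorption
  rules survive. This plays the role of Schur's lemma.\<close>

lemma ysym_central:
  assumes T: "is_tableau n F T" and z: "z \<in> galg (SG n)"
    and central: "\<And>x. x \<in> galg (SG n) \<Longrightarrow> z * x = x * z"
  shows "z * ysym n T = scal (coef (z * ysym n T) 0) * ysym n T"
proof (rule ysym_unique[OF T])
  show "z * ysym n T \<in> galg (SG n)" using z by (intro SG.galg_mult ysym_in)
  show "gel p * (z * ysym n T) = z * ysym n T" if "p \<in> rowG n T" for p
  proof -
    have "gel p \<in> galg (SG n)" using that by (auto simp: level_group_def)
    then have "gel p * (z * ysym n T) = z * (gel p * ysym n T)"
      using central by (metis mult.assoc)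
    then show ?thesis using ysym_absorb_left[OF that] by simp
  qed
  show "z * ysym n T * gel q = scal (psgn q) * (z * ysym n T)" if "q \<in> colG n T" for q
    unfolding mult.assoc ysym_absorb_right[OF that] by (simp only: scal_left_commute)
qed

section \<open>Normalization to primitive idempotents\<close>

text \<open>The factor by which the square of the symmetrizer exceeds it; classically the product of
  the hook lengths.\<close>

definition kap :: "nat \<Rightarrow> (nat \<Rightarrow> nat \<times> nat) \<Rightarrow> complex" where
  "kap n T = coef (ysym n T * ysym n T) 0"

lemma ysym_square:
  assumes T: "is_tableau n F T"
  shows "ysym n T * ysym n T = scal (kap n T) * ysym n T"
  using ysym_sandwich[OF T SG.galg_1] by (simp add: kap_def)

text \<open>With \<open>c = a * b\<close> and \<open>star c = b * a\<close>, the product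
  \<open>c * star c * c\<close> is \<open>c * c\<close> up to the orders of the row and column
  groups, because \<open>a * a\<close> and \<open>b * b\<close> are such multiples of
  \<open>a\<close> and \<open>b\<close>. If \<open>kap\<close> vanished, positivity would give
  \<open>c = 0\<close>, but \<open>c\<close> has coefficient 1 at the identity.\<close>

lemma kap_ne_0:
  assumes T: "is_tableau n F T"
  shows "kap n T \<noteq> 0"
proof
  assume "kap n T = 0"
  let ?a = "sym_sum (rowG n T)" and ?b = "alt_sum (colG n T)"
  have cc: "?a * ?b * (?a * ?b) = 0"
    using ysym_square[OF T] \<open>kap n T = 0\<close> by (simp add: ysym_def)
  have "ysym n T * star (ysym n T) * ysym n T = ?a * (?b * ?b) * (?a * ?a) * ?b"
    by (simp only: ysym_def star_mult row.star_sym_sum col.star_alt_sum mult.assoc)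
  also have "\<dots> = ?a * (scal (of_nat (card (colG n T))) * (?b * (scal (of_nat (card (rowG n T))) * (?a * ?b))))"
    unfolding row.sym_sum_mult(1)[OF order_refl] col.alt_sum_mult(1)[OF order_refl]
    by (simp only: mult.assoc)
  also have "\<dots> = scal (of_nat (card (colG n T))) * (?a * (?b * (scal (of_nat (card (rowG n T))) * (?a * ?b))))"
    by (rule scal_left_commute)
  also have "?b * (scal (of_nat (card (rowG n T))) * (?a * ?b)) = scal (of_nat (card (rowG n T))) * (?b * (?a * ?b))"
    by (rule scal_left_commute)
  also have "?a * (scal (of_nat (card (rowG n T))) * (?b * (?a * ?b))) = scal (of_nat (card (rowG n T))) * (?a * (?b * (?a * ?b)))"
    by (rule scal_left_commute)
  also have "?a * (?b * (?a * ?b)) = ?a * ?b * (?a * ?b)" by (simp only: mult.assoc)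
  finally have "ysym n T * star (ysym n T) * ysym n T = 0" unfolding cc by simp
  then have "ysym n T = 0" by (rule star_nilpotent_eq_0)
  then show False using coef_ysym_0[OF T] by simp
qed

text \<open>Suppose \<open>a\<close> and \<open>b\<close> share neither row nor column and
  \<open>tperm a b = p + q\<close>. Then \<open>q\<close> keeps the row and the column of every
  other number and fixes it, so it sends \<open>a\<close> to \<open>a\<close> or \<open>b\<close>.
  Columns exclude \<open>b\<close>, so \<open>q\<close> fixes \<open>a\<close> and \<open>p\<close>
  moves \<open>a\<close> to \<open>b\<close> within a row, a contradiction.\<close>

lemma coef_ysym_tperm:
  assumes T: "is_tableau n F T" and ab: "a \<in> {1..n}" "b \<in> {1..n}" "a \<noteq> b"
  shows "coef (ysym n T) (tperm a b) =
    (if fst (T a) = fst (T b) then 1 else if snd (T a) = snd (T b) then - 1 else 0)"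
proof (cases "fst (T a) = fst (T b) \<or> snd (T a) = snd (T b)")
  case True
  consider "fst (T a) = fst (T b)" | "fst (T a) \<noteq> fst (T b)" "snd (T a) = snd (T b)" using True by blast
  then show ?thesis
  proof cases
    case 1
    then have "tperm a b \<in> rowG n T" using ab by (intro tperm_in_level_group) auto
    then show ?thesis using 1 coef_ysym(1)[OF T _ col.zero_mem] by fastforce
  next
    case 2
    then have "tperm a b \<in> colG n T" using ab by (intro tperm_in_level_group) auto
    then show ?thesis using 2 coef_ysym(1)[OF T row.zero_mem] psgn_tperm[OF ab(3)] by fastforce
  qed
next
  case False
  have "tperm a b \<noteq> p + q" if p: "p \<in> rowG n T" and q: "q \<in> colG n T" for p q
  proof
    assume eq: "tperm a b = p + q"
    have fst_q: "fst (T (act q k)) = fst (T (act (tperm a b) k))" if "k \<in> {1..n}" for k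
    proof -
      have "act q k \<in> {1..n}" using q that SG_act by (auto simp: level_group_def)
      then have "fst (T (act p (act q k))) = fst (T (act q k))" using p by (auto simp: level_group_def)
      then show ?thesis by (simp add: eq)
    qed
    have snd_q: "snd (T (act q k)) = snd (T k)" if "k \<in> {1..n}" for k
      using q that by (simp add: level_group_def)
    have inj: "act q k = l" if "T (act q k) = T l" "k \<in> {1..n}" "l \<in> {1..n}" for k l
    proof -
      have "act q k \<in> {1..n}" using q that SG_act by (auto simp: level_group_def)
      then show ?thesis using that T unfolding is_tableau_def bij_betw_def inj_on_def by blast
    qed
    have fixed: "act q k = k" if "k \<in> {1..n}" "k \<noteq> a" "k \<noteq> b" for k
      using fst_q[of k] snd_q[of k] that by (intro inj) (auto simp: prod_eq_iff Transposition.transpose_def)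
    have "act q a \<in> {a, b}"
    proof (rule ccontr)
      assume *: "act q a \<notin> {a, b}"
      have "act q a \<in> {1..n}" using q ab SG_act by (auto simp: level_group_def)
      then have "act q (act q a) = act q a" using fixed * by blast
      then have "act q a = a" using bij_act[of q] by (metis bij_is_inj inj_eq)
      then show False using * by blast
    qed
    moreover have "act q a \<noteq> b" using snd_q[OF ab(1)] False by auto
    ultimately have "act q a = a" by blast
    then have "fst (T a) = fst (T b)" using fst_q[OF ab(1)] by simp
    then show False using False by blast
  qed
  then have "coef (ysym n T) (tperm a b) = 0" using coef_ysym(2)[OF T] by blast
  then show ?thesis using False by simp
qed

definition yidem :: "nat \<Rightarrow> (nat \<Rightarrow> nat \<times> nat) \<Rightarrow> nat_perm group_ring" where
  "yidem n T = scal (1 / kap n T) * ysym n T"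

lemma yidem_in: "yidem n T \<in> galg (SG n)"
  unfolding yidem_def by (intro galg_scal_mult ysym_in)

lemma yidem_idem:
  assumes "is_tableau n F T"
  shows "yidem n T * yidem n T = yidem n T"
  using kap_ne_0[OF assms]
  unfolding yidem_def scal_mult_mult_scal ysym_square[OF assms] scal_mult_assoc by simp

lemma coef_yidem_0: "is_tableau n F T \<Longrightarrow> coef (yidem n T) 0 = 1 / kap n T"
  by (simp add: yidem_def coef_ysym_0)

lemma yidem_sandwich:
  assumes T: "is_tableau n F T" and x: "x \<in> galg (SG n)"
  shows "yidem n T * x * yidem n T = scal (kap n T * coef (yidem n T * x * yidem n T) 0) * yidem n T"
proof -
  have "yidem n T * x * yidem n T = scal (1 / kap n T * (1 / kap n T)) * (ysym n T * x * ysym n T)"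
    unfolding yidem_def by (simp only: mult.assoc[of "scal _" "ysym n T" x] scal_mult_mult_scal)
  also have "\<dots> = scal (1 / kap n T * (1 / kap n T)) *
      (scal (coef (ysym n T * x * ysym n T) 0) * ysym n T)"
    using ysym_sandwich[OF T x] by simp
  finally obtain s where s: "yidem n T * x * yidem n T = scal s * ysym n T"
    unfolding scal_mult_assoc by blast
  have c: "coef (yidem n T * x * yidem n T) 0 = s" unfolding s by (simp add: coef_ysym_0[OF T])
  have "scal s * ysym n T = scal (kap n T * s) * yidem n T"
    unfolding yidem_def scal_mult_assoc using kap_ne_0[OF T] by simp
  then show ?thesis unfolding c unfolding s .
qed

lemma yidem_orthogonal:
  assumes "is_tableau n F T" "is_tableau n F' T'" "F \<noteq> F'" "x \<in> galg (SG n)"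
  shows "yidem n T * x * yidem n T' = 0"
proof -
  have "yidem n T * x * yidem n T' = scal (1 / kap n T * (1 / kap n T')) * (ysym n T * x * ysym n T')"
    unfolding yidem_def by (simp only: mult.assoc[of "scal _" "ysym n T" x] scal_mult_mult_scal)
  then show ?thesis using ysym_orthogonal[OF assms] by simp
qed

lemma kap_same_shape:
  assumes "is_tableau n F T" "is_tableau n F T'"
  shows "kap n T' = kap n T"
proof -
  obtain g where g: "ysym n T' = gel g * ysym n T * gel (- g)"
    using ysym_conj_same_shape[OF assms] by blast
  have "ysym n T' * ysym n T' = gel g * ysym n T * (gel (- g) * gel g) * ysym n T * gel (- g)"
    unfolding g by (simp only: mult.assoc)
  also have "\<dots> = gel g * (ysym n T * ysym n T * gel (- g))"
    by (simp add: gel_mult mult.assoc)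
  finally have "coef (ysym n T' * ysym n T') 0 = coef (gel g * (ysym n T * ysym n T * gel (- g))) 0"
    by simp
  also have "\<dots> = coef (ysym n T * ysym n T * gel (- g) * gel g) 0"
    by (rule coef_mult_commute_0)
  also have "\<dots> = coef (ysym n T * ysym n T) 0" by (simp add: mult.assoc gel_mult)
  finally show ?thesis by (simp add: kap_def)
qed

lemma yidem_conj_same_shape:
  assumes "is_tableau n F T" "is_tableau n F T'"
  obtains g where "g \<in> SG n" "yidem n T' = gel g * yidem n T * gel (- g)"
proof -
  obtain g where g: "g \<in> SG n" "ysym n T' = gel g * ysym n T * gel (- g)"
    using ysym_conj_same_shape[OF assms] by blast
  have "yidem n T' = gel g * yidem n T * gel (- g)"
    unfolding yidem_def kap_same_shape[OF assms] g(2)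
    by (simp only: mult.assoc scal_left_commute[of "gel g"])
  then show thesis using that g(1) by blast
qed

lemma tableau_card: "is_tableau n F T \<Longrightarrow> card F = n"
  unfolding is_tableau_def using bij_betw_same_card by fastforce

lemma ex_tableau:
  assumes "young_diagram F" "card F = n"
  obtains T where "is_tableau n F T"
  using ex_bij_betw_nat_finite_1[OF young_diagram_finite[OF assms(1)]] assms
  unfolding is_tableau_def by blast

text \<open>The dimension of the Specht module of shape \<open>F\<close>.\<close>
definition sdim :: "(nat \<times> nat) set \<Rightarrow> real" where
  "sdim F = Re (fact (card F) / kap (card F) (SOME T. is_tableau (card F) F T))"

text \<open>The \<open>Re\<close> in \<open>sdim\<close> loses nothing: \<open>n!\<close> times the
  identity coefficient of an idempotent is a natural number. The choice of the tableau is immaterial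
  because conjugation preserves \<open>kap\<close>.\<close>

lemma of_real_sdim:
  assumes T: "is_tableau n F T"
  shows "complex_of_real (sdim F) = fact n * coef (yidem n T) 0"
proof -
  have "is_tableau n F (SOME T. is_tableau n F T)" using T by (rule someI[of "is_tableau n F"])
  then have s: "sdim F = Re (fact n * coef (yidem n T) 0)"
    unfolding sdim_def tableau_card[OF T] using kap_same_shape[OF T] by (simp add: coef_yidem_0[OF T])
  obtain d :: nat where "of_nat (card (SG n)) * coef (yidem n T) 0 = of_nat d"
    using SG.idempotent_coef_0[OF yidem_in yidem_idem[OF T]] by blast
  then have "fact n * coef (yidem n T) 0 = complex_of_real (real d)" by (simp add: card_SG)
  then show ?thesis unfolding s by simp
qed

lemma sdim_nonneg:
  assumes "young_diagram F"
  shows "0 \<le> sdim F"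
proof -
  obtain T where T: "is_tableau (card F) F T" using ex_tableau[OF assms] by blast
  obtain d :: nat where "of_nat (card (SG (card F))) * coef (yidem (card F) T) 0 = of_nat d"
    using SG.idempotent_coef_0[OF yidem_in yidem_idem[OF T]] by blast
  then have "complex_of_real (sdim F) = complex_of_real (real d)"
    unfolding of_real_sdim[OF T] by (simp add: card_SG)
  then have "sdim F = real d" by (simp only: of_real_eq_iff)
  then show ?thesis by simp
qed

section \<open>The branching rule\<close>

lemma tableau_extend:
  assumes T: "is_tableau m F T" and x: "x \<in> addable F"
  shows "is_tableau (Suc m) (insert x F) (T(Suc m := x))"
proof -
  have bij: "bij_betw T {1..m} F" and yd: "young_diagram (insert x F)" and xF: "x \<notin> F"
    using T x by (auto simp: is_tableau_def addable_def)
  have "bij_betw (T(Suc m := x)) {1..m} F"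
    using bij by (rule bij_betw_cong[THEN iffD1, rotated]) simp
  then have "bij_betw (T(Suc m := x)) ({1..m} \<union> {Suc m}) (F \<union> {x})"
    using xF notIn_Un_bij_betw[of "Suc m" "{1..m}" "T(Suc m := x)" F] by simp
  moreover have "{1..m} \<union> {Suc m} = {1..Suc m}" "F \<union> {x} = insert x F" by auto
  ultimately show ?thesis using yd by (simp only: is_tableau_def)
qed

lemma level_group_extend:
  assumes "\<And>a. a \<in> {1..m} \<Longrightarrow> f' a = f a"
  shows "level_group m f \<subseteq> level_group (Suc m) f'"
proof
  fix p assume p: "p \<in> level_group m f"
  then have pm: "p \<in> SG m" by (simp add: level_group_def)
  have "f' (act p a) = f' a" if a: "a \<in> {1..Suc m}" for a
  proof (cases "a \<in> {1..m}")
    case True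
    then show ?thesis using p SG_act[OF pm True] assms by (simp add: level_group_def)
  next
    case False
    then show ?thesis using SG_act_outside[OF pm] by simp
  qed
  then show "p \<in> level_group (Suc m) f'"
    using subsetD[OF SG_mono[of m "Suc m"] pm] by (simp add: level_group_def)
qed

text \<open>Right multiplication by \<open>u\<close> and \<open>v\<close> gives maps from
  \<open>A e'\<close> to \<open>A e\<close> and back whose composite is the identity of
  \<open>A e'\<close>, where \<open>A\<close> is the larger algebra. Thus the larger shape occurs in
  the induced module. The row and column groups of \<open>T\<close> are contained in those of
  \<open>T'\<close>, so \<open>?a\<close> and \<open>?b\<close> absorb the two factors of
  \<open>?c\<close>.\<close>

lemma branching_intertwiners:
  assumes T: "is_tableau m F T" and x: "x \<in> addable F"
  defines "T' \<equiv> T(Suc m := x)"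
  obtains u v where "u \<in> galg (SG (Suc m))" "v \<in> galg (SG (Suc m))"
    "yidem (Suc m) T' * u = u" "u * yidem m T = u" "yidem m T * v = v" "v * yidem (Suc m) T' = v"
    "u * v = yidem (Suc m) T'"
proof -
  have T': "is_tableau (Suc m) (insert x F) T'"
    unfolding T'_def using T x by (rule tableau_extend)
  let ?a = "sym_sum (rowG (Suc m) T')" and ?b = "alt_sum (colG (Suc m) T')"
  let ?c = "ysym m T" and ?c' = "ysym (Suc m) T'"
  let ?k = "of_nat (card (rowG m T)) * of_nat (card (colG m T)) :: complex"
  let ?\<kappa> = "kap m T" and ?\<kappa>' = "kap (Suc m) T'"
  have sub: "rowG m T \<subseteq> rowG (Suc m) T'" "colG m T \<subseteq> colG (Suc m) T'"
    by (rule level_group_extend; simp add: T'_def)+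
  have k: "?k \<noteq> 0" using row.card_pos[of m T] col.card_pos[of m T] by simp
  have "?a * ?c * ?b = (?a * sym_sum (rowG m T)) * (alt_sum (colG m T) * ?b)"
    by (simp only: ysym_def mult.assoc)
  also have "\<dots> = scal ?k * ?c'"
    unfolding row.sym_sum_mult(1)[OF sub(1)] col.alt_sum_mult(2)[OF sub(2)] scal_mult_mult_scal
    by (simp only: ysym_def)
  finally have acb: "?a * ?c * ?b = scal ?k * ?c'" .
  let ?e = "yidem m T" and ?e' = "yidem (Suc m) T'"
  \<comment> \<open>In \<open>?e' * ?a * ?e * ?b * ?e'\<close> the idempotent \<open>?e\<close>
    contributes \<open>1 / ?\<kappa>\<close>, the absorption \<open>?k\<close>, and
    \<open>?c'\<close> is \<open>?\<kappa>'\<close> times \<open>?e'\<close>.\<close>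
  define \<beta> where "\<beta> = ?k * ?\<kappa>' / ?\<kappa>"
  have \<beta>: "\<beta> \<noteq> 0" using k kap_ne_0[OF T] kap_ne_0[OF T'] by (simp add: \<beta>_def)
  let ?u = "?e' * ?a * ?e" and ?v = "?e * ?b * ?e'"
  have ee: "?e * ?e = ?e" "?e' * ?e' = ?e'" using yidem_idem T T' by blast+
  have "?u * ?v = ?e' * (?a * (?e * ?e) * ?b) * ?e'" by (simp only: mult.assoc)
  also have "?a * (?e * ?e) * ?b = scal (1 / ?\<kappa>) * (?a * ?c * ?b)"
  proof -
    have "?a * ?e * ?b = scal (1 / ?\<kappa>) * (?a * ?c) * ?b"
      unfolding yidem_def scal_left_commute[of ?a] ..
    then show ?thesis unfolding ee by (simp only: mult.assoc)
  qed
  also have "\<dots> = scal \<beta> * ?e'"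
  proof -
    have "1 / ?\<kappa> * ?k = \<beta> * (1 / ?\<kappa>')" using kap_ne_0[OF T'] by (simp add: \<beta>_def)
    then show ?thesis unfolding acb yidem_def scal_mult_assoc by (rule arg_cong)
  qed
  also have "?e' * (scal \<beta> * ?e') = scal \<beta> * (?e' * ?e')"
    by (rule scal_left_commute)
  finally have uv: "?u * ?v = scal \<beta> * ?e'" unfolding ee mult.assoc .
  have e_in: "?e \<in> galg (SG (Suc m))"
    using galg_mono[OF SG_mono yidem_in] by simp
  have u1: "?e' * ?u = ?u" by (simp only: ee(2) flip: mult.assoc)
  have u2: "?u * ?e = ?u" by (simp only: ee mult.assoc)
  have v1: "?e * ?v = ?v" by (simp only: ee(1) flip: mult.assoc)
  have v2: "?v * ?e' = ?v" by (simp only: ee mult.assoc)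
  show thesis
  proof (rule that[of "scal (1 / \<beta>) * ?u" ?v])
    show "scal (1 / \<beta>) * ?u \<in> galg (SG (Suc m))" "?v \<in> galg (SG (Suc m))"
      by (intro galg_scal_mult SG.galg_mult yidem_in e_in row.sym_sum_in col.alt_sum_in)+
    show "?e' * (scal (1 / \<beta>) * ?u) = scal (1 / \<beta>) * ?u"
      unfolding scal_left_commute[of ?e'] u1 ..
    show "scal (1 / \<beta>) * ?u * ?e = scal (1 / \<beta>) * ?u"
      unfolding mult.assoc[of "scal (1 / \<beta>)" ?u ?e] u2 ..
    show "?e * ?v = ?v" "?v * ?e' = ?v" by (rule v1 v2)+
    show "scal (1 / \<beta>) * ?u * ?v = ?e'"
      unfolding mult.assoc[of "scal (1 / \<beta>)" ?u ?v] uv scal_mult_assoc using \<beta> by simp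
  qed
qed

section \<open>Sums of transpositions and contents\<close>

definition transps :: "nat \<Rightarrow> nat_perm set" where
  "transps n = {tperm a b | a b. a \<in> {1..n} \<and> b \<in> {1..n} \<and> a \<noteq> b}"

definition last_transps :: "nat \<Rightarrow> nat_perm set" where
  "last_transps m = (\<lambda>a. tperm a (Suc m)) ` {1..m}"

lemma transps_sub: "transps n \<subseteq> SG n"
  unfolding transps_def using tperm_in_SG by blast

lemma finite_transps: "finite (transps n)"
  using transps_sub SG.fin by (rule finite_subset)

lemma finite_last_transps: "finite (last_transps m)"
  by (simp add: last_transps_def)

lemma transps_Suc: "transps (Suc m) = transps m \<union> last_transps m"
proof (intro equalityI subsetI)
  fix t assume "t \<in> transps (Suc m)"
  then obtain a b where t: "t = tperm a b" "a \<in> {1..Suc m}" "b \<in> {1..Suc m}" "a \<noteq> b"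
    unfolding transps_def by blast
  have comm: "tperm a b = tperm b a" by (simp add: tperm_def transpose_commute)
  consider "a = Suc m" | "b = Suc m" | "a \<noteq> Suc m" "b \<noteq> Suc m" by blast
  then show "t \<in> transps m \<union> last_transps m"
  proof cases
    case 1
    then have "b \<in> {1..m}" using t by auto
    then show ?thesis using t 1 comm unfolding last_transps_def by blast
  next
    case 2
    then have "a \<in> {1..m}" using t by auto
    then show ?thesis using t 2 unfolding last_transps_def by blast
  next
    case 3
    then have "a \<in> {1..m}" "b \<in> {1..m}" using t by auto
    then show ?thesis using t unfolding transps_def by blast
  qed
next
  fix t assume "t \<in> transps m \<union> last_transps m"
  then consider a b where "t = tperm a b" "a \<in> {1..m}" "b \<in> {1..m}" "a \<noteq> b"
    | a where "t = tperm a (Suc m)" "a \<in> {1..m}"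
    unfolding transps_def last_transps_def by blast
  then show "t \<in> transps (Suc m)"
  proof cases
    case 1
    then have "a \<in> {1..Suc m}" "b \<in> {1..Suc m}" by auto
    then show ?thesis using 1 unfolding transps_def by blast
  next
    case 2
    then have "a \<in> {1..Suc m}" "Suc m \<in> {1..Suc m}" "a \<noteq> Suc m" by auto
    then show ?thesis using 2 unfolding transps_def by blast
  qed
qed

lemma transps_disjoint: "transps m \<inter> last_transps m = {}"
proof -
  have "act t (Suc m) = Suc m" if "t \<in> transps m" for t
    using that transps_sub[of m] SG_act_outside[of t m "Suc m"] by auto
  moreover have "act t (Suc m) \<noteq> Suc m" if "t \<in> last_transps m" for t
    using that by (auto simp: last_transps_def)
  ultimately show ?thesis by blast
qed

lemma sym_sum_transps_Suc: "sym_sum (transps (Suc m)) = sym_sum (transps m) + sym_sum (last_transps m)"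
  unfolding sym_sum_def transps_Suc
  by (rule sum.union_disjoint) (rule finite_transps finite_last_transps transps_disjoint)+

lemma transps_in: "sym_sum (transps n) \<in> galg (SG n)"
  unfolding sym_sum_def using transps_sub by (intro galg_sum) auto

lemma transps_central:
  assumes x: "x \<in> galg (SG n)"
  shows "sym_sum (transps n) * x = x * sym_sum (transps n)"
proof -
  have conj: "k - g \<in> transps n \<longleftrightarrow> - g + k \<in> transps n" if g: "g \<in> SG n" for g k
  proof -
    have 1: "h + t - h \<in> transps n" if h: "h \<in> SG n" and t: "t \<in> transps n" for h t
    proof -
      obtain a b where ab: "t = tperm a b" "a \<in> {1..n}" "b \<in> {1..n}" "a \<noteq> b"
        using t unfolding transps_def by blast
      have "act h a \<noteq> act h b" using ab(4) by (metis act_uminus_act)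
      moreover have "h + t - h = tperm (act h a) (act h b)" unfolding ab(1) by (rule tperm_conj)
      ultimately show ?thesis
        using SG_act[OF h ab(2)] SG_act[OF h ab(3)] unfolding transps_def by blast
    qed
    have "- g + k = - g + (k - g) - (- g)" by (simp add: add.assoc)
    moreover have "k - g = g + (- g + k) - g" by simp
    ultimately show ?thesis using 1[OF g, of "- g + k"] 1[OF SG.uminus_mem[OF g], of "k - g"] by metis
  qed
  have gel: "sym_sum (transps n) * gel g = gel g * sym_sum (transps n)" if "g \<in> SG n" for g
    by (rule poly_mapping_eqI) (simp add: coef_sym_sum finite_transps conj[OF that])
  have "sym_sum (transps n) * x = (\<Sum>g\<in>SG n. scal (coef x g) * (sym_sum (transps n) * gel g))"
    using arg_cong[OF group_ring_expansion[OF x SG.fin], of "\<lambda>x. sym_sum (transps n) * x"]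
    by (simp only: sum_distrib_left scal_left_commute)
  also have "\<dots> = (\<Sum>g\<in>SG n. scal (coef x g) * gel g) * sym_sum (transps n)"
    unfolding sum_distrib_right by (intro sum.cong refl) (simp only: gel mult.assoc)
  also have "\<dots> = x * sym_sum (transps n)"
    by (rule arg_cong[OF group_ring_expansion[OF x SG.fin], symmetric, where f = "\<lambda>x. x * _"])
  finally show ?thesis .
qed

text \<open>A central element acts by the identity coefficient of its product with the symmetrizer.
  As transpositions are involutions, this is the sum of the coefficients of the symmetrizer at
  them.\<close>

lemma sym_sum_transps_yidem:
  assumes T: "is_tableau n F T"
  shows "sym_sum (transps n) * yidem n T = scal (\<Sum>t\<in>transps n. coef (ysym n T) t) * yidem n T"
proof -
  have in_galg: "sym_sum (transps n) \<in> galg (transps n)"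
    by (simp add: galg_iff coef_sym_sum finite_transps)
  have "- t = t" if "t \<in> transps n" for t using that by (auto simp: transps_def)
  then have 0: "coef (sym_sum (transps n) * ysym n T) 0 = (\<Sum>t\<in>transps n. coef (ysym n T) t)"
    unfolding coef_mult[OF in_galg finite_transps]
    by (intro sum.cong refl) (simp add: coef_sym_sum finite_transps)
  have "sym_sum (transps n) * ysym n T = scal (\<Sum>t\<in>transps n. coef (ysym n T) t) * ysym n T"
    using ysym_central[OF T transps_in transps_central] unfolding 0 .
  then have "scal (1 / kap n T) * (sym_sum (transps n) * ysym n T) =
     scal (1 / kap n T * (\<Sum>t\<in>transps n. coef (ysym n T) t)) * ysym n T"
    by (simp only: scal_mult_assoc)
  then show ?thesis
    unfolding yidem_def scal_mult_assoc scal_left_commute[of "sym_sum (transps n)"]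
    by (simp only: mult.commute)
qed

text \<open>Transpositions within \<open>{1..m}\<close> see the same positions in both tableaux and
  cancel. For \<open>x = (i, j)\<close>, the transposition of \<open>a\<close> with
  \<open>Suc m\<close> counts \<open>+1\<close> if \<open>a\<close> lies in row \<open>i\<close> and
  \<open>-1\<close> if it lies in column \<open>j\<close>; there are \<open>j - 1\<close> numbers of
  the first kind and \<open>i - 1\<close> of the second.\<close>

lemma content_eq_transps:
  assumes T: "is_tableau m F T" and x: "x \<in> addable F"
  defines "T' \<equiv> T(Suc m := x)"
  shows "(\<Sum>t\<in>transps (Suc m). coef (ysym (Suc m) T') t) - (\<Sum>t\<in>transps m. coef (ysym m T) t) =
    of_int (cell_content x)"
proof -
  have T': "is_tableau (Suc m) (insert x F) T'"
    unfolding T'_def using T x by (rule tableau_extend)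
  have F: "young_diagram F" "bij_betw T {1..m} F" and G: "young_diagram (insert x F)" and xF: "x \<notin> F"
    using T x by (auto simp: is_tableau_def addable_def)
  obtain i j where ij: "x = (i, j)" by force
  have pos: "1 \<le> i" "1 \<le> j" using young_diagram_pos[OF G] ij by auto
  have row: "{l. (i, l) \<in> F} = {1..<j}"
  proof (intro equalityI subsetI)
    fix l assume "l \<in> {l. (i, l) \<in> F}"
    moreover have False if "j \<le> l" "(i, l) \<in> F"
      using young_diagram_down[OF F(1) that(2), of i j] that pos ij xF by simp
    ultimately show "l \<in> {1..<j}" using young_diagram_pos[OF F(1), of i l] by force
  next
    fix l assume "l \<in> {1..<j}"
    then show "l \<in> {l. (i, l) \<in> F}" using young_diagram_down[OF G, of i j i l] ij pos by simp
  qed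
  have col: "{l. (l, j) \<in> F} = {1..<i}"
  proof (intro equalityI subsetI)
    fix l assume "l \<in> {l. (l, j) \<in> F}"
    moreover have False if "i \<le> l" "(l, j) \<in> F"
      using young_diagram_down[OF F(1) that(2), of i j] that pos ij xF by simp
    ultimately show "l \<in> {1..<i}" using young_diagram_pos[OF F(1), of l j] by force
  next
    fix l assume "l \<in> {1..<i}"
    then show "l \<in> {l. (l, j) \<in> F}" using young_diagram_down[OF G, of i j l j] ij pos by simp
  qed
  have TF: "(\<lambda>a. (fst (T a), snd (T a))) ` {1..m} = F" "inj_on (\<lambda>a. (fst (T a), snd (T a))) {1..m}"
    using F(2) by (simp_all add: bij_betw_def)
  have cards: "card {a \<in> {1..m}. fst (T a) = i} = j - 1" "card {a \<in> {1..m}. snd (T a) = j} = i - 1"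
    using card_fst_fibre[OF TF(2), of i] card_snd_fibre[OF TF(2), of j] unfolding TF(1) row col by simp_all
  have old: "coef (ysym (Suc m) T') t = coef (ysym m T) t" if "t \<in> transps m" for t
  proof -
    note old = that
    obtain a b where t: "t = tperm a b" and ab: "a \<in> {1..m}" "b \<in> {1..m}" "a \<noteq> b"
      using old unfolding transps_def by blast
    have ab': "a \<in> {1..Suc m}" "b \<in> {1..Suc m}" and "T' a = T a" "T' b = T b"
      using ab by (auto simp: T'_def)
    then show ?thesis
      unfolding t coef_ysym_tperm[OF T ab] coef_ysym_tperm[OF T' ab' ab(3)] by simp
  qed
  have new: "coef (ysym (Suc m) T') (tperm a (Suc m)) =
      (if fst (T a) = i then 1 else 0) - (if snd (T a) = j then 1 else 0)" if a: "a \<in> {1..m}" for a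
  proof -
    have a': "a \<in> {1..Suc m}" "Suc m \<in> {1..Suc m}" "a \<noteq> Suc m" using a by auto
    have "T a \<in> F" using F(2) a by (rule bij_betw_apply)
    then have "\<not> (fst (T a) = i \<and> snd (T a) = j)" using xF ij by auto
    moreover have "T' a = T a" "T' (Suc m) = (i, j)" using a ij by (auto simp: T'_def)
    ultimately show ?thesis unfolding coef_ysym_tperm[OF T' a'] by auto
  qed
  have inj: "inj_on (\<lambda>a. tperm a (Suc m)) {1..m}"
  proof (rule inj_onI)
    fix a b assume "tperm a (Suc m) = tperm b (Suc m)"
    then have "act (tperm a (Suc m)) (Suc m) = act (tperm b (Suc m)) (Suc m)" by (rule arg_cong)
    then show "a = b" by simp
  qed
  have "(\<Sum>t\<in>last_transps m. coef (ysym (Suc m) T') t) =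
      (\<Sum>a\<in>{1..m}. (if fst (T a) = i then 1 else 0) - (if snd (T a) = j then 1 else 0))"
    unfolding last_transps_def sum.reindex[OF inj] by (rule sum.cong) (simp_all only: new comp_apply)
  also have "\<dots> = of_nat (card {a \<in> {1..m}. fst (T a) = i}) - of_nat (card {a \<in> {1..m}. snd (T a) = j})"
    by (simp add: sum_subtractf flip: sum.inter_filter)
  also have "\<dots> = of_int (cell_content x)"
    unfolding cards using pos ij by (simp add: cell_content_def of_nat_diff)
  finally have "(\<Sum>t\<in>last_transps m. coef (ysym (Suc m) T') t) = of_int (cell_content x)" .
  moreover have "(\<Sum>t\<in>transps (Suc m). coef (ysym (Suc m) T') t) =
      (\<Sum>t\<in>transps m. coef (ysym (Suc m) T') t) + (\<Sum>t\<in>last_transps m. coef (ysym (Suc m) T') t)"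
    unfolding transps_Suc
    by (rule sum.union_disjoint) (rule finite_transps finite_last_transps transps_disjoint)+
  moreover have "(\<Sum>t\<in>transps m. coef (ysym (Suc m) T') t) = (\<Sum>t\<in>transps m. coef (ysym m T) t)"
    by (rule sum.cong) (simp_all add: old)
  ultimately show ?thesis by simp
qed

text \<open>The Jucys--Murphy element \<open>sym_sum (last_transps m)\<close> acts on the constituent with the new
  cell \<open>x\<close> by the content of \<open>x\<close>, as the difference of two central elements.\<close>
lemma branching_idempotents:
  assumes T: "is_tableau m F T"
  obtains p where
    "\<And>x. x \<in> addable F \<Longrightarrow> p x \<in> galg (SG (Suc m))"
    "\<And>x. x \<in> addable F \<Longrightarrow> yidem m T * p x = p x"
    "\<And>x. x \<in> addable F \<Longrightarrow> p x * yidem m T = p x"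
    "\<And>x y. x \<in> addable F \<Longrightarrow> y \<in> addable F \<Longrightarrow> p x * p y = (if x = y then p x else 0)"
    "\<And>x z. x \<in> addable F \<Longrightarrow> z \<in> galg (SG (Suc m)) \<Longrightarrow>
      tr (SG (Suc m)) z (p x) = tr (SG (Suc m)) z (yidem (Suc m) (T(Suc m := x)))"
    "\<And>x. x \<in> addable F \<Longrightarrow>
      sym_sum (last_transps m) * p x = scal (of_int (cell_content x)) * p x"
proof -
  let ?S = "SG (Suc m)" and ?e = "yidem m T" and ?e' = "\<lambda>x. yidem (Suc m) (T(Suc m := x))"
  have "\<forall>x\<in>addable F. \<exists>u v. u \<in> galg ?S \<and> v \<in> galg ?S \<and>
      ?e' x * u = u \<and> u * ?e = u \<and> ?e * v = v \<and> v * ?e' x = v \<and> u * v = ?e' x"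
    using branching_intertwiners[OF T] by metis
  from bchoice[OF this] obtain u where "\<forall>x\<in>addable F. \<exists>v. u x \<in> galg ?S \<and> v \<in> galg ?S \<and>
      ?e' x * u x = u x \<and> u x * ?e = u x \<and> ?e * v = v \<and> v * ?e' x = v \<and> u x * v = ?e' x"
    by blast
  from bchoice[OF this] obtain v where
    uv: "\<And>x. x \<in> addable F \<Longrightarrow> u x \<in> galg ?S" "\<And>x. x \<in> addable F \<Longrightarrow> v x \<in> galg ?S"
      "\<And>x. x \<in> addable F \<Longrightarrow> ?e' x * u x = u x" "\<And>x. x \<in> addable F \<Longrightarrow> u x * ?e = u x"
      "\<And>x. x \<in> addable F \<Longrightarrow> ?e * v x = v x" "\<And>x. x \<in> addable F \<Longrightarrow> v x * ?e' x = v x"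
      "\<And>x. x \<in> addable F \<Longrightarrow> u x * v x = ?e' x"
    by blast
  show thesis
  \<comment> \<open>Since \<open>u x * v x\<close> is the idempotent of the larger shape, the
    reversed product is an equivalent idempotent, now lying below \<open>?e\<close>.\<close>
  proof (rule that[of "\<lambda>x. v x * u x"])
    fix x assume x: "x \<in> addable F"
    show "v x * u x \<in> galg ?S" using uv x by (intro SG.galg_mult)
    show "?e * (v x * u x) = v x * u x" using uv(5)[OF x] by (simp flip: mult.assoc)
    show "v x * u x * ?e = v x * u x" using uv(4)[OF x] by (simp add: mult.assoc)
    have T': "is_tableau (Suc m) (insert x F) (T(Suc m := x))" using T x by (rule tableau_extend)
    show "tr ?S z (v x * u x) = tr ?S z (?e' x)" if "z \<in> galg ?S" for z
      using SG.tr_commute_right[OF that uv(2)[OF x] uv(1)[OF x]] uv(7)[OF x] by simp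
    let ?Z = "sym_sum (transps m)" and ?Z' = "sym_sum (transps (Suc m))"
    let ?z = "\<Sum>t\<in>transps m. coef (ysym m T) t"
      and ?z' = "\<Sum>t\<in>transps (Suc m). coef (ysym (Suc m) (T(Suc m := x))) t"
    \<comment> \<open>The larger class sum is central, passes \<open>v x\<close> and acts on
      \<open>?e' x\<close> at its right end; the smaller one acts on \<open>?e\<close> at its left
      end.\<close>
    have "?Z' * v x = v x * ?Z'" using transps_central[OF uv(2)[OF x]] .
    also have "\<dots> = v x * (?e' x * ?Z')" using uv(6)[OF x] by (simp flip: mult.assoc)
    also have "?e' x * ?Z' = ?Z' * ?e' x" by (rule transps_central[OF yidem_in, symmetric])
    also have "\<dots> = scal ?z' * ?e' x" by (rule sym_sum_transps_yidem[OF T'])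
    also have "v x * \<dots> = scal ?z' * v x"
      unfolding scal_left_commute[of "v x"] uv(6)[OF x] ..
    finally have Z': "?Z' * v x = scal ?z' * v x" .
    have "?Z * v x = ?Z * ?e * v x" using uv(5)[OF x] by (simp add: mult.assoc)
    also have "\<dots> = scal ?z * v x" unfolding sym_sum_transps_yidem[OF T] mult.assoc uv(5)[OF x] ..
    finally have Z: "?Z * v x = scal ?z * v x" .
    have "sym_sum (last_transps m) * v x = ?Z' * v x - ?Z * v x"
      by (simp add: sym_sum_transps_Suc algebra_simps)
    also have "\<dots> = scal (of_int (cell_content x)) * v x"
      unfolding Z Z' content_eq_transps[OF T x, symmetric] by (simp add: single_diff algebra_simps)
    finally show "sym_sum (last_transps m) * (v x * u x) = scal (of_int (cell_content x)) * (v x * u x)"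
      by (simp only: flip: mult.assoc)
  next
    fix x y assume x: "x \<in> addable F" and y: "y \<in> addable F"
    show "v x * u x * (v y * u y) = (if x = y then v x * u x else 0)"
    proof (cases "x = y")
      case True
      have "v x * u x * (v x * u x) = v x * (u x * v x) * u x" by (simp only: mult.assoc)
      then show ?thesis using True uv(6,7)[OF x] by simp
    next
      case False
      have "insert x F \<noteq> insert y F" using x y False by (auto simp: addable_def)
      then have 0: "?e' x * (u x * v y) * ?e' y = 0"
        using uv(1)[OF x] uv(2)[OF y]
        by (intro yidem_orthogonal[OF tableau_extend[OF T x] tableau_extend[OF T y]] SG.galg_mult) auto
      have "v x * u x * (v y * u y) = v x * (u x * v y) * u y" by (simp only: mult.assoc)
      also have "u x * v y = (?e' x * u x) * (v y * ?e' y)" unfolding uv(3)[OF x] uv(6)[OF y] ..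
      also have "\<dots> = 0" using 0 by (simp only: mult.assoc)
      finally show ?thesis using False by simp
    qed
  qed
qed

text \<open>The left side is the dimension of the induced module, and \<open>d\<close> is that of
  the ideal generated by \<open>yidem m T\<close> minus the sum of the \<open>p x\<close>, the part
  not covered by the expected constituents. The decomposition is stated conditionally because
  \<open>d = 0\<close> results only from the comparison with restriction.\<close>

lemma branching_decomposition:
  assumes T: "is_tableau m F T"
  obtains p and d :: nat where
    "real (Suc m) * sdim F = (\<Sum>x\<in>addable F. sdim (insert x F)) + real d"
    "d = 0 \<Longrightarrow> yidem m T = (\<Sum>x\<in>addable F. p x)"
    "\<And>x z. x \<in> addable F \<Longrightarrow> z \<in> galg (SG (Suc m)) \<Longrightarrow>
      tr (SG (Suc m)) z (p x) = tr (SG (Suc m)) z (yidem (Suc m) (T(Suc m := x)))"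
    "\<And>x. x \<in> addable F \<Longrightarrow>
      sym_sum (last_transps m) * p x = scal (of_int (cell_content x)) * p x"
proof -
  obtain p where p: "\<And>x. x \<in> addable F \<Longrightarrow> p x \<in> galg (SG (Suc m))"
    "\<And>x. x \<in> addable F \<Longrightarrow> yidem m T * p x = p x"
    "\<And>x. x \<in> addable F \<Longrightarrow> p x * yidem m T = p x"
    "\<And>x y. x \<in> addable F \<Longrightarrow> y \<in> addable F \<Longrightarrow> p x * p y = (if x = y then p x else 0)"
    "\<And>x z. x \<in> addable F \<Longrightarrow> z \<in> galg (SG (Suc m)) \<Longrightarrow>
      tr (SG (Suc m)) z (p x) = tr (SG (Suc m)) z (yidem (Suc m) (T(Suc m := x)))"
    and jm: "\<And>x. x \<in> addable F \<Longrightarrow>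
      sym_sum (last_transps m) * p x = scal (of_int (cell_content x)) * p x"
    by (rule branching_idempotents[OF T]) blast
  have F: "young_diagram F" using T by (simp add: is_tableau_def)
  note fin = finite_addable[OF F]
  let ?e = "yidem m T" and ?P = "\<Sum>x\<in>addable F. p x"
  have e_in: "?e \<in> galg (SG (Suc m))" using galg_mono[OF SG_mono yidem_in] by simp
  have PP: "?P * ?P = ?P"
  proof -
    have "?P * ?P = (\<Sum>x\<in>addable F. \<Sum>y\<in>addable F. p x * p y)" by (rule sum_product)
    also have "\<dots> = (\<Sum>x\<in>addable F. \<Sum>y\<in>addable F. if x = y then p x else 0)"
      by (intro sum.cong refl p(4))
    also have "\<dots> = ?P" using fin by simp
    finally show ?thesis .
  qed
  have eP: "?e * ?P = ?P" unfolding sum_distrib_left by (intro sum.cong refl p(2))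
  have Pe: "?P * ?e = ?P" unfolding sum_distrib_right by (intro sum.cong refl p(3))
  have r: "(?e - ?P) * (?e - ?P) = ?e - ?P"
    by (simp add: left_diff_distrib right_diff_distrib yidem_idem[OF T] eP Pe PP)
  have r_in: "?e - ?P \<in> galg (SG (Suc m))"
    using p(1) e_in by (intro galg_diff galg_sum)
  obtain d :: nat where d: "of_nat (card (SG (Suc m))) * coef (?e - ?P) 0 = of_nat d"
    and d0: "d = 0 \<Longrightarrow> ?e - ?P = 0"
    using SG.idempotent_coef_0[OF r_in r] by blast
  have px: "fact (Suc m) * coef (p x) 0 = complex_of_real (sdim (insert x F))" if x: "x \<in> addable F" for x
    using p(5)[OF x SG.galg_1] unfolding SG.tr_one card_SG of_real_sdim[OF tableau_extend[OF T x]]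
    by (simp only: of_nat_fact)
  have "complex_of_real (real (Suc m) * sdim F) = fact (Suc m) * coef ?e 0"
    by (simp add: of_real_sdim[OF T])
  also have "\<dots> = fact (Suc m) * coef ?P 0 + fact (Suc m) * coef (?e - ?P) 0"
    by (simp add: lookup_minus algebra_simps)
  also have "fact (Suc m) * coef ?P 0 = (\<Sum>x\<in>addable F. complex_of_real (sdim (insert x F)))"
    unfolding lookup_sum sum_distrib_left using px by (intro sum.cong refl)
  also have "fact (Suc m) * coef (?e - ?P) 0 = complex_of_real (real d)"
    using d unfolding card_SG by (simp only: of_nat_fact of_real_of_nat_eq)
  finally have "complex_of_real (real (Suc m) * sdim F) =
      complex_of_real ((\<Sum>x\<in>addable F. sdim (insert x F)) + real d)"
    by simp
  then have "real (Suc m) * sdim F = (\<Sum>x\<in>addable F. sdim (insert x F)) + real d"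
    by (simp only: of_real_eq_iff)
  then show thesis
  proof (rule that)
    show "?e = ?P" if "d = 0" using d0[OF that] by simp
  qed (rule p(5) jm; assumption)+
qed

lemma sdim_up_le:
  assumes F: "young_diagram F"
  shows "(\<Sum>x\<in>addable F. sdim (insert x F)) \<le> real (Suc (card F)) * sdim F"
proof -
  obtain T where T: "is_tableau (card F) F T" using ex_tableau[OF F] by blast
  obtain d :: nat where "real (Suc (card F)) * sdim F = (\<Sum>x\<in>addable F. sdim (insert x F)) + real d"
    by (rule branching_decomposition[OF T]) blast
  then show ?thesis by simp
qed

section \<open>Isotypic projections and restriction\<close>

definition central_idem :: "nat \<Rightarrow> (nat \<Rightarrow> nat \<times> nat) \<Rightarrow> nat_perm group_ring" where
  "central_idem n T = scal (1 / kap n T) * (\<Sum>g\<in>SG n. gel g * yidem n T * gel (- g))"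

lemma central_idem_in: "central_idem n T \<in> galg (SG n)"
  unfolding central_idem_def
  by (intro galg_scal_mult galg_sum SG.galg_mult yidem_in) (simp_all add: SG.uminus_mem)

lemma conj_sum_central:
  assumes h: "h \<in> SG n"
  shows "gel h * (\<Sum>g\<in>SG n. gel g * f * gel (- g)) = (\<Sum>g\<in>SG n. gel g * f * gel (- g)) * gel h"
proof -
  have "gel h * (\<Sum>g\<in>SG n. gel g * f * gel (- g)) = (\<Sum>g\<in>SG n. gel (h + g) * f * gel (- (h + g)) * gel h)"
    unfolding sum_distrib_left
    by (intro sum.cong refl) (simp add: gel_mult mult.assoc minus_add flip: mult.assoc[of "gel h"])
  also have "\<dots> = (\<Sum>g\<in>SG n. gel g * f * gel (- g) * gel h)"
    by (rule sum.reindex_bij_betw[OF SG.bij_add_left[OF h]])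
  finally show ?thesis unfolding sum_distrib_right .
qed

text \<open>Being central, \<open>s\<close> satisfies \<open>e * s = e * s * e\<close>, a multiple
  of \<open>e\<close>. The scalar is found at the identity: writing each
  \<open>e * gel h * e\<close> as a multiple of \<open>e\<close> turns the sum over \<open>h\<close>
  into \<open>kap\<close> times the identity coefficient of \<open>e * e * e\<close>, which is 1.
  This explains the factor \<open>1 / kap\<close> in \<open>central_idem\<close>.\<close>

lemma yidem_conj_sum:
  assumes T: "is_tableau n F T"
  defines "s \<equiv> \<Sum>g\<in>SG n. gel g * yidem n T * gel (- g)"
  shows "yidem n T * s = scal (kap n T) * yidem n T"
proof -
  let ?e = "yidem n T" and ?k = "kap n T"
  have ee: "?e * ?e = ?e" by (rule yidem_idem[OF T])
  have s_in: "s \<in> galg (SG n)"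
    unfolding s_def by (intro galg_sum SG.galg_mult yidem_in) (simp_all add: SG.uminus_mem)
  have "?e * s = s * ?e"
  proof -
    have gs: "gel h * s = s * gel h" if "h \<in> SG n" for h
      unfolding s_def using that by (rule conj_sum_central)
    have "s * ?e = (\<Sum>h\<in>SG n. scal (coef ?e h) * (s * gel h))"
      using arg_cong[OF group_ring_expansion[OF yidem_in SG.fin], of "\<lambda>x. s * x"]
      by (simp only: sum_distrib_left scal_left_commute)
    also have "\<dots> = (\<Sum>h\<in>SG n. scal (coef ?e h) * gel h) * s"
      unfolding sum_distrib_right by (intro sum.cong refl) (simp only: gs mult.assoc)
    also have "\<dots> = ?e * s"
      by (rule arg_cong[OF group_ring_expansion[OF yidem_in SG.fin], symmetric, where f = "\<lambda>x. x * s"])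
    finally show ?thesis ..
  qed
  then have ese: "?e * s = ?e * s * ?e" by (metis ee mult.assoc)
  have 1: "?e * s = scal (?k * coef (?e * s) 0) * ?e"
    using yidem_sandwich[OF T s_in] unfolding ese[symmetric] .
  have "coef (?e * s) 0 = (\<Sum>h\<in>SG n. coef (?e * gel h * ?e * gel (- h)) 0)"
    unfolding s_def sum_distrib_left lookup_sum by (simp only: mult.assoc)
  also have "\<dots> = (\<Sum>h\<in>SG n. ?k * (coef ?e h * coef (?e * gel h * ?e) 0))"
  proof (intro sum.cong refl)
    fix h assume h: "h \<in> SG n"
    let ?y = "coef (?e * gel h * ?e) 0"
    have "?e * gel h * ?e = scal (?k * ?y) * ?e"
      using yidem_sandwich[OF T, of "gel h"] h by simp
    then have "?e * gel h * ?e * gel (- h) = scal (?k * ?y) * ?e * gel (- h)"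
      by (rule arg_cong[where f = "\<lambda>x. x * gel (- h)"])
    also have "\<dots> = scal (?k * ?y) * (?e * gel (- h))" by (rule mult.assoc)
    finally have "coef (?e * gel h * ?e * gel (- h)) 0 = coef (scal (?k * ?y) * (?e * gel (- h))) 0"
      by (rule arg_cong)
    also have "\<dots> = ?k * ?y * coef (?e * gel (- h)) 0" by (rule coef_scal_mult)
    also have "\<dots> = ?k * (coef ?e h * ?y)" by simp
    finally show "coef (?e * gel h * ?e * gel (- h)) 0 = ?k * (coef ?e h * ?y)" .
  qed
  also have "\<dots> = ?k * coef (\<Sum>h\<in>SG n. scal (coef ?e h) * (?e * gel h * ?e)) 0"
    unfolding lookup_sum coef_scal_mult by (simp only: sum_distrib_left)
  also have "(\<Sum>h\<in>SG n. scal (coef ?e h) * (?e * gel h * ?e)) = ?e * (\<Sum>h\<in>SG n. scal (coef ?e h) * gel h) * ?e"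
    by (simp only: sum_distrib_left sum_distrib_right mult.assoc scal_left_commute)
  also have "\<dots> = ?e * ?e * ?e"
    by (rule arg_cong[OF group_ring_expansion[OF yidem_in SG.fin], symmetric, where f = "\<lambda>x. ?e * x * ?e"])
  also have "?k * coef (?e * ?e * ?e) 0 = 1"
    unfolding ee using coef_yidem_0[OF T] kap_ne_0[OF T] by simp
  finally show ?thesis using 1 by simp
qed

lemma central_idem_idem:
  assumes T: "is_tableau n F T"
  shows "central_idem n T * central_idem n T = central_idem n T"
proof -
  let ?e = "yidem n T"
  let ?s = "\<Sum>g\<in>SG n. gel g * ?e * gel (- g)"
  have "?s * ?s = (\<Sum>g\<in>SG n. gel g * ?e * gel (- g) * ?s)"
    by (rule sum_distrib_right)
  also have "\<dots> = (\<Sum>g\<in>SG n. scal (kap n T) * (gel g * ?e * gel (- g)))"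
  proof (intro sum.cong refl)
    fix g assume g: "g \<in> SG n"
    have "gel g * ?e * gel (- g) * ?s = gel g * ?e * (gel (- g) * ?s)" by (rule mult.assoc)
    also have "gel (- g) * ?s = ?s * gel (- g)" by (rule conj_sum_central[OF SG.uminus_mem[OF g]])
    also have "gel g * ?e * (?s * gel (- g)) = gel g * (?e * ?s) * gel (- g)" by (simp only: mult.assoc)
    also have "\<dots> = gel g * (scal (kap n T) * ?e) * gel (- g)" unfolding yidem_conj_sum[OF T] ..
    also have "\<dots> = scal (kap n T) * (gel g * ?e * gel (- g))"
      unfolding scal_left_commute[of "gel g"] by (rule mult.assoc)
    finally show "gel g * ?e * gel (- g) * ?s = scal (kap n T) * (gel g * ?e * gel (- g))" .
  qed
  also have "\<dots> = scal (kap n T) * ?s" by (rule sum_distrib_left[symmetric])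
  finally have ss: "?s * ?s = scal (kap n T) * ?s" .
  show ?thesis
    unfolding central_idem_def scal_mult_mult_scal ss scal_mult_assoc using kap_ne_0[OF T] by simp
qed

lemma central_idem_orthogonal:
  assumes T: "is_tableau n F T" and T': "is_tableau n F' T'" and "F \<noteq> F'"
  shows "central_idem n T * central_idem n T' = 0"
proof -
  have 0: "gel g * yidem n T * gel (- g) * (gel h * yidem n T' * gel (- h)) = 0"
    if "g \<in> SG n" "h \<in> SG n" for g h
  proof -
    have "gel (- g) * gel h \<in> galg (SG n)"
      using that by (intro SG.galg_mult) (simp_all add: SG.uminus_mem)
    then have "yidem n T * (gel (- g) * gel h) * yidem n T' = 0"
      by (rule yidem_orthogonal[OF T T' \<open>F \<noteq> F'\<close>])
    moreover have "gel g * yidem n T * gel (- g) * (gel h * yidem n T' * gel (- h)) =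
        gel g * (yidem n T * (gel (- g) * gel h) * yidem n T') * gel (- h)"
      by (simp only: mult.assoc)
    ultimately show ?thesis by simp
  qed
  show ?thesis unfolding central_idem_def scal_mult_mult_scal sum_product using 0 by simp
qed

text \<open>The orthogonal idempotents \<open>?z y\<close> cut isotypic parts out of the restriction
  of the Specht module of \<open>G\<close>. Their traces are \<open>sdim (G - {y})\<close> times a
  multiplicity \<open>k y\<close>, which is positive because an intertwiner gives a nonzero element
  of \<open>e A E\<close>. The remaining idempotent \<open>?w\<close> has a nonnegative
  trace.\<close>

lemma sdim_down_le:
  assumes G: "young_diagram G" and card_G: "card G = Suc m"
  shows "(\<Sum>y\<in>removable G. sdim (G - {y})) \<le> sdim G"
proof -
  let ?S = "SG (Suc m)" and ?R = "removable G"
  obtain T0 where T0: "is_tableau (Suc m) G T0" using ex_tableau[OF G card_G] by blast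
  have "\<exists>T. is_tableau m (G - {y}) T" if "y \<in> ?R" for y
  proof -
    have "young_diagram (G - {y})" "card (G - {y}) = m"
      using that card_G young_diagram_finite[OF G] by (auto simp: removable_def)
    then show ?thesis using ex_tableau by blast
  qed
  then obtain t where t: "\<And>y. y \<in> ?R \<Longrightarrow> is_tableau m (G - {y}) (t y)" by metis
  let ?E = "yidem (Suc m) T0" and ?e = "\<lambda>y. yidem m (t y)" and ?z = "\<lambda>y. central_idem m (t y)"
  note fin = finite_removable[OF G]
  have z_in: "?z y \<in> galg ?S" "?e y \<in> galg ?S" for y
    using galg_mono[OF SG_mono[of m "Suc m"]] central_idem_in yidem_in by simp_all
  have zz: "?z x * ?z y = (if x = y then ?z x else 0)" if "x \<in> ?R" "y \<in> ?R" for x y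
  proof (cases "x = y")
    case False
    then have "G - {x} \<noteq> G - {y}" using that by (auto simp: removable_def)
    then show ?thesis using False central_idem_orthogonal[OF t[OF that(1)] t[OF that(2)]] by simp
  qed (use central_idem_idem[OF t[OF that(1)]] in simp)
  let ?w = "1 - (\<Sum>y\<in>?R. ?z y)"
  have "(\<Sum>y\<in>?R. ?z y) * (\<Sum>y\<in>?R. ?z y) = (\<Sum>x\<in>?R. \<Sum>y\<in>?R. if x = y then ?z x else 0)"
    unfolding sum_product by (intro sum.cong refl zz)
  also have "\<dots> = (\<Sum>y\<in>?R. ?z y)" using fin by simp
  finally have "(\<Sum>y\<in>?R. ?z y) * (\<Sum>y\<in>?R. ?z y) = (\<Sum>y\<in>?R. ?z y)" .
  then have ww: "?w * ?w = ?w" by (simp add: left_diff_distrib right_diff_distrib)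
  have w_in: "?w \<in> galg ?S" using z_in by (intro galg_diff galg_sum) simp_all
  obtain d :: nat where d: "tr ?S ?w ?E = of_nat d"
    by (rule SG.tr_idempotent[OF w_in yidem_in ww yidem_idem[OF T0]])
  have tr_e: "\<exists>k::nat. tr ?S (?e y) ?E = of_nat k \<and> k \<noteq> 0" if y: "y \<in> ?R" for y
  proof -
    have yy: "y \<in> addable (G - {y})" "insert y (G - {y}) = G"
      using y G by (auto simp: addable_def removable_def insert_absorb)
    obtain v where v: "v \<in> galg ?S" "v * yidem (Suc m) ((t y)(Suc m := y)) = v" "?e y * v = v"
      and v0: "v \<noteq> 0"
    proof (rule branching_intertwiners[OF t[OF y] yy(1)])
      fix u v
      let ?T' = "(t y)(Suc m := y)"
      assume v: "v \<in> galg ?S" "v * yidem (Suc m) ?T' = v" "?e y * v = v"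
        and uv: "u * v = yidem (Suc m) ?T'"
      have "is_tableau (Suc m) G ?T'" using tableau_extend[OF t[OF y] yy(1)] yy(2) by simp
      then have "coef (u * v) 0 \<noteq> 0" unfolding uv using coef_yidem_0 kap_ne_0 by simp
      then have "v \<noteq> 0" by auto
      then show thesis using that v by blast
    qed
    have T': "is_tableau (Suc m) G ((t y)(Suc m := y))" using tableau_extend[OF t[OF y] yy(1)] yy(2) by simp
    obtain g where g: "g \<in> ?S" "yidem (Suc m) ((t y)(Suc m := y)) = gel g * ?E * gel (- g)"
      using yidem_conj_same_shape[OF T0 T'] by blast
    have "?e y * (v * gel g) * ?E = v * (gel g * ?E * gel (- g)) * gel g"
      unfolding mult.assoc[symmetric] v(3) by (simp add: mult.assoc gel_mult)
    also have "\<dots> = v * gel g" unfolding g(2)[symmetric] v(2) ..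
    finally have eq: "?e y * (v * gel g) * ?E = v * gel g" .
    have "v * gel g \<noteq> 0"
    proof
      assume "v * gel g = 0"
      then have "v * gel g * gel (- g) = 0" by simp
      then show False using v0 by (simp add: mult.assoc gel_mult)
    qed
    moreover have "v * gel g \<in> galg ?S" using v(1) g(1) by (intro SG.galg_mult) simp_all
    ultimately have "\<not> (\<forall>x\<in>galg ?S. ?e y * x * ?E = 0)" using eq by metis
    moreover obtain k :: nat where "tr ?S (?e y) ?E = of_nat k" "k = 0 \<Longrightarrow> \<forall>x\<in>galg ?S. ?e y * x * ?E = 0"
      by (rule SG.tr_idempotent[OF z_in(2) yidem_in yidem_idem[OF t[OF y]] yidem_idem[OF T0]]) blast
    ultimately show ?thesis by blast
  qed
  then obtain k where k: "\<And>y. y \<in> ?R \<Longrightarrow> tr ?S (?e y) ?E = of_nat (k y)" "\<And>y. y \<in> ?R \<Longrightarrow> k y \<noteq> 0"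
    by metis
  \<comment> \<open>All conjugates in \<open>central_idem\<close> have the trace of
    \<open>?e y\<close>, so averaging contributes the factor \<open>m! / kap\<close>, which is
    \<open>sdim (G - {y})\<close>.\<close>
  have tr_z: "tr ?S (?z y) ?E = complex_of_real (sdim (G - {y}) * real (k y))" if y: "y \<in> ?R" for y
  proof -
    have "tr ?S (gel g * ?e y * gel (- g)) ?E = tr ?S (?e y) ?E" if "g \<in> SG m" for g
      using that SG_mono[of m "Suc m"] by (intro SG.tr_conj_left) auto
    then have "tr ?S (?z y) ?E = 1 / kap m (t y) * (fact m * tr ?S (?e y) ?E)"
      unfolding central_idem_def tr_scal_left tr_sum_left by (simp add: card_SG)
    also have "\<dots> = complex_of_real (sdim (G - {y})) * of_nat (k y)"
      unfolding k(1)[OF y] of_real_sdim[OF t[OF y]] coef_yidem_0[OF t[OF y]] by simp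
    finally show ?thesis by simp
  qed
  have "tr ?S 1 ?E = tr ?S ?w ?E + (\<Sum>y\<in>?R. tr ?S (?z y) ?E)"
    unfolding tr_diff_left tr_sum_left by simp
  also have "(\<Sum>y\<in>?R. tr ?S (?z y) ?E) = (\<Sum>y\<in>?R. complex_of_real (sdim (G - {y}) * real (k y)))"
    by (intro sum.cong refl tr_z)
  also have "tr ?S 1 ?E = complex_of_real (sdim G)"
    unfolding SG.tr_one of_real_sdim[OF T0] by (simp only: card_SG of_nat_fact)
  finally have "complex_of_real (sdim G) = complex_of_real (real d + (\<Sum>y\<in>?R. sdim (G - {y}) * real (k y)))"
    unfolding d by simp
  then have eq: "sdim G = real d + (\<Sum>y\<in>?R. sdim (G - {y}) * real (k y))"
    by (simp only: of_real_eq_iff)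
  have "(\<Sum>y\<in>?R. sdim (G - {y})) \<le> (\<Sum>y\<in>?R. sdim (G - {y}) * real (k y))"
  proof (rule sum_mono)
    fix y assume y: "y \<in> ?R"
    have "0 \<le> sdim (G - {y})" using sdim_nonneg y by (simp add: removable_def)
    moreover have "1 \<le> real (k y)" using k(2)[OF y] by simp
    ultimately show "sdim (G - {y}) \<le> sdim (G - {y}) * real (k y)"
      using mult_left_mono[of 1 "real (k y)" "sdim (G - {y})"] by simp
  qed
  then show ?thesis using eq by simp
qed

section \<open>Equality of dimensions\<close>

text \<open>The second clause drives the induction: used for \<open>F - {y}\<close>, it gives the
  restriction formula at \<open>F\<close> itself. With the first clause for \<open>F - {y}\<close>
  and the commutation relation, the sum of \<open>?D (insert x F)\<close> over \<open>x\<close> is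
  exactly \<open>(card F + 1) * sdim F\<close>. The sum of \<open>sdim (insert x F)\<close> lies
  between this value and the same upper bound, so all inequalities are equalities.\<close>

lemma sdim_up_down:
  assumes "young_diagram F"
  shows "(\<Sum>x\<in>addable F. sdim (insert x F)) = real (Suc (card F)) * sdim F \<and>
    (\<forall>x\<in>addable F. (\<Sum>y\<in>removable (insert x F). sdim (insert x F - {y})) = sdim (insert x F))"
  using assms
proof (induction "card F" arbitrary: F rule: less_induct)
  case less
  note F = \<open>young_diagram F\<close>
  let ?D = "\<lambda>G. \<Sum>y\<in>removable G. sdim (G - {y})"
  have down: "?D (insert x F) \<le> sdim (insert x F)" if "x \<in> addable F" for x
    using that young_diagram_finite[OF F]
    by (intro sdim_down_le[where m = "card F"]) (auto simp: addable_def)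
  have IH: "(\<Sum>x\<in>addable (F - {y}). sdim (insert x (F - {y}))) = real (card F) * sdim (F - {y})" "?D F = sdim F"
    if y: "y \<in> removable F" for y
  proof -
    have yF: "y \<in> F" and Fy: "young_diagram (F - {y})" using y by (auto simp: removable_def)
    then have c: "Suc (card (F - {y})) = card F" using young_diagram_finite[OF F]
      by (metis card_Suc_Diff1)
    have IH: "(\<Sum>x\<in>addable (F - {y}). sdim (insert x (F - {y}))) = real (Suc (card (F - {y}))) * sdim (F - {y})"
      "\<forall>x\<in>addable (F - {y}). ?D (insert x (F - {y})) = sdim (insert x (F - {y}))"
      using less.hyps[OF _ Fy] c by auto
    show "(\<Sum>x\<in>addable (F - {y}). sdim (insert x (F - {y}))) = real (card F) * sdim (F - {y})"
      using IH(1) unfolding c .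
    have "y \<in> addable (F - {y})" "insert y (F - {y}) = F"
      using yF F by (auto simp: addable_def insert_absorb)
    then show "?D F = sdim F" using IH(2) by metis
  qed
  have "(\<Sum>x\<in>addable F. ?D (insert x F)) = sdim F + (\<Sum>y\<in>removable F. real (card F) * sdim (F - {y}))"
    unfolding up_down_commutation[OF F] using IH(1) by simp
  also have "(\<Sum>y\<in>removable F. real (card F) * sdim (F - {y})) = real (card F) * sdim F"
  \<comment> \<open>The empty diagram has no smaller diagram to take the restriction formula from,
    but there the factor \<open>card F\<close> vanishes.\<close>
  proof (cases "F = {}")
    case False
    then obtain y where "y \<in> removable F" using removable_nonempty[OF F] by blast
    then show ?thesis using IH(2) by (simp flip: sum_distrib_left)
  qed (simp add: removable_def)
  finally have low: "(\<Sum>x\<in>addable F. ?D (insert x F)) = real (Suc (card F)) * sdim F"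
    by (simp add: algebra_simps)
  moreover have "(\<Sum>x\<in>addable F. ?D (insert x F)) \<le> (\<Sum>x\<in>addable F. sdim (insert x F))"
    by (intro sum_mono down)
  ultimately have up: "(\<Sum>x\<in>addable F. sdim (insert x F)) = real (Suc (card F)) * sdim F"
    using sdim_up_le[OF F] by linarith
  then have "?D (insert x F) = sdim (insert x F)" if "x \<in> addable F" for x
    using sum_mono_inv[of "\<lambda>x. ?D (insert x F)" "addable F" "\<lambda>x. sdim (insert x F)"]
      low down that finite_addable[OF F] by simp
  then show ?case using up by blast
qed

lemma tr_jucys_murphy:
  assumes T: "is_tableau m F T" and z: "z \<in> galg (SG (Suc m))"
  shows "tr (SG (Suc m)) z (sym_sum (last_transps m) * yidem m T) =
    (\<Sum>x\<in>addable F. of_int (cell_content x) * tr (SG (Suc m)) z (yidem (Suc m) (T(Suc m := x))))"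
proof -
  have F: "young_diagram F" "card F = m" using T tableau_card by (auto simp: is_tableau_def)
  obtain p and d :: nat where d: "real (Suc m) * sdim F = (\<Sum>x\<in>addable F. sdim (insert x F)) + real d"
    "d = 0 \<Longrightarrow> yidem m T = (\<Sum>x\<in>addable F. p x)"
    and p: "\<And>x. x \<in> addable F \<Longrightarrow> tr (SG (Suc m)) z (p x) =
      tr (SG (Suc m)) z (yidem (Suc m) (T(Suc m := x)))"
    and jm: "\<And>x. x \<in> addable F \<Longrightarrow>
      sym_sum (last_transps m) * p x = scal (of_int (cell_content x)) * p x"
    using branching_decomposition[OF T] z by metis
  have "d = 0" using d(1) sdim_up_down[OF F(1)] F(2) by simp
  then have "sym_sum (last_transps m) * yidem m T = (\<Sum>x\<in>addable F. scal (of_int (cell_content x)) * p x)"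
    using d(2) jm by (simp add: sum_distrib_left)
  then show ?thesis
    unfolding tr_sum_right tr_scal_right using p
    by (simp only: tr_sum_right tr_scal_right cong: sum.cong)
qed

section \<open>Characters as traces\<close>

text \<open>Translation to the functions on all maps that model the group algebra in the definitions.\<close>
definition emb :: "nat_perm group_ring \<Rightarrow> (nat \<Rightarrow> nat) \<Rightarrow> complex" where
  "emb f g = (if bij g then coef f (Abs_nat_perm g) else 0)"

lemma emb_act [simp]: "emb f (act p) = coef f p"
  by (simp add: emb_def act_inverse)

lemma act_image_SG: "act ` SG n = sym_grp n"
proof (intro equalityI subsetI)
  fix p assume "p \<in> sym_grp n"
  then show "p \<in> act ` SG n"
    by (intro image_eqI[of _ _ "Abs_nat_perm p"]) (auto simp: sym_grp_def Abs_in_SG permutes_bij)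
qed (auto simp: SG_def sym_grp_def)

lemma bij_betw_act_SG: "bij_betw act (SG n) (sym_grp n)"
  unfolding bij_betw_def act_image_SG by (simp add: inj_on_def act_inject)

lemma finite_sym_grp: "finite (sym_grp n)"
  unfolding act_image_SG[symmetric] using SG.fin by simp

lemma emb_in:
  assumes "f \<in> galg (SG n)"
  shows "emb f \<in> grp_alg n"
  unfolding grp_alg_def
proof (intro CollectI allI impI)
  fix g assume g: "g \<notin> sym_grp n"
  show "emb f g = 0"
  proof (cases "bij g")
    case True
    then have "Abs_nat_perm g \<notin> SG n" using g by (simp add: SG_def sym_grp_def)
    then show ?thesis using assms by (simp add: emb_def galg_iff)
  qed (simp add: emb_def)
qed

lemma emb_surj:
  assumes "h \<in> grp_alg n"
  obtains f where "f \<in> galg (SG n)" "emb f = h"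
proof
  let ?f = "\<Sum>p\<in>SG n. scal (h (act p)) * gel p"
  have c: "coef ?f p = (if p \<in> SG n then h (act p) else 0)" for p
    by (simp add: lookup_sum scal_mult_gel lookup_single when_def SG.fin)
  show "?f \<in> galg (SG n)" by (simp add: galg_iff c)
  show "emb ?f = h"
  proof
    fix g
    show "emb ?f g = h g"
    proof (cases "g \<in> sym_grp n")
      case True
      then show ?thesis unfolding act_image_SG[symmetric] by (auto simp: c)
    next
      case False
      then have "Abs_nat_perm g \<notin> SG n" if "bij g" using that by (simp add: SG_def sym_grp_def)
      then show ?thesis using False assms by (simp add: emb_def c grp_alg_def)
    qed
  qed
qed

lemma emb_mult:
  assumes "f \<in> galg (SG n)"
  shows "emb (f * h) = grp_mult n (emb f) (emb h)"
proof
  fix g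
  have "grp_mult n (emb f) (emb h) g = (\<Sum>p\<in>SG n. coef f p * emb h (inv (act p) \<circ> g))"
    unfolding grp_mult_def
    using sum.reindex_bij_betw[OF bij_betw_act_SG, of "\<lambda>x. emb f x * emb h (inv x \<circ> g)" n] by simp
  also have "\<dots> = emb (f * h) g"
  proof (cases "bij g")
    case True
    then obtain k where k: "g = act k" by (metis act_Abs)
    have "inv (act p) \<circ> g = act (- p + k)" for p by (simp add: k act_add act_uminus)
    then show ?thesis using coef_mult[OF assms SG.fin, of h k] by (simp add: k)
  next
    case False
    have "\<not> bij (inv (act p) \<circ> g)" for p
    proof
      assume "bij (inv (act p) \<circ> g)"
      then have "bij (act p \<circ> (inv (act p) \<circ> g))" using bij_act[of p] by (rule bij_comp)
      moreover have "act p \<circ> (inv (act p) \<circ> g) = g"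
        using surj_f_inv_f[OF bij_is_surj[OF bij_act[of p]]] by (simp add: fun_eq_iff)
      ultimately show False using False by simp
    qed
    then show ?thesis using False by (simp add: emb_def)
  qed
  finally show "emb (f * h) g = grp_mult n (emb f) (emb h) g" ..
qed

lemma emb_gel: "emb (gel p) = grp_elt (act p)"
proof
  fix g show "emb (gel p) g = grp_elt (act p) g"
  proof (cases "bij g")
    case True
    then obtain k where k: "g = act k" by (metis act_Abs)
    show ?thesis by (simp add: k coef_gel grp_elt_def act_inject)
  next
    case False
    then have "g \<noteq> act p" by auto
    then show ?thesis using False by (simp add: emb_def grp_elt_def)
  qed
qed

lemma emb_add: "emb (f + h) = emb f + emb h"
  by (auto simp: emb_def fun_eq_iff lookup_add)

lemma emb_0: "emb 0 = 0"
  by (auto simp: emb_def fun_eq_iff)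

lemma emb_sum: "emb (\<Sum>x\<in>A. f x) = (\<Sum>x\<in>A. emb (f x))"
  by (induction A rule: infinite_finite_induct) (simp_all add: emb_add emb_0)

lemma emb_scal: "emb (scal a * f) = fun_scale a (emb f)"
  by (auto simp: emb_def fun_eq_iff fun_scale_def)

section \<open>The canonical tableau\<close>

lemma take_sum_mono:
  fixes \<mu> :: "nat list"
  shows "i \<le> i' \<Longrightarrow> sum_list (take i \<mu>) \<le> sum_list (take i' \<mu>)"
  by (metis le_add1 min_absorb1 sum_list_append take_add le_Suc_ex)

lemma take_sum_Suc:
  fixes \<mu> :: "nat list"
  assumes "1 \<le> i" "i \<le> length \<mu>"
  shows "sum_list (take (i - 1) \<mu>) + \<mu> ! (i - 1) = sum_list (take i \<mu>)"
  using assms take_Suc_conv_app_nth[of "i - 1" \<mu>] by simp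

text \<open>Row \<open>i\<close> fills the block of numbers above the sum of the first
  \<open>i - 1\<close> parts and up to the sum of the first \<open>i\<close>. Distinct rows use
  disjoint blocks, and counting gives surjectivity.\<close>

lemma bij_betw_tableau: "bij_betw (tableau \<mu>) (ferrers \<mu>) {1..sum_list \<mu>}"
proof -
  have bounds: "sum_list (take (i - 1) \<mu>) < tableau \<mu> (i, j)" "tableau \<mu> (i, j) \<le> sum_list (take i \<mu>)"
    if "(i, j) \<in> ferrers \<mu>" for i j
    using that take_sum_Suc[of i \<mu>] by (auto simp: ferrers_def tableau_def)
  have lt: "tableau \<mu> (i, j) < tableau \<mu> (i', j')"
    if ij: "(i, j) \<in> ferrers \<mu>" "(i', j') \<in> ferrers \<mu>" "i < i'" for i j i' j'
  proof -
    have "tableau \<mu> (i, j) \<le> sum_list (take i \<mu>)" by (rule bounds(2)[OF ij(1)])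
    also have "\<dots> \<le> sum_list (take (i' - 1) \<mu>)" using ij(3) by (intro take_sum_mono) simp
    also have "\<dots> < tableau \<mu> (i', j')" by (rule bounds(1)[OF ij(2)])
    finally show ?thesis .
  qed
  have inj: "inj_on (tableau \<mu>) (ferrers \<mu>)"
  proof (rule inj_onI)
    fix x y assume xy: "x \<in> ferrers \<mu>" "y \<in> ferrers \<mu>" "tableau \<mu> x = tableau \<mu> y"
    have "fst x = fst y"
      using lt[of "fst x" "snd x" "fst y" "snd y"] lt[of "fst y" "snd y" "fst x" "snd x"] xy
      by (metis less_irrefl linorder_neqE_nat prod.collapse)
    then show "x = y" using xy(3) by (simp add: tableau_def prod_eq_iff)
  qed
  have "tableau \<mu> ` ferrers \<mu> \<subseteq> {1..sum_list \<mu>}"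
  proof
    fix a assume "a \<in> tableau \<mu> ` ferrers \<mu>"
    then obtain i j where a: "(i, j) \<in> ferrers \<mu>" "a = tableau \<mu> (i, j)" by auto
    have "sum_list (take i \<mu>) \<le> sum_list (take (max i (length \<mu>)) \<mu>)" by (intro take_sum_mono) simp
    then show "a \<in> {1..sum_list \<mu>}" using bounds[OF a(1)] a(2) by simp
  qed
  moreover have "card (tableau \<mu> ` ferrers \<mu>) = card {1..sum_list \<mu>}"
    using card_image[OF inj] card_ferrers by simp
  ultimately have "tableau \<mu> ` ferrers \<mu> = {1..sum_list \<mu>}"
    by (intro card_subset_eq) simp_all
  then show ?thesis using inj by (simp add: bij_betw_def)
qed

definition canon_tab :: "nat list \<Rightarrow> nat \<Rightarrow> nat \<times> nat" where
  "canon_tab \<mu> = inv_into (ferrers \<mu>) (tableau \<mu>)"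

lemma canon_tab_tableau [simp]: "x \<in> ferrers \<mu> \<Longrightarrow> canon_tab \<mu> (tableau \<mu> x) = x"
  unfolding canon_tab_def by (rule bij_betw_inv_into_left[OF bij_betw_tableau])

lemma tableau_canon_tab: "a \<in> {1..sum_list \<mu>} \<Longrightarrow> tableau \<mu> (canon_tab \<mu> a) = a"
  unfolding canon_tab_def by (rule bij_betw_inv_into_right[OF bij_betw_tableau])

lemma canon_tab_mem: "a \<in> {1..sum_list \<mu>} \<Longrightarrow> canon_tab \<mu> a \<in> ferrers \<mu>"
  unfolding canon_tab_def by (rule bij_betw_apply[OF bij_betw_inv_into[OF bij_betw_tableau]])

lemma is_tableau_canon_tab:
  assumes "is_partition m \<mu>"
  shows "is_tableau m (ferrers \<mu>) (canon_tab \<mu>)"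
proof -
  have "sum_list \<mu> = m" using assms by (simp add: is_partition_def)
  then show ?thesis
    using bij_betw_inv_into[OF bij_betw_tableau, of \<mu>] young_diagram_ferrers[OF assms]
    by (simp add: is_tableau_def canon_tab_def)
qed

lemma tableau_mem: "x \<in> ferrers \<mu> \<Longrightarrow> tableau \<mu> x \<in> {1..sum_list \<mu>}"
  by (rule bij_betw_apply[OF bij_betw_tableau])

text \<open>Covers the row group and the column group together, with \<open>\<phi>\<close> as
  \<open>fst\<close> or \<open>snd\<close>.\<close>

lemma canonical_level_group:
  "act ` level_group (sum_list \<mu>) (\<phi> \<circ> canon_tab \<mu>) =
    {p \<in> sym_grp (sum_list \<mu>). \<forall>x\<in>ferrers \<mu>. \<exists>y\<in>ferrers \<mu>. \<phi> y = \<phi> x \<and> p (tableau \<mu> x) = tableau \<mu> y}"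
  (is "?L = ?R")
proof (intro equalityI subsetI)
  fix p assume "p \<in> ?L"
  then obtain q where q: "p = act q" "q \<in> SG (sum_list \<mu>)"
    "\<And>a. a \<in> {1..sum_list \<mu>} \<Longrightarrow> \<phi> (canon_tab \<mu> (act q a)) = \<phi> (canon_tab \<mu> a)"
    unfolding level_group_def by auto
  have "\<exists>y\<in>ferrers \<mu>. \<phi> y = \<phi> x \<and> p (tableau \<mu> x) = tableau \<mu> y" if x: "x \<in> ferrers \<mu>" for x
  proof
    have a: "tableau \<mu> x \<in> {1..sum_list \<mu>}" by (rule tableau_mem[OF x])
    then have b: "act q (tableau \<mu> x) \<in> {1..sum_list \<mu>}" by (rule SG_act[OF q(2)])
    show "canon_tab \<mu> (act q (tableau \<mu> x)) \<in> ferrers \<mu>" by (rule canon_tab_mem[OF b])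
    show "\<phi> (canon_tab \<mu> (act q (tableau \<mu> x))) = \<phi> x \<and>
        p (tableau \<mu> x) = tableau \<mu> (canon_tab \<mu> (act q (tableau \<mu> x)))"
      using q(3)[OF a] tableau_canon_tab[OF b] x q(1) by simp
  qed
  moreover have "p \<in> sym_grp (sum_list \<mu>)" using q(1,2) act_image_SG by blast
  ultimately show "p \<in> ?R" by blast
next
  fix p assume p: "p \<in> ?R"
  then obtain q where q: "q \<in> SG (sum_list \<mu>)" "p = act q" using act_image_SG[of "sum_list \<mu>"] by blast
  have "\<phi> (canon_tab \<mu> (act q a)) = \<phi> (canon_tab \<mu> a)" if a: "a \<in> {1..sum_list \<mu>}" for a
  proof -
    obtain y where y: "y \<in> ferrers \<mu>" "\<phi> y = \<phi> (canon_tab \<mu> a)" "p (tableau \<mu> (canon_tab \<mu> a)) = tableau \<mu> y"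
      using p canon_tab_mem[OF a] by blast
    then have "act q a = tableau \<mu> y" using tableau_canon_tab[OF a] q(2) by simp
    then show ?thesis using y(1,2) by simp
  qed
  then show "p \<in> ?L" using q by (auto simp: level_group_def)
qed

lemma row_group_eq: "row_group \<mu> = act ` rowG (sum_list \<mu>) (canon_tab \<mu>)"
  unfolding canonical_level_group row_group_def
proof (intro Collect_cong conj_cong refl ball_cong)
  fix p x
  have "(\<exists>j. P (i, j)) \<longleftrightarrow> (\<exists>y. fst y = i \<and> P y)" for P and i :: nat
    by (metis fst_conv prod.collapse)
  from this[of "\<lambda>y. y \<in> ferrers \<mu> \<and> p (tableau \<mu> x) = tableau \<mu> y" "fst x"]
  show "(case x of (i, j) \<Rightarrow> \<exists>j'. (i, j') \<in> ferrers \<mu> \<and> p (tableau \<mu> (i, j)) = tableau \<mu> (i, j')) \<longleftrightarrow>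
      (\<exists>y\<in>ferrers \<mu>. fst y = fst x \<and> p (tableau \<mu> x) = tableau \<mu> y)"
    by (auto simp: Bex_def split: prod.splits)
qed

lemma column_group_eq: "column_group \<mu> = act ` colG (sum_list \<mu>) (canon_tab \<mu>)"
  unfolding canonical_level_group column_group_def
proof (intro Collect_cong conj_cong refl ball_cong)
  fix p x
  have "(\<exists>i. P (i, j)) \<longleftrightarrow> (\<exists>y. snd y = j \<and> P y)" for P and j :: nat
    by (metis snd_conv prod.collapse)
  from this[of "\<lambda>y. y \<in> ferrers \<mu> \<and> p (tableau \<mu> x) = tableau \<mu> y" "snd x"]
  show "(case x of (i, j) \<Rightarrow> \<exists>i'. (i', j) \<in> ferrers \<mu> \<and> p (tableau \<mu> (i, j)) = tableau \<mu> (i', j)) \<longleftrightarrow>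
      (\<exists>y\<in>ferrers \<mu>. snd y = snd x \<and> p (tableau \<mu> x) = tableau \<mu> y)"
    by (auto simp: Bex_def split: prod.splits)
qed

lemma young_symmetrizer_eq: "young_symmetrizer \<mu> = emb (ysym (sum_list \<mu>) (canon_tab \<mu>))"
proof -
  let ?m = "sum_list \<mu>" and ?T = "canon_tab \<mu>"
  have inj: "inj_on act A" for A by (simp add: inj_on_def act_inject)
  have "row_symmetrizer \<mu> = emb (sym_sum (rowG ?m ?T))"
    unfolding row_symmetrizer_def row_group_eq sym_sum_def emb_sum emb_gel sum.reindex[OF inj] by simp
  moreover have "column_antisymmetrizer \<mu> = emb (alt_sum (colG ?m ?T))"
    unfolding column_antisymmetrizer_def column_group_eq alt_sum_def emb_sum emb_scal emb_gel
      sum.reindex[OF inj] by (simp add: psgn_def)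
  ultimately show ?thesis
    unfolding young_symmetrizer_def ysym_def using emb_mult[OF row.sym_sum_in] by simp
qed

lemma grp_mult_linear_right: "Vector_Spaces.linear fun_scale fun_scale (grp_mult n f)"
  by unfold_locales
    (auto simp: grp_mult_def fun_eq_iff fun_scale_def algebra_simps sum.distrib sum_distrib_left)

lemma grp_mult_linear_left: "Vector_Spaces.linear fun_scale fun_scale (\<lambda>f. grp_mult n f h)"
  by unfold_locales
    (auto simp: grp_mult_def fun_eq_iff fun_scale_def algebra_simps sum.distrib sum_distrib_left)

lemma tr_same_shape:
  assumes T: "is_tableau n F T" "is_tableau n F T'" and z: "z \<in> galg (SG n)"
  shows "tr (SG n) z (yidem n T') = tr (SG n) z (yidem n T)"
proof -
  obtain g where g: "g \<in> SG n" "yidem n T' = gel g * yidem n T * gel (- g)"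
    using yidem_conj_same_shape[OF T] by blast
  have "tr (SG n) z (gel g * yidem n T * gel (- g)) = tr (SG n) z (gel (- g) * (gel g * yidem n T))"
    using g(1) by (intro SG.tr_commute_right z SG.galg_mult yidem_in) (simp_all add: SG.uminus_mem)
  also have "gel (- g) * (gel g * yidem n T) = yidem n T"
    by (simp add: gel_mult flip: mult.assoc)
  finally show ?thesis unfolding g(2) .
qed

text \<open>The Specht module \<open>A c\<close> is also \<open>A e\<close> for the normalized
  idempotent, and right multiplication by \<open>e\<close> projects \<open>A\<close> onto it. So the
  trace over an unspecified basis becomes a sum over permutations. The tableau is left arbitrary,
  since adding a cell to a canonical tableau need not give a canonical one.\<close>

lemma irr_char_eq_tr:
  assumes \<mu>: "is_partition m \<mu>" and s: "s \<in> SG m" and T: "is_tableau m (ferrers \<mu>) T"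
  shows "irr_char \<mu> (act s) = tr (SG m) (gel s) (yidem m T)"
proof -
  have m: "sum_list \<mu> = m" using \<mu> by (simp add: is_partition_def)
  let ?T = "canon_tab \<mu>"
  have T0: "is_tableau m (ferrers \<mu>) ?T" by (rule is_tableau_canon_tab[OF \<mu>])
  let ?c = "ysym m ?T" and ?e = "yidem m ?T"
  let ?V = "specht_module \<mu>"
  have V: "?V = (\<lambda>f. emb (f * ?c)) ` galg (SG m)"
  proof (intro equalityI subsetI)
    fix v assume "v \<in> ?V"
    then obtain h where h: "h \<in> grp_alg m" "v = grp_mult m h (emb ?c)"
      unfolding specht_module_def young_symmetrizer_eq m by blast
    obtain f where f: "f \<in> galg (SG m)" "emb f = h" using emb_surj[OF h(1)] by blast
    then have "v = emb (f * ?c)" using h(2) emb_mult[OF f(1)] by simp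
    then show "v \<in> (\<lambda>f. emb (f * ?c)) ` galg (SG m)" using f(1) by blast
  next
    fix v assume "v \<in> (\<lambda>f. emb (f * ?c)) ` galg (SG m)"
    then obtain f where f: "f \<in> galg (SG m)" "v = emb (f * ?c)" by blast
    then have "v = grp_mult m (emb f) (emb ?c)" using emb_mult by simp
    then show "v \<in> ?V"
      unfolding specht_module_def young_symmetrizer_eq m using emb_in[OF f(1)] by blast
  qed
  have sub: "fun_space.subspace ?V"
    unfolding fun_space.subspace_def
  proof (intro conjI ballI allI)
    show "0 \<in> ?V" unfolding V by (rule image_eqI[of _ _ 0]) (simp_all add: emb_0)
    fix v assume "v \<in> ?V"
    then obtain f where f: "f \<in> galg (SG m)" "v = emb (f * ?c)" unfolding V by blast
    have "fun_scale a v = emb (scal a * f * ?c)" for a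
      unfolding f(2) emb_scal[symmetric] by (simp only: mult.assoc)
    then show "fun_scale a v \<in> ?V" for a
      unfolding V using galg_scal_mult[OF f(1)] by blast
    fix w assume "w \<in> ?V"
    then obtain h where h: "h \<in> galg (SG m)" "w = emb (h * ?c)" unfolding V by blast
    have "v + w = emb ((f + h) * ?c)" unfolding f(2) h(2) by (simp add: distrib_right emb_add)
    then show "v + w \<in> ?V" unfolding V using galg_add[OF f(1) h(1)] by blast
  qed
  have supp: "?V \<subseteq> {f. \<forall>x. x \<notin> sym_grp m \<longrightarrow> f x = 0}"
  proof
    fix v assume "v \<in> ?V"
    then obtain f where f: "f \<in> galg (SG m)" "v = emb (f * ?c)" unfolding V by blast
    have "f * ?c \<in> galg (SG m)" using f(1) by (intro SG.galg_mult ysym_in)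
    then show "v \<in> {f. \<forall>x. x \<notin> sym_grp m \<longrightarrow> f x = 0}"
      using emb_in f(2) unfolding grp_alg_def by blast
  qed
  have ce: "?c * ?e = ?c"
    unfolding yidem_def scal_left_commute[of ?c] ysym_square[OF T0] scal_mult_assoc
    using kap_ne_0[OF T0] by simp
  have "irr_char \<mu> (act s) = (\<Sum>g\<in>sym_grp m. grp_mult m (grp_elt (act s))
      (grp_mult m (\<lambda>h. if h = g then 1 else 0) (emb ?e)) g)"
    unfolding irr_char_def m
  proof (rule trace_on_eq_sum[OF finite_sym_grp sub supp grp_mult_linear_left grp_mult_linear_right])
    fix f :: "(nat \<Rightarrow> nat) \<Rightarrow> complex" assume "\<And>x. x \<notin> sym_grp m \<Longrightarrow> f x = 0"
    then have "f \<in> grp_alg m" by (simp add: grp_alg_def)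
    then obtain h where h: "h \<in> galg (SG m)" "emb h = f" using emb_surj by blast
    have "grp_mult m f (emb ?e) = emb (h * ?e)" unfolding h(2)[symmetric] emb_mult[OF h(1)] ..
    also have "h * ?e = scal (1 / kap m ?T) * h * ?c"
      unfolding yidem_def scal_left_commute[of h] by (rule mult.assoc[symmetric])
    finally show "grp_mult m f (emb ?e) \<in> ?V"
      unfolding V using galg_scal_mult[OF h(1)] by blast
  next
    fix f assume "f \<in> ?V"
    then obtain h where h: "h \<in> galg (SG m)" "f = emb (h * ?c)" unfolding V by blast
    have hc: "h * ?c \<in> galg (SG m)" using h(1) by (intro SG.galg_mult ysym_in)
    show "grp_mult m f (emb ?e) = f"
      unfolding h(2) emb_mult[OF hc, symmetric] by (simp only: mult.assoc ce)
    have gs: "gel s \<in> galg (SG m)" using s by simp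
    have "grp_mult m (grp_elt (act s)) f = emb (gel s * h * ?c)"
      unfolding h(2) emb_gel[symmetric] emb_mult[OF gs, symmetric] by (simp only: mult.assoc)
    then show "grp_mult m (grp_elt (act s)) f \<in> ?V"
      unfolding V using SG.galg_mult[OF gs h(1)] by blast
  qed
  also have "\<dots> = (\<Sum>g\<in>SG m. grp_mult m (grp_elt (act s))
      (grp_mult m (\<lambda>h. if h = act g then 1 else 0) (emb ?e)) (act g))"
    by (rule sum.reindex_bij_betw[OF bij_betw_act_SG, symmetric])
  also have "\<dots> = tr (SG m) (gel s) ?e"
    unfolding tr_def
  proof (intro sum.cong refl)
    fix g assume g: "g \<in> SG m"
    have D: "(\<lambda>h. if h = act g then 1 else 0) = emb (gel g)"
      by (simp add: emb_gel grp_elt_def fun_eq_iff)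
    have gs: "gel s \<in> galg (SG m)" "gel g \<in> galg (SG m)" using s g by simp_all
    show "grp_mult m (grp_elt (act s)) (grp_mult m (\<lambda>h. if h = act g then 1 else 0) (emb ?e)) (act g) =
        coef (gel s * gel g * ?e) g"
      unfolding D emb_gel[symmetric] emb_mult[OF gs(2), symmetric] emb_mult[OF gs(1), symmetric]
      by (simp only: emb_act mult.assoc)
  qed
  also have "\<dots> = tr (SG m) (gel s) (yidem m T)"
    using s by (intro tr_same_shape[OF T T0]) simp
  finally show ?thesis .
qed

lemma irr_char_conj:
  assumes \<mu>: "is_partition m \<mu>" and "s \<in> SG m" "h \<in> SG m"
  shows "irr_char \<mu> (act (h + s - h)) = irr_char \<mu> (act s)"
proof -
  have "h + s - h \<in> SG m"
    unfolding diff_conv_add_uminus using assms(2,3) by (intro SG.add_mem SG.uminus_mem)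
  moreover have "gel (h + s - h) = gel h * gel s * gel (- h)"
    by (simp add: gel_mult)
  ultimately show ?thesis
    using assms irr_char_eq_tr[OF \<mu> _ is_tableau_canon_tab[OF \<mu>]] SG.tr_conj_left by metis
qed

section \<open>Cycle types\<close>

lemma bij_image_mset_eq:
  fixes f :: "'a \<Rightarrow> 'c" and g :: "'b \<Rightarrow> 'c"
  assumes "finite A" "finite B" "image_mset f (mset_set A) = image_mset g (mset_set B)"
  obtains \<beta> where "bij_betw \<beta> A B" "\<And>x. x \<in> A \<Longrightarrow> g (\<beta> x) = f x"
proof -
  have "card A = card B"
    using assms(3) by (metis size_image_mset size_mset_set)
  then obtain \<gamma> where \<gamma>: "bij_betw \<gamma> A B"
    using assms(1,2) by (metis bij_betw_iff_card)
  have eq: "image_mset f (mset_set A) = image_mset (g \<circ> \<gamma>) (mset_set A)"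
    using assms(3) image_mset_mset_set[of \<gamma> A] \<gamma>
    by (simp add: bij_betw_def flip: multiset.map_comp)
  from image_mset_eq_implies_permutes[OF assms(1) eq]
  obtain p where p: "p permutes A" "\<forall>x\<in>A. f x = (g \<circ> \<gamma>) (p x)" .
  show thesis
  proof
    show "bij_betw (\<gamma> \<circ> p) A B" using permutes_imp_bij[OF p(1)] \<gamma> by (rule bij_betw_trans)
    show "g ((\<gamma> \<circ> p) x) = f x" if "x \<in> A" for x using p(2) that by simp
  qed
qed

lemma orbit_enum:
  assumes "a \<in> orbit f a"
  shows "bij_betw (\<lambda>k. (f ^^ k) a) {0..<card (orbit f a)} (orbit f a)" "(f ^^ card (orbit f a)) a = a"
proof -
  let ?N = "funpow_dist1 f a a"
  have bij: "bij_betw (\<lambda>k. (f ^^ k) a) {0..<?N} (orbit f a)"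
    unfolding bij_betw_def using inj_on_funpow_dist1[OF assms] orbit_conv_funpow_dist1[OF assms] by simp
  then have N: "card (orbit f a) = ?N" using bij_betw_same_card by fastforce
  show "bij_betw (\<lambda>k. (f ^^ k) a) {0..<card (orbit f a)} (orbit f a)" unfolding N by (rule bij)
  show "(f ^^ card (orbit f a)) a = a" unfolding N by (rule funpow_dist1_prop[OF assms])
qed

text \<open>Match the iterates of \<open>a\<close> with those of \<open>b\<close>; equal orbit sizes
  make the two cycles close at the same step.\<close>

lemma orbit_intertwiner:
  assumes a: "a \<in> orbit f a" and b: "b \<in> orbit g b" and card: "card (orbit f a) = card (orbit g b)"
  obtains h where "bij_betw h (orbit f a) (orbit g b)" "\<And>x. x \<in> orbit f a \<Longrightarrow> h (f x) = g (h x)"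
proof -
  let ?N = "card (orbit f a)"
  note fa = orbit_enum[OF a] and gb = orbit_enum[OF b, folded card]
  define \<iota> where "\<iota> = inv_into {0..<?N} (\<lambda>k. (f ^^ k) a)"
  have \<iota>: "\<iota> ((f ^^ k) a) = k" if "k < ?N" for k
    unfolding \<iota>_def using bij_betw_inv_into_left[OF fa(1), of k] that by simp
  show thesis
  proof
    show "bij_betw ((\<lambda>k. (g ^^ k) b) \<circ> \<iota>) (orbit f a) (orbit g b)"
      unfolding \<iota>_def by (rule bij_betw_trans[OF bij_betw_inv_into[OF fa(1)] gb(1)])
    fix x assume "x \<in> orbit f a"
    then have "x \<in> (\<lambda>k. (f ^^ k) a) ` {0..<?N}" using bij_betw_imp_surj_on[OF fa(1)] by simp
    then obtain k where "k \<in> {0..<?N}" and kx: "x = (f ^^ k) a" by blast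
    then have k: "k < ?N" "x = (f ^^ k) a" by simp_all
    have "(g ^^ \<iota> (f x)) b = (g ^^ Suc k) b"
    proof (cases "Suc k = ?N")
      case True
      then have "f x = (f ^^ 0) a" using fa(2) k(2) by (metis funpow.simps(2) funpow_0 comp_apply)
      moreover have "\<iota> ((f ^^ 0) a) = 0" using k(1) by (intro \<iota>) simp
      ultimately show ?thesis unfolding True gb(2) by simp
    next
      case False
      then have "\<iota> ((f ^^ Suc k) a) = Suc k" using k(1) by (intro \<iota>) simp
      then show ?thesis using k(2) by simp
    qed
    then show "((\<lambda>k. (g ^^ k) b) \<circ> \<iota>) (f x) = g (((\<lambda>k. (g ^^ k) b) \<circ> \<iota>) x)"
      using \<iota>[OF k(1)] k(2) by simp
  qed
qed

lemma permutes_orbit_facts: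
  assumes "p permutes {1..n::nat}"
  shows "x \<in> orbit p x" "a \<in> {1..n} \<Longrightarrow> orbit p a \<subseteq> {1..n}"
    "y \<in> orbit p x \<Longrightarrow> orbit p y = orbit p x"
proof -
  have "permutation p" using assms permutation_permutes by blast
  then show "x \<in> orbit p x" by (rule permutation_self_in_orbit)
  show "a \<in> {1..n} \<Longrightarrow> orbit p a \<subseteq> {1..n}" by (rule permutes_orbit_subset[OF assms])
  show "y \<in> orbit p x \<Longrightarrow> orbit p y = orbit p x"
    using cyclic_on_orbit'[OF \<open>permutation p\<close>] by (rule orbit_cyclic_eq3)
qed

text \<open>Equal multisets of orbit sizes give a size-preserving bijection between the orbits.
  Intertwiners of matched orbits are glued to the conjugating permutation.\<close>

lemma same_cycle_type_conj:
  assumes s: "s \<in> SG n" and t: "t \<in> SG n" and eq: "cycle_type n (act s) = cycle_type n (act t)"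
  obtains h where "h \<in> SG n" "t = h + s - h"
proof -
  let ?A = "{1..n}" and ?f = "act s" and ?g = "act t"
  have f: "?f permutes ?A" and g: "?g permutes ?A" using s t by (simp_all add: SG_def)
  note fo = permutes_orbit_facts[OF f] and go = permutes_orbit_facts[OF g]
  obtain \<beta> where \<beta>: "bij_betw \<beta> (orbit ?f ` ?A) (orbit ?g ` ?A)"
    and card: "\<And>C. C \<in> orbit ?f ` ?A \<Longrightarrow> card (\<beta> C) = card C"
    using bij_image_mset_eq[of "orbit ?f ` ?A" "orbit ?g ` ?A" card card] eq
    unfolding cycle_type_def by blast
  have "\<exists>h. bij_betw h C (\<beta> C) \<and> (\<forall>x\<in>C. h (?f x) = ?g (h x))" if C: "C \<in> orbit ?f ` ?A" for C
  proof -
    obtain a where a: "C = orbit ?f a" using C by blast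
    have "\<beta> C \<in> orbit ?g ` ?A" using \<beta> C by (rule bij_betw_apply)
    then obtain b where b: "\<beta> C = orbit ?g b" by blast
    have "card (orbit ?f a) = card (orbit ?g b)" using card[OF C] a b by simp
    from orbit_intertwiner[OF fo(1) go(1) this] show ?thesis unfolding a b[unfolded a] by metis
  qed
  then obtain H where H: "\<And>C. C \<in> orbit ?f ` ?A \<Longrightarrow> bij_betw (H C) C (\<beta> C)"
    "\<And>C x. C \<in> orbit ?f ` ?A \<Longrightarrow> x \<in> C \<Longrightarrow> H C (?f x) = ?g (H C x)" by metis
  define h where "h x = (if x \<in> ?A then H (orbit ?f x) x else x)" for x
  have hmem: "h x \<in> \<beta> (orbit ?f x)" if "x \<in> ?A" for x
    using bij_betw_apply[OF H(1) fo(1), of x] that by (simp add: h_def)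
  have \<beta>mem: "\<beta> (orbit ?f x) \<in> orbit ?g ` ?A" if "x \<in> ?A" for x
    using bij_betw_apply[OF \<beta>] that by blast
  have "h ` ?A \<subseteq> ?A"
  proof
    fix y assume "y \<in> h ` ?A"
    then obtain x where x: "x \<in> ?A" "y = h x" by blast
    obtain b where "b \<in> ?A" "\<beta> (orbit ?f x) = orbit ?g b" using \<beta>mem[OF x(1)] by blast
    then show "y \<in> ?A" using go(2)[of b] hmem[OF x(1)] x(2) by blast
  qed
  moreover have "inj_on h ?A"
  proof (rule inj_onI)
    fix x y assume x: "x \<in> ?A" and y: "y \<in> ?A" and "h x = h y"
    obtain b c where bc: "\<beta> (orbit ?f x) = orbit ?g b" "\<beta> (orbit ?f y) = orbit ?g c"
      using \<beta>mem[OF x] \<beta>mem[OF y] by blast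
    have "orbit ?g (h x) = orbit ?g b" "orbit ?g (h y) = orbit ?g c"
      using go(3) hmem[OF x] hmem[OF y] bc by blast+
    then have "\<beta> (orbit ?f x) = \<beta> (orbit ?f y)" using \<open>h x = h y\<close> bc by simp
    then have o: "orbit ?f x = orbit ?f y"
      using \<beta> x y unfolding bij_betw_def by (meson imageI inj_onD)
    then have "H (orbit ?f x) x = H (orbit ?f x) y" using \<open>h x = h y\<close> x y by (simp add: h_def)
    moreover have "inj_on (H (orbit ?f x)) (orbit ?f x)" using H(1) x by (simp add: bij_betw_def)
    moreover have "x \<in> orbit ?f x" "y \<in> orbit ?f x" using fo(1)[of x] fo(1)[of y] o by simp_all
    ultimately show "x = y" by (meson inj_onD)
  qed
  ultimately have "bij_betw h ?A ?A" by (simp add: bij_betw_def endo_inj_surj)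
  then have h: "h permutes ?A" by (intro bij_imp_permutes) (auto simp: h_def)
  define k where "k = Abs_nat_perm h"
  have k: "k \<in> SG n" "act k = h" using h by (auto simp: k_def Abs_in_SG permutes_bij)
  have comm: "h (?f x) = ?g (h x)" for x
  proof (cases "x \<in> ?A")
    case True
    have "?f x \<in> orbit ?f x" by (rule orbit.base)
    then have "orbit ?f (?f x) = orbit ?f x" by (rule fo(3))
    moreover have "?f x \<in> ?A" using SG_act[OF s True] .
    ultimately show ?thesis using H(2)[OF imageI[OF True] fo(1)] True by (simp add: h_def)
  next
    case False
    then have "h x = x" unfolding h_def by (rule if_not_P)
    then show ?thesis using SG_act_outside[OF s False] SG_act_outside[OF t False] by simp
  qed
  have "k + s = t + k" by (rule nat_perm_eqI) (simp add: k(2) comm)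
  then have "t = k + s - k" by (simp add: add.assoc)
  then show thesis using that k(1) by blast
qed

lemma cycle_type_conj:
  assumes s: "s \<in> SG n" and h: "h \<in> SG n"
  shows "cycle_type n (act (h + s - h)) = cycle_type n (act s)"
proof -
  let ?A = "{1..n}" and ?f = "act s" and ?g = "act (h + s - h)"
  have f: "?f permutes ?A" using s by (simp add: SG_def)
  have orb: "act h ` orbit ?f a = orbit ?g (act h a)" for a
    by (rule orbit_inverse[OF permutes_orbit_facts(1)[OF f]])
      (simp add: diff_conv_add_uminus del: add_uminus_conv_diff)
  have "act h ` ?A = ?A" using h by (simp add: SG_def permutes_image)
  then have "orbit ?g ` ?A = orbit ?g ` act h ` ?A" by simp
  also have "\<dots> = image (act h) ` orbit ?f ` ?A" by (simp add: image_image orb)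
  finally have C: "orbit ?g ` ?A = image (act h) ` orbit ?f ` ?A" .
  have inj: "inj (act h)" by (simp add: bij_is_inj)
  then have "inj_on (image (act h)) (orbit ?f ` ?A)" by (simp add: inj_on_def inj_image_eq_iff)
  then have "mset_set (orbit ?g ` ?A) = image_mset (image (act h)) (mset_set (orbit ?f ` ?A))"
    unfolding C by (simp add: image_mset_mset_set)
  moreover have "card (act h ` C) = card C" for C
    using inj by (simp add: card_image inj_on_subset)
  ultimately show ?thesis by (simp add: cycle_type_def multiset.map_comp comp_def)
qed

lemma cycle_type_Suc:
  assumes s: "s \<in> SG m"
  shows "cycle_type (Suc m) (act s) = add_mset 1 (cycle_type m (act s))"
proof -
  have f: "act s permutes {1..m}" using s by (simp add: SG_def)
  have "orbit (act s) (Suc m) = {Suc m}"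
    using SG_act_outside[OF s, of "Suc m"] by (simp add: orbit_eq_singleton_iff)
  moreover have "{1..Suc m} = insert (Suc m) {1..m}" by auto
  ultimately have "orbit (act s) ` {1..Suc m} = insert {Suc m} (orbit (act s) ` {1..m})" by simp
  moreover have "{Suc m} \<notin> orbit (act s) ` {1..m}"
  proof
    assume "{Suc m} \<in> orbit (act s) ` {1..m}"
    then obtain a where a: "a \<in> {1..m}" "{Suc m} = orbit (act s) a" by blast
    then have "Suc m \<in> {1..m}" using permutes_orbit_facts(2)[OF f a(1)] by blast
    then show False by simp
  qed
  ultimately show ?thesis by (simp add: cycle_type_def)
qed

text \<open>The description by \<open>THE\<close> has a unique solution because permutations of
  equal cycle type are conjugate and the character is invariant under conjugation.\<close>

lemma irr_char_at_type_eq: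
  assumes \<mu>: "is_partition m \<mu>" and s: "s \<in> SG m"
  shows "irr_char_at_type \<mu> (cycle_type m (act s)) = irr_char \<mu> (act s)"
  unfolding irr_char_at_type_def
proof (rule the_equality)
  have m: "sum_list \<mu> = m" using \<mu> by (simp add: is_partition_def)
  show "\<exists>\<tau>\<in>sym_grp (sum_list \<mu>). cycle_type (sum_list \<mu>) \<tau> = cycle_type m (act s) \<and> irr_char \<mu> (act s) = irr_char \<mu> \<tau>"
    unfolding m act_image_SG[symmetric] using s by blast
  fix v assume "\<exists>\<tau>\<in>sym_grp (sum_list \<mu>). cycle_type (sum_list \<mu>) \<tau> = cycle_type m (act s) \<and> v = irr_char \<mu> \<tau>"
  then obtain t where t: "t \<in> SG m" "cycle_type m (act s) = cycle_type m (act t)" "v = irr_char \<mu> (act t)"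
    unfolding m act_image_SG[symmetric] by auto
  obtain h where "h \<in> SG m" "t = h + s - h" using same_cycle_type_conj[OF s t(1,2)] by blast
  then show "v = irr_char \<mu> (act s)" using irr_char_conj[OF \<mu> s] t(3) by simp
qed

section \<open>The trace of the Jucys--Murphy element\<close>

lemma SG_fix_last:
  assumes "p \<in> SG (Suc m)" "act p (Suc m) = Suc m"
  shows "p \<in> SG m"
proof -
  have "act p permutes {1..Suc m}" using assms(1) by (simp add: SG_def)
  then have "act p permutes {1..m}"
    by (rule permutes_superset) (use assms(2) in \<open>auto simp: le_Suc_eq\<close>)
  then show ?thesis by (simp add: SG_def)
qed

text \<open>Only the transposition that moves the last point back where \<open>g\<inverse> \<sigma>\<inverse> g\<close> took it from
  yields a permutation in the support of \<open>e\<close>.\<close>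
lemma coef_jucys_murphy_conj:
  assumes s: "s \<in> SG (Suc m)" and g: "g \<in> SG (Suc m)" and j: "act g (Suc m) = act s j"
    and e: "e \<in> galg (SG m)"
  shows "coef (gel s * gel g * (sym_sum (last_transps m) * e)) g =
    (if act s j = j then 0 else coef e (- g - (s + tperm j (act s j)) + g))"
proof -
  let ?n = "Suc m" and ?w = "- g - s + g"
  have fin: "finite (last_transps m)" by (rule finite_last_transps)
  have "coef (gel s * gel g * (sym_sum (last_transps m) * e)) g = coef (sym_sum (last_transps m) * e) ?w"
    unfolding gel_mult by (simp add: minus_add)
  also have "\<dots> = (\<Sum>t\<in>last_transps m. coef e (- t + ?w))"
    unfolding sym_sum_def sum_distrib_right lookup_sum by simp
  also have "\<dots> = (\<Sum>t\<in>last_transps m. if act s j \<noteq> j \<and> t = tperm (act (- g) j) ?n then coef e (t + ?w) else 0)"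
  proof (intro sum.cong refl)
    fix t assume "t \<in> last_transps m"
    then obtain a where a: "a \<in> {1..m}" "t = tperm a ?n" by (auto simp: last_transps_def)
    have t: "- t = t" using a(2) by simp
    have w: "act ?w ?n = act (- g) j"
      by (simp add: diff_conv_add_uminus j del: add_uminus_conv_diff)
    show "coef e (- t + ?w) = (if act s j \<noteq> j \<and> t = tperm (act (- g) j) ?n then coef e (t + ?w) else 0)"
    proof (cases "t + ?w \<in> SG m")
      case True
      then have "act t (act (- g) j) = ?n" using SG_act_outside[OF True, of ?n] w by simp
      then have aj: "act (- g) j = a"
        using a by (auto simp: Transposition.transpose_def split: if_splits)
      have "act s j \<noteq> j"
      proof
        assume "act s j = j"
        then have "act (- g) j = ?n" using j by (metis act_uminus_act)
        then show False using aj a(1) by simp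
      qed
      then show ?thesis using aj a(2) t by simp
    next
      case False
      then have "coef e (t + ?w) = 0" using e by (simp add: galg_iff)
      then show ?thesis unfolding t by (simp only: if_cancel)
    qed
  qed
  also have "\<dots> = (if act s j = j then 0 else coef e (- g - (s + tperm j (act s j)) + g))"
  proof (cases "act s j = j")
    case False
    have "j \<in> {1..?n}"
    proof (rule ccontr)
      assume "j \<notin> {1..?n}"
      then show False using SG_act_outside[OF s] False by blast
    qed
    then have "act (- g) j \<in> {1..?n}" using SG_act[OF SG.uminus_mem[OF g]] by blast
    moreover have "act (- g) j \<noteq> ?n"
    proof
      assume "act (- g) j = ?n"
      then have "act g ?n = j" by (metis act_act_uminus)
      then show False using j False by simp
    qed
    ultimately have "act (- g) j \<in> {1..m}" by (simp add: le_Suc_eq)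
    then have mem: "tperm (act (- g) j) ?n \<in> last_transps m" by (simp add: last_transps_def)
    have n: "act (- g) (act s j) = ?n" unfolding j[symmetric] by simp
    have "tperm (act (- g) j) ?n = - g + tperm j (act s j) + g"
      using tperm_conj[of "- g" j "act s j"] n by simp
    then have "tperm (act (- g) j) ?n + ?w = - g + (tperm j (act s j) - s) + g"
      by (simp add: add.assoc diff_conv_add_uminus del: add_uminus_conv_diff)
    also have "\<dots> = - g - (s + tperm j (act s j)) + g"
      by (simp add: diff_conv_add_uminus minus_add add.assoc del: add_uminus_conv_diff)
    finally show ?thesis using False mem fin by simp
  qed simp
  finally show ?thesis .
qed

text \<open>The permutations \<open>g\<close> are grouped by the \<open>j\<close> with
  \<open>act g (Suc m) = act s j\<close>. Each group is a coset of \<open>SG m\<close> represented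
  by \<open>tperm (Suc m) (act s j)\<close>. Translating by the representative leaves a trace over
  \<open>SG m\<close>, at a conjugate of \<open>s + tperm j (act s j)\<close>; the fixed points of
  \<open>s\<close> contribute nothing.\<close>

lemma tr_jucys_murphy_conj:
  assumes s: "s \<in> SG (Suc m)" and e: "e \<in> galg (SG m)"
  shows "tr (SG (Suc m)) (gel s) (sym_sum (last_transps m) * e) =
    (\<Sum>j\<in>{j\<in>{1..Suc m}. act s j \<noteq> j}.
      tr (SG m) (gel (- tperm (Suc m) (act s j) + (s + tperm j (act s j)) + tperm (Suc m) (act s j))) e)"
proof -
  let ?n = "Suc m" and ?S = "SG (Suc m)"
  let ?\<pi> = "\<lambda>j. s + tperm j (act s j)" and ?g = "\<lambda>j. tperm (Suc m) (act s j)"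
  let ?X = "sym_sum (last_transps m) * e"
  have "tr ?S (gel s) ?X = (\<Sum>j\<in>{1..?n}. \<Sum>g\<in>{g \<in> ?S. act (- s) (act g ?n) = j}. coef (gel s * gel g * ?X) g)"
    unfolding tr_def
  proof (rule sum.group[symmetric])
    show "(\<lambda>g. act (- s) (act g ?n)) ` ?S \<subseteq> {1..?n}"
      using SG_act[OF SG.uminus_mem[OF s]] SG_act[of _ ?n ?n] by force
  qed (simp_all add: SG.fin)
  also have "\<dots> = (\<Sum>j\<in>{1..?n}. if act s j = j then 0 else
      (\<Sum>g\<in>{g \<in> ?S. act (- s) (act g ?n) = j}. coef e (- g - ?\<pi> j + g)))"
  proof (intro sum.cong refl)
    fix j
    have "coef (gel s * gel g * ?X) g = (if act s j = j then 0 else coef e (- g - ?\<pi> j + g))"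
      if "g \<in> {g \<in> ?S. act (- s) (act g ?n) = j}" for g
    proof (rule coef_jucys_murphy_conj[OF s _ _ e])
      show "g \<in> ?S" using that by simp
      show "act g ?n = act s j" using that by auto
    qed
    then show "(\<Sum>g\<in>{g \<in> ?S. act (- s) (act g ?n) = j}. coef (gel s * gel g * ?X) g) =
        (if act s j = j then 0 else (\<Sum>g\<in>{g \<in> ?S. act (- s) (act g ?n) = j}. coef e (- g - ?\<pi> j + g)))"
      by (cases "act s j = j") simp_all
  qed
  also have "\<dots> = (\<Sum>j\<in>{j\<in>{1..?n}. act s j \<noteq> j}.
      \<Sum>g\<in>{g \<in> ?S. act (- s) (act g ?n) = j}. coef e (- g - ?\<pi> j + g))"
    by (subst sum.inter_filter) (auto intro!: sum.cong)
  also have "\<dots> = (\<Sum>j\<in>{j\<in>{1..?n}. act s j \<noteq> j}. tr (SG m) (gel (- ?g j + ?\<pi> j + ?g j)) e)"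
  proof (intro sum.cong refl)
    fix j assume "j \<in> {j\<in>{1..?n}. act s j \<noteq> j}"
    then have sj: "act s j \<in> {1..?n}" using SG_act[OF s] by blast
    have g: "?g j \<in> ?S" using sj by (intro tperm_in_SG) simp_all
    have gn: "act (?g j) ?n = act s j" by simp
    have "(\<Sum>g\<in>{g \<in> ?S. act (- s) (act g ?n) = j}. coef e (- g - ?\<pi> j + g)) =
        (\<Sum>h\<in>SG m. coef e (- (?g j + h) - ?\<pi> j + (?g j + h)))"
    proof (rule sum.reindex_bij_witness[of _ "\<lambda>h. ?g j + h" "\<lambda>g. - ?g j + g"])
      fix g assume g': "g \<in> {g \<in> ?S. act (- s) (act g ?n) = j}"
      then have "act g ?n = act s j" by auto
      then have "act (- ?g j + g) ?n = ?n" using gn by (metis act_add_apply act_uminus_act)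
      moreover have "- ?g j + g \<in> ?S" using g g' by (intro SG.add_mem SG.uminus_mem) auto
      ultimately show "- ?g j + g \<in> SG m" by (rule SG_fix_last[rotated])
      have "?g j + (- ?g j + g) = g" by (simp only: add_minus_cancel)
      then show "?g j + (- ?g j + g) = g" .
      then show "coef e (- (?g j + (- ?g j + g)) - ?\<pi> j + (?g j + (- ?g j + g))) = coef e (- g - ?\<pi> j + g)"
        by (simp only:)
    next
      fix h assume h: "h \<in> SG m"
      show "- ?g j + (?g j + h) = h" by (simp only: minus_add_cancel)
      have "h \<in> ?S" using h SG_mono[of m ?n] by auto
      moreover have "act h ?n = ?n" using SG_act_outside[OF h] by simp
      ultimately show "?g j + h \<in> {g \<in> ?S. act (- s) (act g ?n) = j}"
        using SG.add_mem[OF g] gn by simp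
    qed
    also have "\<dots> = tr (SG m) (gel (- ?g j + ?\<pi> j + ?g j)) e"
      unfolding SG.tr_gel
      by (intro sum.cong refl arg_cong[where f = "coef e"])
        (simp only: diff_conv_add_uminus minus_add minus_minus add.assoc)
    finally show "(\<Sum>g\<in>{g \<in> ?S. act (- s) (act g ?n) = j}. coef e (- g - ?\<pi> j + g)) =
        tr (SG m) (gel (- ?g j + ?\<pi> j + ?g j)) e" .
  qed
  finally show ?thesis .
qed

theorem theorem3:
  fixes n :: nat and \<mu> :: "nat list" and \<sigma> :: "nat \<Rightarrow> nat"
  assumes "n \<ge> 2"
    and "is_partition (n - 1) \<mu>"
    and "\<sigma> \<in> sym_grp n"
  shows "(\<forall>i\<in>{1..n}. \<sigma> i \<noteq> i \<longrightarrow>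
            (\<exists>j\<in>{1..n}. (\<sigma> \<circ> Transposition.transpose i (\<sigma> i)) j = j)) \<and>
         (\<Sum>i\<in>{i\<in>{1..n}. \<sigma> i \<noteq> i}.
            irr_char_at_type \<mu> (cycle_type n (\<sigma> \<circ> Transposition.transpose i (\<sigma> i)) - {#1#}))
         = (\<Sum>x\<in>addable_cells \<mu>. of_int (cell_content x) * irr_char (add_cell \<mu> x) \<sigma>)"
proof -
  obtain m where n: "n = Suc m" using assms(1) by (cases n) auto
  have \<mu>: "is_partition m \<mu>" using assms(2) n by simp
  obtain s where s: "s \<in> SG n" "\<sigma> = act s" using assms(3) act_image_SG[of n] by blast
  let ?F = "ferrers \<mu>" and ?T = "canon_tab \<mu>"
  have T: "is_tableau m ?F ?T" by (rule is_tableau_canon_tab[OF \<mu>])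
  have sn: "s \<in> SG (Suc m)" using s(1) n by simp
  have fixpt: "\<exists>j\<in>{1..n}. (\<sigma> \<circ> Transposition.transpose i (\<sigma> i)) j = j" if "i \<in> {1..n}" for i
    using SG_act[OF s(1) that] s(2) by (intro bexI[of _ "\<sigma> i"]) simp_all
  have lhs: "irr_char_at_type \<mu> (cycle_type n (\<sigma> \<circ> Transposition.transpose i (\<sigma> i)) - {#1#}) =
      tr (SG m) (gel (- tperm (Suc m) (act s i) + (s + tperm i (act s i)) + tperm (Suc m) (act s i))) (yidem m ?T)"
    if "i \<in> {i\<in>{1..n}. \<sigma> i \<noteq> i}" for i
  proof -
    let ?\<pi> = "s + tperm i (act s i)" and ?g = "tperm (Suc m) (act s i)"
    \<comment> \<open>\<open>?\<pi>\<close> fixes \<open>act s i\<close>. Conjugation by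
      \<open>?g\<close> moves this fixed point to \<open>Suc m\<close>, so \<open>?\<rho>\<close>
      belongs to \<open>SG m\<close>, and its cycle type there is that of \<open>?\<pi>\<close> with
      one part 1 deleted.\<close>
    let ?\<rho> = "- ?g + ?\<pi> + ?g"
    have i: "i \<in> {1..Suc m}" "act s i \<in> {1..Suc m}" using that n SG_act[OF s(1)] by auto
    have g: "?g \<in> SG (Suc m)" using i by (intro tperm_in_SG) simp_all
    have \<pi>: "?\<pi> \<in> SG (Suc m)" using i by (intro SG.add_mem sn tperm_in_SG)
    have "act ?\<rho> (Suc m) = Suc m" by simp
    moreover have "?\<rho> \<in> SG (Suc m)" by (rule SG.add_mem[OF SG.add_mem[OF SG.uminus_mem[OF g] \<pi>] g])
    ultimately have \<rho>: "?\<rho> \<in> SG m" by (rule SG_fix_last[rotated])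
    have "\<sigma> \<circ> Transposition.transpose i (\<sigma> i) = act ?\<pi>" unfolding s(2) by (simp add: act_add)
    moreover have "cycle_type (Suc m) (act ?\<pi>) = cycle_type (Suc m) (act ?\<rho>)"
      using cycle_type_conj[OF \<pi> SG.uminus_mem[OF g]] by (simp only: diff_minus_eq_add)
    ultimately have "cycle_type n (\<sigma> \<circ> Transposition.transpose i (\<sigma> i)) - {#1#} = cycle_type m (act ?\<rho>)"
      unfolding n using cycle_type_Suc[OF \<rho>] by simp
    then show ?thesis
      using irr_char_at_type_eq[OF \<mu> \<rho>] irr_char_eq_tr[OF \<mu> \<rho> T] by simp
  qed
  have "(\<Sum>i\<in>{i\<in>{1..n}. \<sigma> i \<noteq> i}.
      irr_char_at_type \<mu> (cycle_type n (\<sigma> \<circ> Transposition.transpose i (\<sigma> i)) - {#1#})) =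
      tr (SG (Suc m)) (gel s) (sym_sum (last_transps m) * yidem m ?T)"
    unfolding tr_jucys_murphy_conj[OF sn yidem_in] using lhs n s(2) by (intro sum.cong) simp_all
  also have "\<dots> = (\<Sum>x\<in>addable ?F. of_int (cell_content x) *
      tr (SG (Suc m)) (gel s) (yidem (Suc m) (?T(Suc m := x))))"
    using sn by (intro tr_jucys_murphy[OF T]) simp
  also have "\<dots> = (\<Sum>x\<in>addable_cells \<mu>. of_int (cell_content x) * irr_char (add_cell \<mu> x) \<sigma>)"
  proof (intro sum.cong)
    show "addable ?F = addable_cells \<mu>" by (rule addable_cells_eq[OF \<mu>, symmetric])
    fix x assume x: "x \<in> addable_cells \<mu>"
    note c = add_cell[OF \<mu> x]
    have "is_tableau (Suc m) (ferrers (add_cell \<mu> x)) (?T(Suc m := x))"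
      unfolding c(2) using x by (intro tableau_extend[OF T]) (simp add: addable_cells_eq[OF \<mu>])
    then have "irr_char (add_cell \<mu> x) \<sigma> = tr (SG (Suc m)) (gel s) (yidem (Suc m) (?T(Suc m := x)))"
      unfolding s(2) using c(1) sn by (intro irr_char_eq_tr) simp_all
    then show "of_int (cell_content x) * tr (SG (Suc m)) (gel s) (yidem (Suc m) (?T(Suc m := x))) =
        of_int (cell_content x) * irr_char (add_cell \<mu> x) \<sigma>" by simp
  qed
  finally show ?thesis using fixpt by blast
qed

end
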